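(* Let $d\ge2$ and consider the Veronese variety $\mathrm{Ver}(d-1,2)$ with defining matrix $A$. Then $c=(1,1,\ldots,1,1)\notin\Sigma_A$. In particular, $\mathrm{mldeg}(\mathrm{Ver}(d-1,2))=\deg(\mathrm{Ver}(d-1,2))=2^{d-1}$.
   Context: Veronese: $A$ is the $(d-1)\times n$ integer matrix whose columns $a_1,\ldots,a_n$ are all the non-negative integer vectors in $\mathbb{Z}^{d-1}$ with coordinate sum $\le 2$. For $c\in(\mathbb{C}^* )^n$, let $V^c\subset\mathbb{P}^{n-1}$ be the projective variety over $\mathbb{C}$ whose affine cone is the Zariski closure in $\mathbb{C}^n$ of the image of $\psi^c:(\mathbb{C}^* )^d\to(\mathbb{C}^* )^n$, $(s,\theta_1,\ldots,\theta_{d-1})\mapsto(c_1s\theta^{a_1},\ldots,c_ns\theta^{a_n})$. $\mathrm{Ver}(d-1,2)$ is $V=V^{(1,\ldots,1)}$. ML degree: for a projective variety $X\subset\mathbb{P}^{n-1}$ with homogeneous coordinates $[p_1:\cdots:p_n]$ and a vector $u=(u_1,\ldots,u_n)$, let $\ell_u(p)=p_1^{u_1}\cdots p_n^{u_n}/(p_1+\cdots+p_n)^{u_1+\cdots+u_n}$. Let $X_{\mathrm{reg}}$ be the set of smooth points of $X$ and let $\mathcal{H}$ be the union of the coordinate hyperplanes and the hyperplane $p_1+\cdots+p_n=0$. Then $\mathrm{mldeg}(X)$ is the number of complex critical points of $\ell_u$ on $X_{\mathrm{reg}}\setminus\mathcal{H}$ for generic $u$ (this number is well-defined). $\deg$ is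 the degree as a projective variety in $\mathbb{P}^{n-1}$. $A$-resultant: for $g=\sum_i b_i\theta^{a_i}$ write $L_g(p)=\sum_i b_ip_i$. Given $f_1,\ldots,f_d$ with $f_j=\sum_{i=1}^n c_{i,j}\theta^{a_i}$, the $A$-resultant $R_A(f_1,\ldots,f_d)$ is the irreducible polynomial in the coefficients $c_{i,j}$ (unique up to a scalar) which vanishes at $(c_{i,j})$ if and only if $L_{f_1}=\cdots=L_{f_d}=0$ has a solution on the projective variety $V$. Principal $A$-determinant: for $f=\sum_{i=1}^n c_i\theta^{a_i}$, $E_A(f)=R_A\bigl(f,\theta_1\frac{\partial f}{\partial\theta_1},\ldots,\theta_{d-1}\frac{\partial f}{\partial\theta_{d-1}}\bigr)$, a polynomial in $c_1,\ldots,c_n$; $\Sigma_A\subset\mathbb{C}^n$ is its zero locus. *)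

theory Defs
  imports
    "HOL-Analysis.Analysis"
    "HOL-Library.Poly_Mapping"
    "HOL-Computational_Algebra.Polynomial"
begin

section \<open>Multivariate polynomials over the complex numbers\<close>

text \<open>A monomial is a finitely supported exponent vector; the variables are the elements of the
  type of its indices.\<close>

type_synonym 'v cpoly = "('v \<Rightarrow>\<^sub>0 nat) \<Rightarrow>\<^sub>0 complex"

definition monom_degree :: "('v \<Rightarrow>\<^sub>0 nat) \<Rightarrow> nat" where
  "monom_degree m = (\<Sum>v\<in>Poly_Mapping.keys m. Poly_Mapping.lookup m v)"

definition peval :: "'v cpoly \<Rightarrow> ('v \<Rightarrow> complex) \<Rightarrow> complex" where
  "peval F x =
     (\<Sum>m\<in>Poly_Mapping.keys F. Poly_Mapping.lookup F m * (\<Prod>v\<in>Poly_Mapping.keys m. x v ^ Poly_Mapping.lookup m v))"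

definition pvars :: "'v cpoly \<Rightarrow> 'v set" where
  "pvars F = (\<Union>m\<in>Poly_Mapping.keys F. Poly_Mapping.keys m)"

definition pvar :: "'v \<Rightarrow> 'v cpoly" where
  "pvar v = Poly_Mapping.single (Poly_Mapping.single v 1) 1"

text \<open>The exponent subtraction below truncates only where the coefficient vanishes.\<close>

definition partial_deriv :: "'v \<Rightarrow> 'v cpoly \<Rightarrow> 'v cpoly" where
  "partial_deriv v F =
     (\<Sum>m\<in>Poly_Mapping.keys F. Poly_Mapping.single (m - Poly_Mapping.single v 1)
        (of_nat (Poly_Mapping.lookup m v) * Poly_Mapping.lookup F m))"

definition pscale :: "complex \<Rightarrow> 'v cpoly \<Rightarrow> 'v cpoly" where
  "pscale k F = Poly_Mapping.single 0 k * F"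

interpretation cpoly: vector_space "pscale :: complex \<Rightarrow> 'v cpoly \<Rightarrow> 'v cpoly"
  by unfold_locales
    (simp_all add: pscale_def algebra_simps single_add mult_single flip: mult.assoc)

definition homogeneous_forms :: "nat \<Rightarrow> 'v cpoly set" where
  "homogeneous_forms t = {F. \<forall>m\<in>Poly_Mapping.keys F. monom_degree m = t}"


section \<open>Projective varieties\<close>

text \<open>A point of projective space is represented by the set of its homogeneous coordinate
  vectors, and a projective variety by the set of its points.\<close>

type_synonym 'n ppoint = "(complex ^ 'n) set"

definition proj_point :: "complex ^ 'n \<Rightarrow> 'n ppoint" where
  "proj_point p = {k *s p | k. k \<noteq> 0}"

definition zariski_closure :: "(complex ^ 'n::finite) set \<Rightarrow> (complex ^ 'n) set" where
  "zariski_closure S =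
     {p. \<forall>F. (\<forall>q\<in>S. peval F (($) q) = 0) \<longrightarrow> peval F (($) p) = 0}"

definition vanishing_ideal :: "'n::finite ppoint set \<Rightarrow> 'n cpoly set" where
  "vanishing_ideal X = {F. \<forall>P\<in>X. \<forall>p\<in>P. peval F (($) p) = 0}"

text \<open>The dimension of the degree \<open>t\<close> part of the homogeneous coordinate ring.\<close>

definition hilbert_function :: "'n::finite ppoint set \<Rightarrow> nat \<Rightarrow> nat" where
  "hilbert_function X t =
     cpoly.dim (homogeneous_forms t :: 'n cpoly set)
     - cpoly.dim (homogeneous_forms t \<inter> vanishing_ideal X)"

definition hilbert_poly :: "'n::finite ppoint set \<Rightarrow> rat poly" where
  "hilbert_poly X =
     (THE h. \<exists>t0. \<forall>t\<ge>t0. poly h (of_nat t) = of_nat (hilbert_function X t))"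

definition proj_dim :: "'n::finite ppoint set \<Rightarrow> nat" where
  "proj_dim X = degree (hilbert_poly X)"

definition proj_degree :: "'n::finite ppoint set \<Rightarrow> rat" where
  "proj_degree X = fact (proj_dim X) * lead_coeff (hilbert_poly X)"

text \<open>The tangent space of the affine cone over \<open>X\<close> at \<open>p\<close>.\<close>

definition tangent_space :: "'n::finite ppoint set \<Rightarrow> complex ^ 'n \<Rightarrow> (complex ^ 'n) set" where
  "tangent_space X p =
     {v. \<forall>F\<in>vanishing_ideal X. (\<Sum>i\<in>UNIV. peval (partial_deriv i F) (($) p) * v $ i) = 0}"

text \<open>The smooth points of an irreducible variety: the cone has dimension \<open>proj_dim X + 1\<close>.\<close>

definition regular_points :: "'n::finite ppoint set \<Rightarrow> 'n ppoint set" where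
  "regular_points X = {P \<in> X. \<forall>p\<in>P. vec.dim (tangent_space X p) = proj_dim X + 1}"


section \<open>Maximum likelihood degree\<close>

definition likelihood_hyperplanes :: "'n::finite ppoint set" where
  "likelihood_hyperplanes =
     {proj_point p | p. p \<noteq> 0 \<and> ((\<exists>i. p $ i = 0) \<or> (\<Sum>i\<in>UNIV. p $ i) = 0)}"

text \<open>For complex \<open>u\<close> the likelihood function \<open>l\<^sub>u\<close> is multivalued. The following is the branch of
  \<open>l\<^sub>u(q) / l\<^sub>u(p)\<close> with value \<open>1\<close> at \<open>q = p\<close>; all bases of powers are then close to \<open>1\<close>, where
  \<open>powr\<close> is holomorphic. Every local branch of \<open>l\<^sub>u\<close> near \<open>p\<close> is a nonzero constant multiple of it,
  and for integral \<open>u\<close> it is exactly the quotient.\<close>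

definition likelihood_ratio ::
    "complex ^ 'n \<Rightarrow> complex ^ 'n \<Rightarrow> complex ^ 'n::finite \<Rightarrow> complex" where
  "likelihood_ratio u p q =
     (\<Prod>i\<in>UNIV. (q $ i / p $ i) powr (u $ i))
     / ((\<Sum>i\<in>UNIV. q $ i) / (\<Sum>i\<in>UNIV. p $ i)) powr (\<Sum>i\<in>UNIV. u $ i)"

text \<open>\<open>l\<^sub>u\<close> is homogeneous of degree \<open>0\<close>, so a point of \<open>X\<close> is critical iff all derivatives of \<open>l\<^sub>u\<close>
  along tangent vectors of the affine cone vanish there.\<close>

definition critical_points ::
    "'n::finite ppoint set \<Rightarrow> complex ^ 'n \<Rightarrow> 'n ppoint set" where
  "critical_points X u =
     {P \<in> regular_points X - likelihood_hyperplanes.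
        \<forall>p\<in>P. \<forall>v\<in>tangent_space X p.
          ((\<lambda>t. likelihood_ratio u p (p + t *s v)) has_field_derivative 0) (at 0)}"

text \<open>Generic \<open>u\<close> means: all \<open>u\<close> outside the zero locus of some nonzero polynomial \<open>G\<close>.\<close>

definition mldeg :: "'n::finite ppoint set \<Rightarrow> nat" where
  "mldeg X =
     (THE N. \<exists>G :: 'n cpoly. G \<noteq> 0 \<and>
        (\<forall>u. peval G (($) u) \<noteq> 0 \<longrightarrow>
           finite (critical_points X u) \<and> card (critical_points X u) = N))"


section \<open>Toric varieties\<close>

text \<open>The columns of the matrix \<open>A\<close> are the exponent vectors \<open>a i\<close>, supported on \<open>{1..d-1}\<close>;
  the index type \<open>'n\<close> plays the role of \<open>{1..n}\<close>.\<close>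

definition toric_map ::
    "('n::finite \<Rightarrow> nat \<Rightarrow>\<^sub>0 nat) \<Rightarrow> nat \<Rightarrow> complex ^ 'n \<Rightarrow> complex \<Rightarrow> (nat \<Rightarrow> complex) \<Rightarrow> complex ^ 'n" where
  "toric_map a d c s \<theta> =
     (\<chi> i. c $ i * s * (\<Prod>j\<in>{1..d-1}. \<theta> j ^ Poly_Mapping.lookup (a i) j))"

definition toric_variety ::
    "('n::finite \<Rightarrow> nat \<Rightarrow>\<^sub>0 nat) \<Rightarrow> nat \<Rightarrow> complex ^ 'n \<Rightarrow> 'n ppoint set" where
  "toric_variety a d c =
     {proj_point p | p. p \<noteq> 0 \<and>
        p \<in> zariski_closure {toric_map a d c s \<theta> | s \<theta>. s \<noteq> 0 \<and> (\<forall>j\<in>{1..d-1}. \<theta> j \<noteq> 0)}}"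

definition veronese_columns :: "nat \<Rightarrow> (nat \<Rightarrow>\<^sub>0 nat) set" where
  "veronese_columns d = {m. Poly_Mapping.keys m \<subseteq> {1..d-1} \<and> monom_degree m \<le> 2}"


section \<open>The principal A-determinant\<close>

definition support_poly :: "('n::finite \<Rightarrow> nat \<Rightarrow>\<^sub>0 nat) \<Rightarrow> complex ^ 'n \<Rightarrow> nat cpoly" where
  "support_poly a c = (\<Sum>i\<in>UNIV. Poly_Mapping.single (a i) (c $ i))"

definition L_form ::
    "('n::finite \<Rightarrow> nat \<Rightarrow>\<^sub>0 nat) \<Rightarrow> nat cpoly \<Rightarrow> complex ^ 'n \<Rightarrow> complex" where
  "L_form a g p = (\<Sum>i\<in>UNIV. Poly_Mapping.lookup g (a i) * p $ i)"

text \<open>The value \<open>R(f\<^sub>1,\<dots>,f\<^sub>d)\<close>: the variable \<open>(i, j)\<close> of \<open>R\<close> stands for the coefficient of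
  \<open>f\<^sub>j\<close> at the monomial \<open>a i\<close>.\<close>

definition eval_coeffs ::
    "('n::finite \<Rightarrow> nat \<Rightarrow>\<^sub>0 nat) \<Rightarrow> ('n \<times> nat) cpoly \<Rightarrow> (nat \<Rightarrow> nat cpoly) \<Rightarrow> complex" where
  "eval_coeffs a R f = peval R (\<lambda>(i, j). Poly_Mapping.lookup (f j) (a i))"

text \<open>The A-resultant is determined only up to a nonzero scalar, hence a predicate.\<close>

definition is_A_resultant ::
    "('n::finite \<Rightarrow> nat \<Rightarrow>\<^sub>0 nat) \<Rightarrow> nat \<Rightarrow> ('n \<times> nat) cpoly \<Rightarrow> bool" where
  "is_A_resultant a d R \<longleftrightarrow>
     irreducible R \<and> pvars R \<subseteq> UNIV \<times> {1..d} \<and>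
     (\<forall>f. (\<forall>j\<in>{1..d}. Poly_Mapping.keys (f j) \<subseteq> range a) \<longrightarrow>
        (eval_coeffs a R f = 0 \<longleftrightarrow>
          (\<exists>P \<in> toric_variety a d (\<chi> i. 1). \<forall>p\<in>P. \<forall>j\<in>{1..d}. L_form a (f j) p = 0)))"

text \<open>The system \<open>f, \<theta>\<^sub>1 \<partial>f/\<partial>\<theta>\<^sub>1, \<dots>, \<theta>\<^bsub>d-1\<^esub> \<partial>f/\<partial>\<theta>\<^bsub>d-1\<^esub>\<close>, numbered from \<open>1\<close> to \<open>d\<close>.\<close>

definition toric_derivatives :: "nat cpoly \<Rightarrow> nat \<Rightarrow> nat cpoly" where
  "toric_derivatives f j = (if j = 1 then f else pvar (j - 1) * partial_deriv (j - 1) f)"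

text \<open>In the following two definitions \<open>R\<close> is the A-resultant. The zero locus does not depend on
  the scalar factor of \<open>R\<close>.\<close>

definition principal_A_det ::
    "('n::finite \<Rightarrow> nat \<Rightarrow>\<^sub>0 nat) \<Rightarrow> ('n \<times> nat) cpoly \<Rightarrow> complex ^ 'n \<Rightarrow> complex" where
  "principal_A_det a R c = eval_coeffs a R (toric_derivatives (support_poly a c))"

definition Sigma_A ::
    "('n::finite \<Rightarrow> nat \<Rightarrow>\<^sub>0 nat) \<Rightarrow> ('n \<times> nat) cpoly \<Rightarrow> (complex ^ 'n) set" where
  "Sigma_A a R = {c. principal_A_det a R c = 0}"

end

theory Submission
  imports
    Defs
    "HOL-Library.Function_Algebras"
    "HOL-Computational_Algebra.Field_as_Ring"
    "Subresultants.Subresultant_Gcd"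
    "Jordan_Normal_Form.Char_Poly"
begin

text \<open>The Veronese cone consists of the vectors \<open>(x\<^sub>j x\<^sub>k)\<close> with \<open>j \<le> k < d\<close>; write \<open>S = \<Sum> x\<^sub>j\<close>. Forms of
  degree \<open>t\<close> restrict to it as the forms of degree \<open>2t\<close> in \<open>x\<close>, which gives the Hilbert polynomial and
  the degree. The toric derivatives of \<open>f\<close> are the functions \<open>x\<^sub>j\<^sup>2 + x\<^sub>j S\<close>, and these have only the trivial
  common zero. The critical points of \<open>l\<^sub>u\<close> are, up to \<open>x \<mapsto> -x\<close>, the solutions of
  \<open>x\<^sub>j\<^sup>2 + x\<^sub>j S = b\<^sub>j\<close> with \<open>b\<close> linear in \<open>u\<close>, so one has to see that this system has \<open>2\<^sup>d\<close> solutions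
  for generic \<open>b\<close>.

  It never has more, because squarefree monomials span the functions on the solution set. For the
  lower bound put \<open>y\<^sub>j = 2 x\<^sub>j + S\<close>; then \<open>y\<^sub>j\<^sup>2 = S\<^sup>2 + 4 b\<^sub>j\<close> and \<open>(d + 2) S = \<Sum> y\<^sub>j\<close>, so \<open>S\<close> runs
  through the roots of a polynomial of degree \<open>2\<^sup>d\<close> which is the product over all choices of signs of
  the square roots. Its discriminant does not vanish identically: for real \<open>b > 0\<close> each choice of signs
  contributes exactly one real root, and these are distinct for a suitable \<open>b\<close>.\<close>


section \<open>Evaluation of polynomials\<close>

text \<open>Two bounds have to meet because neither suffices alone: squarefree monomials bound the
  number of solutions for every \<open>b\<close> but produce none, while a discriminant only
  certifies distinct values of \<open>S\<close>. Each such value lifts to at least one solution, so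
  \<open>2^d\<close> distinct values and at most \<open>2^d\<close> solutions force equality.
  Completing the square in \<open>x_j^2 + x_j S = b_j\<close> is the origin of \<open>4 b_j\<close>,
  and summing \<open>y_j = 2 x_j + S\<close> is the origin of \<open>d + 2\<close>. A discriminant
  is not identically zero as soon as one good point exists; over the positive reals monotonicity
  supplies it, since each \<open>sqrt (S^2 + 4 b_j)\<close> changes at most as fast as
  \<open>S\<close>, so that \<open>d\<close> of them cannot keep up with \<open>(d + 2) S\<close>.
  The likelihood equations are homogeneous in \<open>x\<close> and carry the coordinate sum of the
  point as an extra factor. Rescaling that sum to the sum of the entries of \<open>u\<close> removes
  the factor and leaves exactly the quadratic system; the sign of the scale is the only freedom
  left, so the count is halved. Genericity in \<open>b\<close> passes to \<open>u\<close> because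
  \<open>b\<close> depends linearly and surjectively on \<open>u\<close>.\<close>

definition pmono :: "('v \<Rightarrow> complex) \<Rightarrow> ('v \<Rightarrow>\<^sub>0 nat) \<Rightarrow> complex" where
  "pmono x m = (\<Prod>v\<in>Poly_Mapping.keys m. x v ^ Poly_Mapping.lookup m v)"

lemma pmono_superset:
  assumes "finite A" "Poly_Mapping.keys m \<subseteq> A"
  shows "pmono x m = (\<Prod>v\<in>A. x v ^ Poly_Mapping.lookup m v)"
  unfolding pmono_def
  by (rule prod.mono_neutral_left) (use assms in \<open>auto simp: not_in_keys_iff_lookup_eq_zero\<close>)

lemma pmono_0 [simp]: "pmono x 0 = 1"
  by (simp add: pmono_def)

lemma pmono_single [simp]: "pmono x (Poly_Mapping.single v k) = x v ^ k"
  by (subst pmono_superset[where A = "{v}"]) auto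

lemma pmono_add: "pmono x (m + m') = pmono x m * pmono x m'"
proof -
  let ?A = "Poly_Mapping.keys m \<union> Poly_Mapping.keys m'"
  have "Poly_Mapping.keys (m + m') \<subseteq> ?A" by (rule Poly_Mapping.keys_add)
  then show ?thesis
    by (subst (1 2 3) pmono_superset[where A = ?A])
       (auto simp: lookup_add power_add prod.distrib)
qed

lemma pmono_mult: "pmono (\<lambda>v. x v * y v) m = pmono x m * pmono y m"
  by (simp add: pmono_def power_mult_distrib prod.distrib)

lemma peval_superset:
  assumes "finite A" "Poly_Mapping.keys F \<subseteq> A"
  shows "peval F x = (\<Sum>m\<in>A. Poly_Mapping.lookup F m * pmono x m)"
  unfolding peval_def pmono_def[symmetric]
  by (rule sum.mono_neutral_left) (use assms in \<open>auto simp: not_in_keys_iff_lookup_eq_zero\<close>)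

lemma peval_0 [simp]: "peval 0 x = 0"
  by (simp add: peval_def)

lemma peval_single [simp]: "peval (Poly_Mapping.single m c) x = c * pmono x m"
  by (subst peval_superset[where A = "{m}"]) auto

lemma peval_add: "peval (F + G) x = peval F x + peval G x"
proof -
  let ?A = "Poly_Mapping.keys F \<union> Poly_Mapping.keys G"
  have "Poly_Mapping.keys (F + G) \<subseteq> ?A" by (rule Poly_Mapping.keys_add)
  then show ?thesis
    by (subst (1 2 3) peval_superset[where A = ?A])
       (auto simp: lookup_add algebra_simps sum.distrib)
qed

lemma peval_sum: "peval (\<Sum>i\<in>I. F i) x = (\<Sum>i\<in>I. peval (F i) x)"
  by (induction I rule: infinite_finite_induct) (simp_all add: peval_add)

lemma poly_mapping_sum_monomials:
  "F = (\<Sum>m\<in>Poly_Mapping.keys F. Poly_Mapping.single m (Poly_Mapping.lookup F m))"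
  by (rule poly_mapping_eqI)
     (simp add: lookup_sum lookup_single when_def not_in_keys_iff_lookup_eq_zero)

lemma peval_mult: "peval (F * G) x = peval F x * peval G x"
proof -
  have "F * G = (\<Sum>m\<in>Poly_Mapping.keys F. \<Sum>m'\<in>Poly_Mapping.keys G.
      Poly_Mapping.single (m + m') (Poly_Mapping.lookup F m * Poly_Mapping.lookup G m'))"
    by (subst (1) poly_mapping_sum_monomials[of F], subst (1) poly_mapping_sum_monomials[of G])
       (simp add: sum_product mult_single)
  then have "peval (F * G) x = (\<Sum>m\<in>Poly_Mapping.keys F. \<Sum>m'\<in>Poly_Mapping.keys G.
      (Poly_Mapping.lookup F m * pmono x m) * (Poly_Mapping.lookup G m' * pmono x m'))"
    by (simp add: peval_sum pmono_add algebra_simps)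
  then show ?thesis
    by (simp add: sum_product peval_superset[of "Poly_Mapping.keys F" F]
        peval_superset[of "Poly_Mapping.keys G" G])
qed

lemma peval_diff: "peval (F - G) x = peval F x - peval G x"
  using peval_add[of "F - G" G x] by simp

lemma peval_pvar [simp]: "peval (pvar v) x = x v"
  by (simp add: pvar_def)

text \<open>Dedekind's independence of characters, for the multiplicative functions \<^term>\<open>pmono\<close>.\<close>

lemma pmono_independent:
  assumes "finite A" "\<And>x. (\<Sum>m\<in>A. c m * pmono x m) = 0" "m \<in> A"
  shows "c m = 0"
  using assms
proof (induction A arbitrary: c m rule: finite_induct)
  case (insert m1 A)
  have other: "c m2 = 0" if m2: "m2 \<in> A" for m2
  proof -
    have "m1 \<noteq> m2" using insert.hyps m2 by auto
    then obtain v where v: "Poly_Mapping.lookup m1 v \<noteq> Poly_Mapping.lookup m2 v"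
      by (metis poly_mapping_eqI)
    \<comment> \<open>Evaluating at the product of \<open>g\<close> and \<open>x\<close> multiplies
      each monomial by 2 to its exponent at \<open>v\<close>, which separates \<open>m1\<close> from
      \<open>m2\<close>. Subtracting \<open>pmono g m1\<close> times the original relation removes
      the \<open>m1\<close> term.\<close>
    define g :: "'a \<Rightarrow> complex" where "g = (\<lambda>w. if w = v then 2 else 1)"
    have g: "pmono g m = 2 ^ Poly_Mapping.lookup m v" for m
      by (subst pmono_superset[of "insert v (Poly_Mapping.keys m)"])
         (auto simp: g_def prod.insert_remove)
    have "(\<Sum>m\<in>A. (c m * (pmono g m - pmono g m1)) * pmono x m) = 0" for x
    proof -
      have "(\<Sum>m\<in>A. (c m * (pmono g m - pmono g m1)) * pmono x m) =
          (\<Sum>m\<in>insert m1 A. (c m * (pmono g m - pmono g m1)) * pmono x m)"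
        using insert.hyps by simp
      also have "\<dots> = (\<Sum>m\<in>insert m1 A. c m * pmono (\<lambda>v. g v * x v) m)
          - pmono g m1 * (\<Sum>m\<in>insert m1 A. c m * pmono x m)"
        by (simp add: pmono_mult sum_distrib_left sum_subtractf algebra_simps)
      also have "\<dots> = 0" using insert.prems(1) by simp
      finally show ?thesis .
    qed
    from insert.IH[of "\<lambda>m. c m * (pmono g m - pmono g m1)", OF this m2]
    have "c m2 * (pmono g m2 - pmono g m1) = 0" .
    moreover have "pmono g m2 \<noteq> pmono g m1"
    proof
      assume "pmono g m2 = pmono g m1"
      then have "(of_nat (2 ^ Poly_Mapping.lookup m2 v) :: complex) = of_nat (2 ^ Poly_Mapping.lookup m1 v)"
        by (simp add: g)
      then have "(2::nat) ^ Poly_Mapping.lookup m2 v = 2 ^ Poly_Mapping.lookup m1 v"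
        by (subst (asm) of_nat_eq_iff)
      then show False using v by simp
    qed
    ultimately show ?thesis by simp
  qed
  have "c m1 = 0"
    using insert.prems(1)[of "\<lambda>_. 1"] insert.hyps other by (simp add: pmono_def)
  then show ?case using other insert.prems(2) by auto
qed simp

lemma peval_eq_0_imp:
  assumes "\<And>x. peval F x = 0"
  shows "F = 0"
proof (rule poly_mapping_eqI)
  fix m
  show "Poly_Mapping.lookup F m = Poly_Mapping.lookup 0 m"
    using pmono_independent[of "Poly_Mapping.keys F" "Poly_Mapping.lookup F" m] assms
    by (cases "m \<in> Poly_Mapping.keys F")
       (auto simp: peval_superset[of "Poly_Mapping.keys F" F] not_in_keys_iff_lookup_eq_zero)
qed

section \<open>Polynomial functions\<close>

text \<open>Polynomials are treated as functions on an arbitrary parameter type, generated by the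
  coordinate functions \<open>X\<close>. Determinants, substitutions and elimination then need no
  explicit monomials; an actual polynomial is recovered only when \<open>mldeg\<close> asks for
  one.\<close>

inductive_set polyfun :: "('p \<Rightarrow> complex) set \<Rightarrow> ('p \<Rightarrow> complex) set" for X where
  const: "(\<lambda>_. c) \<in> polyfun X"
| base: "f \<in> X \<Longrightarrow> f \<in> polyfun X"
| add: "f \<in> polyfun X \<Longrightarrow> g \<in> polyfun X \<Longrightarrow> (\<lambda>p. f p + g p) \<in> polyfun X"
| mult: "f \<in> polyfun X \<Longrightarrow> g \<in> polyfun X \<Longrightarrow> (\<lambda>p. f p * g p) \<in> polyfun X"

lemma polyfun_uminus: "f \<in> polyfun X \<Longrightarrow> (\<lambda>p. - f p) \<in> polyfun X"
  using polyfun.mult[OF polyfun.const[of "-1"], of f] by simp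

lemma polyfun_diff: "f \<in> polyfun X \<Longrightarrow> g \<in> polyfun X \<Longrightarrow> (\<lambda>p. f p - g p) \<in> polyfun X"
  using polyfun.add[OF _ polyfun_uminus, of f X g] by simp

lemma polyfun_sum: "(\<And>i. i \<in> I \<Longrightarrow> f i \<in> polyfun X) \<Longrightarrow> (\<lambda>p. \<Sum>i\<in>I. f i p) \<in> polyfun X"
  by (induction I rule: infinite_finite_induct) (auto intro: polyfun.intros)

lemma polyfun_prod: "(\<And>i. i \<in> I \<Longrightarrow> f i \<in> polyfun X) \<Longrightarrow> (\<lambda>p. \<Prod>i\<in>I. f i p) \<in> polyfun X"
  by (induction I rule: infinite_finite_induct) (auto intro: polyfun.intros)

lemma polyfun_power: "f \<in> polyfun X \<Longrightarrow> (\<lambda>p. f p ^ k) \<in> polyfun X"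
  by (induction k) (auto intro: polyfun.intros)

lemma polyfun_if: "f \<in> polyfun X \<Longrightarrow> g \<in> polyfun X \<Longrightarrow> (\<lambda>p. if b then f p else g p) \<in> polyfun X"
  by (cases b) simp_all

lemma polyfun_subst:
  assumes "f \<in> polyfun X" "\<And>x. x \<in> X \<Longrightarrow> (\<lambda>q. x (g q)) \<in> polyfun Y"
  shows "(\<lambda>q. f (g q)) \<in> polyfun Y"
  using assms by induction (auto intro: polyfun.intros)

lemma polyfun_imp_peval:
  assumes "f \<in> polyfun (range (\<lambda>i u. vec_nth u i))"
  shows "\<exists>G :: 'n::finite cpoly. \<forall>u. f u = peval G (vec_nth u)"
  using assms
proof induction
  case (const c)
  show ?case by (rule exI[of _ "Poly_Mapping.single 0 c"]) simp
next
  case (base f)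
  then obtain i where "f = (\<lambda>u. vec_nth u i)" by auto
  then show ?case by (intro exI[of _ "pvar i"]) simp
next
  case (add f g)
  then show ?case by (metis peval_add)
next
  case (mult f g)
  then show ?case by (metis peval_mult)
qed

text \<open>Adjoins one new variable, read by \<open>fst\<close>, to the generators
  \<open>X\<close>; iterating it adjoins several.\<close>

abbreviation extend_coords :: "('p \<Rightarrow> complex) set \<Rightarrow> (complex \<times> 'p \<Rightarrow> complex) set" where
  "extend_coords X \<equiv> insert fst ((\<lambda>f. f \<circ> snd) ` X)"

lemma polyfun_snd: "f \<in> polyfun X \<Longrightarrow> (\<lambda>q. f (snd q)) \<in> polyfun (extend_coords X)"
  by (rule polyfun_subst) (auto intro!: polyfun.base simp: o_def)

lemma polyfun_fst: "fst \<in> polyfun (extend_coords X)"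
  by (rule polyfun.base) simp

text \<open>Collects powers of the adjoined variable. The degree of \<open>q u\<close> is not
  controlled here and has to be bounded separately.\<close>

lemma polyfun_univariate:
  assumes "F \<in> polyfun (extend_coords X)"
  shows "\<exists>q. (\<forall>s u. F (s, u) = poly (q u) s) \<and> (\<forall>i. (\<lambda>u. coeff (q u) i) \<in> polyfun X)"
  using assms
proof induction
  case (const c)
  show ?case
  proof (intro exI conjI allI)
    fix i show "(\<lambda>u. coeff [:c:] i) \<in> polyfun X" by (rule polyfun.const)
  qed simp
next
  case (base f)
  then consider "f = fst" | g where "g \<in> X" "f = g \<circ> snd" by auto
  then show ?case
  proof cases
    case 1
    show ?thesis
    proof (intro exI conjI allI)
      fix i show "(\<lambda>u. coeff [:0, 1:] i) \<in> polyfun X" by (rule polyfun.const)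
    qed (simp add: 1)
  next
    case 2
    show ?thesis
    proof (intro exI conjI allI)
      fix i show "(\<lambda>u. coeff [:g u:] i) \<in> polyfun X"
        using 2 by (cases i) (auto intro: polyfun.intros)
    qed (simp add: 2)
  qed
next
  case (add f g)
  then obtain q r where "\<forall>s u. f (s, u) = poly (q u) s" "\<forall>i. (\<lambda>u. coeff (q u) i) \<in> polyfun X"
    "\<forall>s u. g (s, u) = poly (r u) s" "\<forall>i. (\<lambda>u. coeff (r u) i) \<in> polyfun X" by blast
  then show ?case by (intro exI[of _ "\<lambda>u. q u + r u"]) (auto intro: polyfun.intros)
next
  case (mult f g)
  then obtain q r where "\<forall>s u. f (s, u) = poly (q u) s" "\<forall>i. (\<lambda>u. coeff (q u) i) \<in> polyfun X"
    "\<forall>s u. g (s, u) = poly (r u) s" "\<forall>i. (\<lambda>u. coeff (r u) i) \<in> polyfun X" by blast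
  then show ?case
    by (intro exI[of _ "\<lambda>u. q u * r u"]) (auto simp: coeff_mult intro!: polyfun_sum polyfun.mult)
qed

lemma poly_mult_common_nonroot:
  fixes p q :: "complex poly"
  assumes "p \<noteq> 0" "q \<noteq> 0"
  shows "\<exists>t. poly p t \<noteq> 0 \<and> poly q t \<noteq> 0"
proof -
  have "finite {t. poly (p * q) t = 0}" using assms by (intro poly_roots_finite) simp
  then have "{t. poly (p * q) t = 0} \<noteq> UNIV" using infinite_UNIV_char_0 by metis
  then show ?thesis by auto
qed

text \<open>On the line joining a nonzero of \<open>F\<close> to a nonzero of \<open>G\<close> both
  restrict to nonzero univariate polynomials, which have a common nonroot. Two generic conditions
  can thus be met together, which makes the value in \<open>mldeg\<close> unique.\<close>

lemma peval_common_nonzero: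
  fixes F G :: "'n::finite cpoly"
  assumes "F \<noteq> 0" "G \<noteq> 0"
  shows "\<exists>u. peval F (vec_nth u) \<noteq> 0 \<and> peval G (vec_nth u) \<noteq> 0"
proof -
  have ex: "\<exists>x. peval H x \<noteq> 0" if "H \<noteq> 0" for H :: "'n cpoly"
    using that peval_eq_0_imp by blast
  obtain x y where x: "peval F x \<noteq> 0" and y: "peval G y \<noteq> 0" using ex assms by metis
  have line: "\<exists>q. \<forall>t. peval H (\<lambda>v. x v + t * (y v - x v)) = poly q t" for H
  proof -
    define q where "q = (\<Sum>m\<in>Poly_Mapping.keys H. Polynomial.smult (Poly_Mapping.lookup H m)
       (\<Prod>v\<in>Poly_Mapping.keys m. [: x v, y v - x v :] ^ Poly_Mapping.lookup m v))"
    have "peval H (\<lambda>v. x v + t * (y v - x v)) = poly q t" for t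
      by (simp add: q_def peval_def poly_sum poly_prod)
    then show ?thesis by blast
  qed
  obtain p q where p: "\<And>t. peval F (\<lambda>v. x v + t * (y v - x v)) = poly p t"
    and q: "\<And>t. peval G (\<lambda>v. x v + t * (y v - x v)) = poly q t" using line by metis
  have "p \<noteq> 0" using p[of 0] x by auto
  moreover have "q \<noteq> 0" using q[of 1] y by auto
  ultimately obtain t where "poly p t \<noteq> 0" "poly q t \<noteq> 0"
    using poly_mult_common_nonroot by blast
  then show ?thesis
    using p[of t] q[of t]
    by (intro exI[of _ "\<chi> v. x v + t * (y v - x v)"]) (simp add: vec_lambda_inverse)
qed

section \<open>Generic squarefreeness\<close>

text \<open>Over the complex numbers the roots are all simple iff \<open>q\<close> and its
  derivative share no root, iff their gcd is constant, and the resultant detects this.\<close>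

lemma card_roots_iff_resultant:
  fixes q :: "complex poly"
  assumes "degree q = N" "N > 0"
  shows "card {z. poly q z = 0} = N \<longleftrightarrow> resultant q (pderiv q) \<noteq> 0"
proof -
  have "q \<noteq> 0" using assms by auto
  have "card {z. poly q z = 0} = N \<longleftrightarrow> rsquarefree q"
    using assms \<open>q \<noteq> 0\<close> rsquarefree_card_degree by metis
  also have "\<dots> \<longleftrightarrow> (\<forall>z. \<not> (poly q z = 0 \<and> poly (pderiv q) z = 0))"
    by (rule rsquarefree_roots)
  also have "\<dots> \<longleftrightarrow> degree (gcd q (pderiv q)) = 0"
  proof
    assume *: "\<forall>z. \<not> (poly q z = 0 \<and> poly (pderiv q) z = 0)"
    show "degree (gcd q (pderiv q)) = 0"
    proof (rule ccontr)
      assume "degree (gcd q (pderiv q)) \<noteq> 0"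
      then obtain z where "poly (gcd q (pderiv q)) z = 0"
        using fundamental_theorem_of_algebra constant_degree by metis
      then show False using * by (meson dvd_trans gcd_dvd1 gcd_dvd2 poly_eq_0_iff_dvd)
    qed
  next
    assume deg: "degree (gcd q (pderiv q)) = 0"
    show "\<forall>z. \<not> (poly q z = 0 \<and> poly (pderiv q) z = 0)"
    proof (intro allI notI)
      fix z assume "poly q z = 0 \<and> poly (pderiv q) z = 0"
      then have "[:-z, 1:] dvd gcd q (pderiv q)" by (simp add: poly_eq_0_iff_dvd)
      moreover have "gcd q (pderiv q) \<noteq> 0" using \<open>q \<noteq> 0\<close> by simp
      ultimately have "degree [:-z, 1:] \<le> degree (gcd q (pderiv q))" by (rule dvd_imp_degree_le)
      then show False using deg by simp
    qed
  qed
  also have "\<dots> \<longleftrightarrow> resultant q (pderiv q) \<noteq> 0"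
    using resultant_0_gcd[of q "pderiv q"] by simp
  finally show ?thesis .
qed

text \<open>The condition \<open>D\<close> is the coefficient at \<open>N\<close> times a resultant.
  The first factor fixes the degree, the second excludes multiple roots; at \<open>u0\<close> the
  degree is \<open>N\<close> because a nonzero polynomial with \<open>N\<close> roots cannot have a
  smaller one.\<close>

lemma generic_card_roots:
  fixes q :: "'p \<Rightarrow> complex poly"
  assumes coeff: "\<And>i. (\<lambda>u. coeff (q u) i) \<in> polyfun X"
    and deg: "\<And>u. degree (q u) \<le> N" and N: "N > 0"
    and u0: "q u0 \<noteq> 0" "card {z. poly (q u0) z = 0} = N"
  shows "\<exists>D\<in>polyfun X. D u0 \<noteq> 0 \<and> (\<forall>u. D u \<noteq> 0 \<longrightarrow> card {z. poly (q u) z = 0} = N)"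
proof -
  \<comment> \<open>A Sylvester matrix of fixed format has entries polynomial in \<open>u\<close>
    even where the degree of \<open>q u\<close> drops; its determinant is the true resultant where
    the degree is \<open>N\<close>.\<close>
  define R where "R u = resultant_sub N (N - 1) (q u) (pderiv (q u))" for u
  have R: "R u = resultant (q u) (pderiv (q u))" if "degree (q u) = N" for u
    using that degree_pderiv[of "q u"] by (simp add: R_def resultant_sub)
  have "R \<in> polyfun X"
  proof -
    let ?M = "\<lambda>u. sylvester_mat_sub N (N - 1) (q u) (pderiv (q u))"
    let ?n = "N + (N - 1)"
    have R_eq: "R = (\<lambda>u. \<Sum>p | p permutes {0..<?n}. signof p * (\<Prod>i = 0..<?n. ?M u $$ (i, p i)))"
      by (rule ext, unfold R_def resultant_sub_def, rule det_def'[OF sylvester_mat_sub_carrier])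
    have entry: "(\<lambda>u. ?M u $$ (i, p i)) \<in> polyfun X"
      if "p permutes {0..<?n}" "i \<in> {0..<?n}" for p i
    proof -
      have "p i < ?n" using that permutes_in_image[OF that(1), of i] by simp
      moreover have "i < ?n" using that by simp
      ultimately have index: "(\<lambda>u. ?M u $$ (i, p i)) = (\<lambda>u. if i < N - 1
          then if i \<le> p i \<and> p i - i \<le> N then coeff (q u) (N + i - p i) else 0
          else if i - (N - 1) \<le> p i \<and> p i \<le> i then coeff (pderiv (q u)) (i - p i) else 0)"
        by (intro ext) (rule sylvester_mat_sub_index)
      have coeff': "(\<lambda>u. coeff (pderiv (q u)) k) \<in> polyfun X" for k
        using polyfun.mult[OF polyfun.const[of "of_nat (Suc k)"] coeff[of "Suc k"]] by (simp add: coeff_pderiv)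
      show ?thesis
        unfolding index by (rule polyfun_if; rule polyfun_if; rule polyfun.const coeff coeff')
    qed
    show ?thesis
      unfolding R_eq
      by (rule polyfun_sum, rule polyfun.mult, rule polyfun.const, rule polyfun_prod, rule entry)
         simp_all
  qed
  then have D: "(\<lambda>u. coeff (q u) N * R u) \<in> polyfun X" by (rule polyfun.mult[OF coeff])
  have degN: "degree (q u) = N" if "coeff (q u) N \<noteq> 0" for u
    using that deg[of u] le_degree[of "q u" N] by simp
  have "N \<le> degree (q u0)"
    using card_poly_roots_bound[OF u0(1)] u0(2) by simp
  then have deg0: "degree (q u0) = N" using deg[of u0] by simp
  have "coeff (q u0) N * R u0 \<noteq> 0"
    using u0 deg0[symmetric] R[OF deg0] card_roots_iff_resultant[OF deg0 N] by simp
  moreover have "card {z. poly (q u) z = 0} = N" if "coeff (q u) N * R u \<noteq> 0" for u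
  proof -
    have "degree (q u) = N" by (rule degN) (use that in simp)
    then show ?thesis using that R card_roots_iff_resultant[OF _ N] by simp
  qed
  ultimately show ?thesis using D by (intro bexI[where x = "\<lambda>u. coeff (q u) N * R u"]) simp_all
qed


section \<open>Eliminating square roots\<close>

text \<open>The product, over all \<open>2^k\<close> sign choices, of \<open>z\<close> minus the
  signed sum of the \<open>r j\<close>. The recursion splits off one root, so that its sign can be
  eliminated one index at a time.\<close>

fun sign_prod :: "nat \<Rightarrow> complex \<Rightarrow> (nat \<Rightarrow> complex) \<Rightarrow> complex" where
  "sign_prod 0 z r = z"
| "sign_prod (Suc k) z r = sign_prod k (z - r k) r * sign_prod k (z + r k) r"

lemma sign_prod_eq_0_iff:
  "sign_prod k z r = 0 \<longleftrightarrow> (\<exists>T\<subseteq>{..<k}. z = (\<Sum>j<k. if j \<in> T then r j else - r j))"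
proof (induction k arbitrary: z)
  case (Suc k)
  have split: "(\<exists>T\<subseteq>{..<Suc k}. P T) \<longleftrightarrow> (\<exists>T\<subseteq>{..<k}. P T \<or> P (insert k T))" for P :: "nat set \<Rightarrow> bool"
  proof
    assume "\<exists>T\<subseteq>{..<Suc k}. P T"
    then obtain T where T: "T \<subseteq> {..<Suc k}" "P T" by blast
    show "\<exists>T\<subseteq>{..<k}. P T \<or> P (insert k T)"
      using T by (intro exI[of _ "T - {k}"]) (cases "k \<in> T", auto simp: insert_absorb less_Suc_eq)
  next
    assume "\<exists>T\<subseteq>{..<k}. P T \<or> P (insert k T)"
    then obtain T where T: "T \<subseteq> {..<k}" "P T \<or> P (insert k T)" by blast
    then have "T \<subseteq> {..<Suc k}" "insert k T \<subseteq> {..<Suc k}" by auto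
    then show "\<exists>T\<subseteq>{..<Suc k}. P T" using T by blast
  qed
  have 1: "(\<Sum>j<Suc k. if j \<in> T then r j else - r j) = (\<Sum>j<k. if j \<in> T then r j else - r j) - r k"
    and 2: "(\<Sum>j<Suc k. if j \<in> insert k T then r j else - r j)
      = (\<Sum>j<k. if j \<in> T then r j else - r j) + r k"
    if "T \<subseteq> {..<k}" for T
  proof -
    have "k \<notin> T" using that by auto
    then show "(\<Sum>j<Suc k. if j \<in> T then r j else - r j) = (\<Sum>j<k. if j \<in> T then r j else - r j) - r k"
      by simp
    have "(\<Sum>j<k. if j \<in> insert k T then r j else - r j) = (\<Sum>j<k. if j \<in> T then r j else - r j)"
      by (rule sum.cong) auto
    then show "(\<Sum>j<Suc k. if j \<in> insert k T then r j else - r j)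
      = (\<Sum>j<k. if j \<in> T then r j else - r j) + r k" by simp
  qed
  have "sign_prod (Suc k) z r = 0 \<longleftrightarrow>
     (\<exists>T\<subseteq>{..<k}. z - r k = (\<Sum>j<k. if j \<in> T then r j else - r j)
                \<or> z + r k = (\<Sum>j<k. if j \<in> T then r j else - r j))"
    by (auto simp: Suc.IH)
  also have "\<dots> \<longleftrightarrow> (\<exists>T\<subseteq>{..<k}. z = (\<Sum>j<Suc k. if j \<in> T then r j else - r j)
                \<or> z = (\<Sum>j<Suc k. if j \<in> insert k T then r j else - r j))"
  proof (intro ex_cong1 conj_cong refl)
    fix T :: "nat set" assume T: "T \<subseteq> {..<k}"
    show "(z - r k = (\<Sum>j<k. if j \<in> T then r j else - r j)
                \<or> z + r k = (\<Sum>j<k. if j \<in> T then r j else - r j)) \<longleftrightarrow>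
      (z = (\<Sum>j<Suc k. if j \<in> T then r j else - r j)
                \<or> z = (\<Sum>j<Suc k. if j \<in> insert k T then r j else - r j))"
      unfolding 1[OF T] 2[OF T] by (auto simp: algebra_simps)
  qed
  also have "\<dots> \<longleftrightarrow> (\<exists>T\<subseteq>{..<Suc k}. z = (\<Sum>j<Suc k. if j \<in> T then r j else - r j))"
    by (rule split[symmetric])
  finally show ?case .
qed simp

text \<open>Every one of the \<open>2^k\<close> factors is at most the base. The exponent becomes
  the bound on the degree of the eliminant.\<close>

lemma norm_sign_prod_le: "norm (sign_prod k z r) \<le> (norm z + (\<Sum>j<k. norm (r j))) ^ 2 ^ k"
proof (induction k arbitrary: z)
  case (Suc k)
  let ?B = "norm z + (\<Sum>j<Suc k. norm (r j))"
  have bound: "norm (sign_prod k w r) \<le> ?B ^ 2 ^ k" if "norm w \<le> norm z + norm (r k)" for w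
  proof -
    have "norm (sign_prod k w r) \<le> (norm w + (\<Sum>j<k. norm (r j))) ^ 2 ^ k" by (rule Suc.IH)
    also have "\<dots> \<le> ?B ^ 2 ^ k"
      using that by (intro power_mono) (auto intro!: add_nonneg_nonneg sum_nonneg)
    finally show ?thesis .
  qed
  have "norm (sign_prod (Suc k) z r) \<le> ?B ^ 2 ^ k * ?B ^ 2 ^ k"
    unfolding sign_prod.simps norm_mult
    by (intro mult_mono bound) (auto intro: norm_triangle_ineq norm_triangle_ineq4 zero_le_power
        simp: sum_nonneg)
  then show ?case by (simp add: power_add[symmetric] mult_2)
qed simp

text \<open>Separating the parts of \<open>F(z + r)\<close> that are even and odd in \<open>r\<close> shows that
  \<open>F(z + r) F(z - r) = A\<^sup>2 - \<rho> B\<^sup>2\<close> is a polynomial in \<open>\<rho> = r\<^sup>2\<close>.\<close>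

lemma polyfun_shift_sqrt:
  assumes "F \<in> polyfun (extend_coords X)" "\<rho> \<in> polyfun X"
  shows "\<exists>A\<in>polyfun (extend_coords X). \<exists>B\<in>polyfun (extend_coords X).
    \<forall>z p r. r\<^sup>2 = \<rho> p \<longrightarrow> F (z + r, p) = A (z, p) + r * B (z, p)"
  using assms(1)
proof induction
  case (const c)
  show ?case
    by (intro bexI[of _ "\<lambda>_. c"] bexI[of _ "\<lambda>_. 0"]) (auto intro: polyfun.const)
next
  case (base f)
  then consider "f = fst" | g where "g \<in> X" "f = g \<circ> snd" by auto
  then show ?case
  proof cases
    case 1
    then show ?thesis
      by - (rule bexI[OF _ polyfun_fst], rule bexI[OF _ polyfun.const[of 1]], simp)
  next
    case 2
    then have mem: "g \<circ> snd \<in> polyfun (extend_coords X)" by (intro polyfun.base) blast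
    show ?thesis
      by (rule bexI[OF _ mem], rule bexI[OF _ polyfun.const[of 0]], simp add: 2)
  qed
next
  case (add f g)
  then obtain A B A' B' where
    mem: "A \<in> polyfun (extend_coords X)" "B \<in> polyfun (extend_coords X)"
      "A' \<in> polyfun (extend_coords X)" "B' \<in> polyfun (extend_coords X)" and
    eq: "\<And>z p r. r\<^sup>2 = \<rho> p \<Longrightarrow> f (z + r, p) = A (z, p) + r * B (z, p)"
      "\<And>z p r. r\<^sup>2 = \<rho> p \<Longrightarrow> g (z + r, p) = A' (z, p) + r * B' (z, p)" by meson
  show ?case
    by (rule bexI[OF _ polyfun.add[OF mem(1,3)]], rule bexI[OF _ polyfun.add[OF mem(2,4)]])
       (simp add: eq algebra_simps)
next
  case (mult f g)
  then obtain A B A' B' where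
    mem: "A \<in> polyfun (extend_coords X)" "B \<in> polyfun (extend_coords X)"
      "A' \<in> polyfun (extend_coords X)" "B' \<in> polyfun (extend_coords X)" and
    eq: "\<And>z p r. r\<^sup>2 = \<rho> p \<Longrightarrow> f (z + r, p) = A (z, p) + r * B (z, p)"
      "\<And>z p r. r\<^sup>2 = \<rho> p \<Longrightarrow> g (z + r, p) = A' (z, p) + r * B' (z, p)" by meson
  have memA: "(\<lambda>x. A x * A' x + \<rho> (snd x) * (B x * B' x)) \<in> polyfun (extend_coords X)"
    by (intro polyfun.add polyfun.mult mem polyfun_snd[OF assms(2)])
  have memB: "(\<lambda>x. A x * B' x + B x * A' x) \<in> polyfun (extend_coords X)"
    by (intro polyfun.add polyfun.mult mem)
  show ?case
  proof (rule bexI[OF _ memA], rule bexI[OF _ memB], intro allI impI)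
    fix z r :: complex and p assume r: "r\<^sup>2 = \<rho> p"
    show "f (z + r, p) * g (z + r, p) = (A (z, p) * A' (z, p) + \<rho> (snd (z, p)) * (B (z, p) * B' (z, p))) +
        r * (A (z, p) * B' (z, p) + B (z, p) * A' (z, p))"
      unfolding eq(1)[OF r] eq(2)[OF r] by (simp add: r[symmetric] power2_eq_square algebra_simps)
  qed
qed

text \<open>One \<open>E\<close> serves every choice of square roots \<open>r\<close>, which is what
  makes the sign product a polynomial in the radicands \<open>\<rho> j\<close>. The induction step
  multiplies the two shifts by the last root and its negative, where the odd parts cancel.\<close>

lemma polyfun_sign_prod:
  assumes "\<And>j. j < k \<Longrightarrow> \<rho> j \<in> polyfun X"
  shows "\<exists>E\<in>polyfun (extend_coords X). \<forall>z p r. (\<forall>j<k. (r j)\<^sup>2 = \<rho> j p) \<longrightarrow> E (z, p) = sign_prod k z r"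
  using assms
proof (induction k)
  case 0
  show ?case by (rule bexI[OF _ polyfun_fst]) simp
next
  case (Suc k)
  then obtain E where E: "E \<in> polyfun (extend_coords X)"
    "\<And>z p r. (\<forall>j<k. (r j)\<^sup>2 = \<rho> j p) \<Longrightarrow> E (z, p) = sign_prod k z r" by (metis less_SucI)
  obtain A B where mem: "A \<in> polyfun (extend_coords X)" "B \<in> polyfun (extend_coords X)"
    and AB: "\<And>z p r. r\<^sup>2 = \<rho> k p \<Longrightarrow> E (z + r, p) = A (z, p) + r * B (z, p)"
    using polyfun_shift_sqrt[OF E(1) Suc.prems[of k]] by auto
  show ?case
  proof (intro bexI allI impI)
    show "(\<lambda>x. A x * A x - \<rho> k (snd x) * (B x * B x)) \<in> polyfun (extend_coords X)"
      using mem polyfun_snd[OF Suc.prems[of k]] by (auto intro!: polyfun_diff polyfun.mult)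
    fix z :: complex and p and r :: "nat \<Rightarrow> complex" assume r: "\<forall>j<Suc k. (r j)\<^sup>2 = \<rho> j p"
    \<comment> \<open>The root and its negative square to the same radicand, so the same
      \<open>A\<close> and \<open>B\<close> serve both shifts.\<close>
    have rk: "(r k)\<^sup>2 = \<rho> k p" "(- r k)\<^sup>2 = \<rho> k p" and r': "\<forall>j<k. (r j)\<^sup>2 = \<rho> j p" using r by auto
    have "sign_prod (Suc k) z r = E (z + - r k, p) * E (z + r k, p)"
      by (simp add: E(2)[OF r'])
    also have "\<dots> = A (z, p) * A (z, p) - \<rho> k p * (B (z, p) * B (z, p))"
      by (simp only: AB[OF rk(1)] AB[OF rk(2)] rk(1)[symmetric]) (simp add: algebra_simps power2_eq_square)
    finally show "A (z, p) * A (z, p) - \<rho> k (snd (z, p)) * (B (z, p) * B (z, p)) = sign_prod (Suc k) z r"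
      by simp
  qed
qed

text \<open>Dividing by \<open>t\<close> to the degree gives the leading coefficient in the limit,
  whereas a degree above \<open>N\<close> would force the limit 0. The eliminant is known through
  its values, so its degree is read off from growth.\<close>

lemma degree_le_of_growth:
  fixes q :: "complex poly"
  assumes "\<And>t::real. t \<ge> 1 \<Longrightarrow> norm (poly q (of_real t)) \<le> C * t ^ N"
  shows "degree q \<le> N"
proof (rule ccontr)
  assume less: "\<not> degree q \<le> N"
  define n where "n = degree q"
  have n: "N < n" "n > 0" using less by (auto simp: n_def)
  have "((\<lambda>z. poly q z / z ^ n) \<longlongrightarrow> lead_coeff q) at_infinity"
    unfolding n_def by (rule poly_divide_tendsto_aux)
  then have "((\<lambda>t::real. poly q (of_real t) / of_real t ^ n) \<longlongrightarrow> lead_coeff q) at_top"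
    by (rule filterlim_compose) (rule filterlim_of_real_at_infinity)
  then have lim: "((\<lambda>t::real. norm (poly q (of_real t) / of_real t ^ n)) \<longlongrightarrow> norm (lead_coeff q)) at_top"
    by (rule tendsto_norm)
  have "((\<lambda>t::real. C / t) \<longlongrightarrow> 0) at_top" by real_asymp
  moreover have "eventually (\<lambda>t::real. norm (poly q (of_real t) / of_real t ^ n) \<le> C / t) at_top"
    using eventually_ge_at_top[of 1]
  proof eventually_elim
    case (elim t)
    have C: "C \<ge> 0" using assms[of 1] by (simp add: order.trans[OF norm_ge_zero])
    have "norm (poly q (of_real t)) * t \<le> C * t ^ N * t"
      using assms[of t] elim by (intro mult_right_mono) auto
    also have "\<dots> \<le> C * t ^ n"
    proof -
      have "t ^ Suc N \<le> t ^ n" using n elim by (intro power_increasing) auto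
      then have "C * t ^ Suc N \<le> C * t ^ n" using C by (rule mult_left_mono)
      then show ?thesis by (simp add: algebra_simps)
    qed
    finally show ?case using elim by (simp add: norm_divide norm_power divide_simps)
  qed
  ultimately have "norm (lead_coeff q) \<le> 0"
    using lim by (intro tendsto_le[of at_top]) auto
  then have "q = 0" by simp
  then show False using n n_def by simp
qed


section \<open>The quadratic system\<close>

text \<open>Independence is a property of sets, so counting a family by its index set also needs
  injectivity.\<close>

lemma (in vector_space) independent_family:
  assumes "finite J" and zero: "\<And>c. (\<Sum>j\<in>J. scale (c j) (w j)) = 0 \<Longrightarrow> \<forall>j\<in>J. c j = 0"
  shows "inj_on w J" "independent (w ` J)"
proof -
  show inj: "inj_on w J"
  proof (rule inj_onI, rule ccontr)
    fix i j assume ij: "i \<in> J" "j \<in> J" "w i = w j" "i \<noteq> j"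
    have "(\<Sum>k\<in>J. scale (if k = i then 1 else if k = j then - 1 else 0) (w k)) =
        (\<Sum>k\<in>{i, j}. scale (if k = i then 1 else if k = j then - 1 else 0) (w k))"
      by (rule sum.mono_neutral_right) (use assms ij in auto)
    also have "\<dots> = 0" using ij by simp
    finally show False using zero ij(1) by force
  qed
  show "independent (w ` J)"
  proof (rule independent_if_scalars_zero)
    show "finite (w ` J)" using assms by simp
    fix f x assume sum0: "(\<Sum>x\<in>w ` J. scale (f x) x) = 0" and x: "x \<in> w ` J"
    then have "(\<Sum>j\<in>J. scale (f (w j)) (w j)) = 0" using inj by (simp add: sum.reindex)
    then show "f x = 0" using zero[of "\<lambda>j. f (w j)"] x by auto
  qed
qed

interpretation fs: vector_space "\<lambda>c (f :: 'a \<Rightarrow> complex) x. c * f x"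
  by unfold_locales (auto simp: fun_eq_iff algebra_simps)

text \<open>These equations say \<open>x\<^sub>j \<partial>q/\<partial>x\<^sub>j = b\<^sub>j\<close> for \<open>q = \<Sum>\<^bsub>j\<le>k\<^esub> x\<^sub>j x\<^sub>k\<close>.\<close>

definition quad_sols :: "nat \<Rightarrow> (nat \<Rightarrow> complex) \<Rightarrow> (nat \<Rightarrow> complex) set" where
  "quad_sols d b = {x. (\<forall>j\<ge>d. x j = 0) \<and> (\<forall>j<d. (x j)\<^sup>2 + x j * (\<Sum>k<d. x k) = b j)}"

text \<open>On solutions, the functions given by squarefree monomials span a space closed under
  multiplication by each \<open>x\<^sub>j\<close>: for a monomial \<open>x\<^sub>T\<close>, the products \<open>x\<^sub>k x\<^sub>T\<close> with \<open>k \<in> T\<close> solve a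
  linear system with the invertible matrix \<open>I + J\<close>, where \<open>J\<close> is the all-ones matrix.\<close>

lemma card_quad_sols_subset_le:
  assumes Z: "finite Z" "Z \<subseteq> quad_sols d b"
  shows "card Z \<le> 2 ^ d"
proof -
  \<comment> \<open>Cut off outside \<open>Z\<close>, so that equality of functions is equality on
    \<open>Z\<close>.\<close>
  define mon :: "nat set \<Rightarrow> (nat \<Rightarrow> complex) \<Rightarrow> complex"
    where "mon T = (\<lambda>x. if x \<in> Z then \<Prod>j\<in>T. x j else 0)" for T
  define W where "W = fs.span (mon ` Pow {..<d})"
  have mon_W: "mon T \<in> W" if "T \<subseteq> {..<d}" for T
    unfolding W_def using that by (intro fs.span_base) auto
  have W_add: "(\<lambda>x. f x + g x) \<in> W" if "f \<in> W" "g \<in> W" for f g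
    using fs.span_add[of f _ g] that by (simp add: W_def plus_fun_def)
  have W_scale: "(\<lambda>x. c * f x) \<in> W" if "f \<in> W" for f c
    using that by (simp add: W_def fs.span_scale)
  have W_diff: "(\<lambda>x. f x - g x) \<in> W" if "f \<in> W" "g \<in> W" for f g
    using W_add[OF that(1) W_scale[OF that(2), of "-1"]] by simp
  have W_0: "(\<lambda>x. 0) \<in> W"
    using fs.span_zero by (simp add: W_def zero_fun_def)
  have W_sum: "(\<lambda>x. \<Sum>i\<in>I. f i x) \<in> W" if "\<And>i. i \<in> I \<Longrightarrow> f i \<in> W" for I :: "nat set" and f
    using that by (induction I rule: infinite_finite_induct) (auto intro: W_0 W_add)
  have mult_mon: "(\<lambda>x. x j * mon T x) \<in> W" if T: "T \<subseteq> {..<d}" and j: "j < d" for T j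
  proof (cases "j \<in> T")
    case False
    have "finite T" using T finite_subset by auto
    then have "(\<lambda>x. x j * mon T x) = mon (insert j T)"
      using False by (auto simp: mon_def)
    then show ?thesis using mon_W[of "insert j T"] T j by simp
  next
    case True
    have fin: "finite T" using T finite_subset by auto
    \<comment> \<open>The equation for \<open>k\<close> times the monomial of \<open>T - {k}\<close>
      reads \<open>x_k x_T + S x_T = b_k x_{T - {k}}\<close>. Splitting \<open>S\<close> at
      \<open>T\<close> leaves \<open>Y\<close> on the left and moves the squarefree terms with
      \<open>l\<close> outside \<open>T\<close> into \<open>R k\<close>.\<close>
    define Y where "Y = (\<lambda>x. \<Sum>k\<in>T. x k * mon T x)"
    define R where "R k = (\<lambda>x. b k * mon (T - {k}) x - (\<Sum>l\<in>{..<d} - T. mon (insert l T) x))" for k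
    have R_W: "R k \<in> W" for k
      unfolding R_def using T by (intro W_diff W_scale W_sum mon_W) auto
    have eq: "x k * mon T x + Y x = R k x" if k: "k \<in> T" for x k
    proof (cases "x \<in> Z")
      case x: True
      then have sol: "(x k)\<^sup>2 + x k * (\<Sum>l<d. x l) = b k"
        using Z(2) k T by (auto simp: quad_sols_def)
      have xT: "(\<Prod>j\<in>T. x j) = x k * (\<Prod>j\<in>T - {k}. x j)"
        using k fin by (simp add: prod.remove)
      have split: "(\<Sum>l<d. x l) = (\<Sum>l\<in>T. x l) + (\<Sum>l\<in>{..<d} - T. x l)"
        using sum.subset_diff[OF T, of x] by simp
      have ins: "(\<Sum>l\<in>{..<d} - T. mon (insert l T) x) = (\<Sum>l\<in>{..<d} - T. x l) * (\<Prod>j\<in>T. x j)"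
        unfolding sum_distrib_right using fin x by (intro sum.cong) (auto simp: mon_def)
      have "R k x = ((x k)\<^sup>2 + x k * (\<Sum>l<d. x l)) * (\<Prod>j\<in>T - {k}. x j)
          - (\<Sum>l\<in>{..<d} - T. x l) * (\<Prod>j\<in>T. x j)"
        unfolding R_def ins using x sol by (simp add: mon_def)
      also have "\<dots> = x k * (\<Prod>j\<in>T. x j) + (\<Sum>l\<in>T. x l) * (\<Prod>j\<in>T. x j)"
        unfolding split xT by (simp add: algebra_simps power2_eq_square)
      also have "\<dots> = x k * mon T x + Y x"
        using x by (simp add: Y_def mon_def sum_distrib_right)
      finally show ?thesis by simp
    qed (simp add: Y_def R_def mon_def)
    \<comment> \<open>Summing the equations over \<open>T\<close> counts \<open>Y\<close> once from
      the first terms and \<open>card T\<close> times from the second: the eigenvalue of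
      \<open>I + J\<close> at the all-ones vector.\<close>
    have "Y x = 1 / of_nat (card T + 1) * (\<Sum>k\<in>T. R k x)" for x
    proof -
      have "(\<Sum>k\<in>T. R k x) = (\<Sum>k\<in>T. x k * mon T x + Y x)"
        by (rule sum.cong) (simp_all add: eq)
      also have "\<dots> = of_nat (card T + 1) * Y x"
        by (simp add: sum.distrib Y_def algebra_simps)
      finally show ?thesis by (simp del: of_nat_add of_nat_Suc)
    qed
    then have "Y = (\<lambda>x. 1 / of_nat (card T + 1) * (\<Sum>k\<in>T. R k x))" by auto
    also have "\<dots> \<in> W" by (intro W_scale W_sum R_W)
    finally have "Y \<in> W" .
    then have "(\<lambda>x. R j x - Y x) \<in> W" by (intro W_diff R_W)
    moreover have "(\<lambda>x. R j x - Y x) = (\<lambda>x. x j * mon T x)"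
      using eq[OF True] by (auto simp: algebra_simps)
    ultimately show ?thesis by simp
  qed
  have mult_W: "(\<lambda>x. x j * f x) \<in> W" if f: "f \<in> W" and j: "j < d" for f j
    using f unfolding W_def
  proof (induction rule: fs.span_induct_alt)
    case base
    show ?case using W_0 by (simp add: W_def)
  next
    case (step c g h)
    then obtain T where T: "T \<subseteq> {..<d}" "g = mon T" by auto
    have "(\<lambda>x. c * (x j * g x) + x j * h x) \<in> W"
      using mult_mon[OF T(1) j] step(2) by (intro W_add W_scale) (auto simp: T W_def)
    then show ?case by (simp add: W_def algebra_simps)
  qed
  have "\<exists>j<d. x j \<noteq> w j" if "x \<in> Z" "w \<in> Z" "x \<noteq> w" for x w
  proof (rule ccontr)
    assume "\<not> (\<exists>j<d. x j \<noteq> w j)"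
    moreover have "x j = w j" if "j \<ge> d" for j
    proof -
      have "x \<in> quad_sols d b" "w \<in> quad_sols d b" using Z(2) \<open>x \<in> Z\<close> \<open>w \<in> Z\<close> by auto
      then show ?thesis using \<open>j \<ge> d\<close> by (simp add: quad_sols_def)
    qed
    ultimately have "x = w" by (intro ext) (metis not_le)
    then show False using that by simp
  qed
  then obtain J where J: "\<And>x w. x \<in> Z \<Longrightarrow> w \<in> Z \<Longrightarrow> x \<noteq> w \<Longrightarrow> J x w < d \<and> x (J x w) \<noteq> w (J x w)"
    by metis
  \<comment> \<open>Lagrange interpolation along separating coordinates puts these indicators into
    \<open>W\<close>. They are independent, so \<open>Z\<close> has at most as many points as
    \<open>W\<close> has generators.\<close>
  define \<delta> :: "(nat \<Rightarrow> complex) \<Rightarrow> (nat \<Rightarrow> complex) \<Rightarrow> complex"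
    where "\<delta> z = (\<lambda>x. if x = z then 1 else 0)" for z
  have \<delta>_W: "\<delta> z \<in> W" if z: "z \<in> Z" for z
  proof -
    have prod_W: "(\<lambda>x. (\<Prod>w\<in>A. (x (J z w) - w (J z w)) / (z (J z w) - w (J z w))) * mon {} x) \<in> W"
      if "finite A" "A \<subseteq> Z - {z}" for A
      using that
    proof (induction A rule: finite_induct)
      case empty
      then show ?case using mon_W[of "{}"] by simp
    next
      case (insert w A)
      let ?f = "\<lambda>x. (\<Prod>w\<in>A. (x (J z w) - w (J z w)) / (z (J z w) - w (J z w))) * mon {} x"
      have "J z w < d" using J[of z w] insert.prems z by auto
      then have "(\<lambda>x. (1 / (z (J z w) - w (J z w))) * (x (J z w) * ?f x - w (J z w) * ?f x)) \<in> W"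
        using insert by (intro W_scale W_diff mult_W) auto
      then show ?case using insert.hyps
        by (simp add: algebra_simps diff_divide_distrib)
    qed
    have "\<delta> z = (\<lambda>x. (\<Prod>w\<in>Z - {z}. (x (J z w) - w (J z w)) / (z (J z w) - w (J z w))) * mon {} x)"
    proof
      fix x
      consider "x = z" | "x \<in> Z" "x \<noteq> z" | "x \<notin> Z" using z by blast
      then show "\<delta> z x = (\<Prod>w\<in>Z - {z}. (x (J z w) - w (J z w)) / (z (J z w) - w (J z w))) * mon {} x"
      proof cases
        case 1
        have "(\<Prod>w\<in>Z - {z}. (z (J z w) - w (J z w)) / (z (J z w) - w (J z w))) = 1"
          by (rule prod.neutral) (use J[OF z] in force)
        then show ?thesis using 1 z by (simp add: \<delta>_def mon_def)
      next
        case 2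
        then have "(\<Prod>w\<in>Z - {z}. (x (J z w) - w (J z w)) / (z (J z w) - w (J z w))) = 0"
          using Z(1) by (intro prod_zero) (auto intro!: bexI[of _ x])
        then show ?thesis using 2 by (simp add: \<delta>_def)
      qed (auto simp: \<delta>_def mon_def z)
    qed
    then show ?thesis using prod_W[of "Z - {z}"] Z(1) by simp
  qed
  have zero: "\<forall>z\<in>Z. c z = 0" if "(\<Sum>z\<in>Z. (\<lambda>x. c z * \<delta> z x)) = 0" for c
  proof
    fix z assume z: "z \<in> Z"
    have "(\<Sum>w\<in>Z. (\<lambda>x. c w * \<delta> w x)) z = (\<Sum>w\<in>Z. c w * \<delta> w z)"
      by (induction Z rule: infinite_finite_induct) auto
    also have "\<dots> = c z" using Z(1) z by (simp add: \<delta>_def if_distrib cong: if_cong)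
    finally show "c z = 0" using that by simp
  qed
  have inj: "inj_on \<delta> Z" by (rule fs.independent_family(1)[OF Z(1) zero])
  have "card (\<delta> ` Z) \<le> card (mon ` Pow {..<d})"
    using fs.independent_span_bound[of "mon ` Pow {..<d}" "\<delta> ` Z"]
      fs.independent_family(2)[OF Z(1) zero] \<delta>_W by (auto simp: W_def)
  also have "\<dots> \<le> card (Pow {..<d})" by (rule card_image_le) simp
  also have "\<dots> = 2 ^ d" by (simp add: card_Pow)
  finally show ?thesis using card_image[OF inj] by simp
qed

text \<open>The uniform bound on finite subsets gives finiteness of the whole set first, after which
  the bound applies to the set itself.\<close>

lemma quad_sols_finite: "finite (quad_sols d b)" and card_quad_sols_le: "card (quad_sols d b) \<le> 2 ^ d"
proof -
  show fin: "finite (quad_sols d b)"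
    using finite_if_finite_subsets_card_bdd[of "quad_sols d b" "2 ^ d"] card_quad_sols_subset_le
    by blast
  show "card (quad_sols d b) \<le> 2 ^ d" by (rule card_quad_sols_subset_le) (use fin in auto)
qed


section \<open>Counting the solutions\<close>

text \<open>Its zeros are the values of \<open>S\<close> on real solutions where \<open>y\<^sub>j\<close> is the positive square root
  for \<open>j \<in> T\<close> and the negative one otherwise.\<close>

definition sqrt_gap :: "nat \<Rightarrow> nat set \<Rightarrow> (nat \<Rightarrow> real) \<Rightarrow> real \<Rightarrow> real" where
  "sqrt_gap d T b s =
     (real d + 2) * s - (\<Sum>j<d. if j \<in> T then sqrt (s\<^sup>2 + 4 * b j) else - sqrt (s\<^sup>2 + 4 * b j))"

text \<open>The square root is the modulus of the complex number with parts \<open>s\<close> and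
  \<open>sqrt c\<close>, so this is the reverse triangle inequality.\<close>

lemma sqrt_lipschitz:
  fixes s t c :: real
  assumes "c \<ge> 0"
  shows "\<bar>sqrt (s\<^sup>2 + c) - sqrt (t\<^sup>2 + c)\<bar> \<le> \<bar>s - t\<bar>"
proof -
  have "\<bar>cmod (Complex s (sqrt c)) - cmod (Complex t (sqrt c))\<bar>
      \<le> cmod (Complex s (sqrt c) - Complex t (sqrt c))"
    by (rule norm_triangle_ineq3)
  then show ?thesis using assms by (simp add: cmod_def)
qed

text \<open>The linear term has slope \<open>d + 2\<close>, while the \<open>d\<close> signed roots
  together change at most with slope \<open>d\<close>.\<close>

lemma sqrt_gap_strict_mono:
  assumes "\<And>j. j < d \<Longrightarrow> b j \<ge> 0" "s < t"
  shows "sqrt_gap d T b s < sqrt_gap d T b t"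
proof -
  let ?g = "\<lambda>s j. if j \<in> T then sqrt (s\<^sup>2 + 4 * b j) else - sqrt (s\<^sup>2 + 4 * b j)"
  have "(\<Sum>j<d. ?g t j) - (\<Sum>j<d. ?g s j) = (\<Sum>j<d. ?g t j - ?g s j)"
    by (simp add: sum_subtractf)
  also have "\<dots> \<le> (\<Sum>j<d. t - s)"
  proof (rule sum_mono)
    fix j assume "j \<in> {..<d}"
    then have "\<bar>sqrt (t\<^sup>2 + 4 * b j) - sqrt (s\<^sup>2 + 4 * b j)\<bar> \<le> t - s"
      using sqrt_lipschitz[of "4 * b j" t s] assms by auto
    then show "?g t j - ?g s j \<le> t - s" by (auto simp: abs_le_iff)
  qed
  also have "\<dots> = real d * (t - s)" by simp
  also have "\<dots> < (real d + 2) * (t - s)" using assms by simp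
  finally show ?thesis unfolding sqrt_gap_def by (simp add: algebra_simps)
qed

lemma sqrt_gap_root_ex1:
  assumes b: "\<And>j. j < d \<Longrightarrow> b j \<ge> 0"
  shows "\<exists>!s. sqrt_gap d T b s = 0"
proof -
  \<comment> \<open>At absolute value \<open>M\<close> of \<open>s\<close> each root is at most
    \<open>M + 2 * sqrt (b j)\<close>, so the roots sum to at most \<open>d M + M\<close>, which the
    linear term of size \<open>(d + 2) M\<close> dominates. This gives the signs at both
    ends.\<close>
  define M where "M = (\<Sum>j<d. 2 * sqrt (b j))"
  have M: "M \<ge> 0" unfolding M_def using b by (intro sum_nonneg) auto
  have le: "\<bar>\<Sum>j<d. if j \<in> T then sqrt (s\<^sup>2 + 4 * b j) else - sqrt (s\<^sup>2 + 4 * b j)\<bar> \<le> real d * M + M"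
    if s: "\<bar>s\<bar> = M" for s
  proof -
    have "\<bar>\<Sum>j<d. if j \<in> T then sqrt (s\<^sup>2 + 4 * b j) else - sqrt (s\<^sup>2 + 4 * b j)\<bar>
        \<le> (\<Sum>j<d. \<bar>if j \<in> T then sqrt (s\<^sup>2 + 4 * b j) else - sqrt (s\<^sup>2 + 4 * b j)\<bar>)"
      by (rule sum_abs)
    also have "\<dots> \<le> (\<Sum>j<d. M + 2 * sqrt (b j))"
    proof (rule sum_mono)
      fix j assume "j \<in> {..<d}"
      then have bj: "b j \<ge> 0" using b by simp
      have "sqrt (s\<^sup>2 + 4 * b j) \<le> sqrt (s\<^sup>2) + sqrt (4 * b j)"
        by (rule sqrt_add_le_add_sqrt) (use bj in auto)
      also have "\<dots> = M + 2 * sqrt (b j)" using s by (simp add: real_sqrt_mult)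
      finally show "\<bar>if j \<in> T then sqrt (s\<^sup>2 + 4 * b j) else - sqrt (s\<^sup>2 + 4 * b j)\<bar>
          \<le> M + 2 * sqrt (b j)"
        using bj by auto
    qed
    also have "\<dots> = real d * M + M" by (simp add: sum.distrib M_def)
    finally show ?thesis .
  qed
  have "sqrt_gap d T b (-M) \<le> 0" "0 \<le> sqrt_gap d T b M"
    using le[of "-M"] le[of M] M by (auto simp: sqrt_gap_def algebra_simps abs_le_iff)
  moreover have "continuous_on {-M..M} (\<lambda>s. if j \<in> T then sqrt (s\<^sup>2 + 4 * b j)
      else - sqrt (s\<^sup>2 + 4 * b j))" for j
    by (cases "j \<in> T") (auto intro!: continuous_intros)
  then have "continuous_on {-M..M} (sqrt_gap d T b)"
    unfolding sqrt_gap_def by (intro continuous_intros)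
  ultimately obtain s where "sqrt_gap d T b s = 0"
    using IVT'[of "sqrt_gap d T b" "-M" 0 M] M by auto
  moreover have "s = t" if "sqrt_gap d T b s = 0" "sqrt_gap d T b t = 0" for s t
    using that sqrt_gap_strict_mono[of d b s t T, OF b] sqrt_gap_strict_mono[of d b t s T, OF b]
    by (metis less_irrefl linorder_neqE_linordered_idom)
  ultimately show ?thesis by blast
qed

text \<open>Raising \<open>b\<^sub>j\<close> moves the root for \<open>T\<close> up if \<open>j \<in> T\<close> and down otherwise, so on every line in
  direction \<open>j\<close> two sign patterns that differ at \<open>j\<close> share a root at most once.\<close>

lemma sqrt_gap_no_second_collision:
  assumes b: "\<And>k. k < d \<Longrightarrow> b k \<ge> 0" "\<And>k. k < d \<Longrightarrow> b' k \<ge> 0"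
    and j: "j < d" "j \<in> T" "j \<notin> T'" and less: "b j < b' j"
    and eq: "\<And>k. k < d \<Longrightarrow> k \<noteq> j \<Longrightarrow> b k = b' k"
    and s: "sqrt_gap d T b s = 0" "sqrt_gap d T' b s = 0"
    and t: "sqrt_gap d T b' t = 0" "sqrt_gap d T' b' t = 0"
  shows False
proof -
  have rem: "sqrt_gap d U c s = (real d + 2) * s
      - (\<Sum>k\<in>{..<d} - {j}. if k \<in> U then sqrt (s\<^sup>2 + 4 * c k) else - sqrt (s\<^sup>2 + 4 * c k))
      - (if j \<in> U then sqrt (s\<^sup>2 + 4 * c j) else - sqrt (s\<^sup>2 + 4 * c j))" for U c
    unfolding sqrt_gap_def using j by (subst sum.remove[of _ j]) auto
  have same: "(\<Sum>k\<in>{..<d} - {j}. if k \<in> U then sqrt (s\<^sup>2 + 4 * b' k) else - sqrt (s\<^sup>2 + 4 * b' k))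
     = (\<Sum>k\<in>{..<d} - {j}. if k \<in> U then sqrt (s\<^sup>2 + 4 * b k) else - sqrt (s\<^sup>2 + 4 * b k))" for U
    by (rule sum.cong) (auto simp: eq)
  have root_less: "sqrt (s\<^sup>2 + 4 * b j) < sqrt (s\<^sup>2 + 4 * b' j)" using less by simp
  \<comment> \<open>At the old common root one gap falls and the other rises. Both gaps increase in
    \<open>s\<close>, so the new roots lie on opposite sides of \<open>s\<close> and cannot both be
    \<open>t\<close>.\<close>
  have "sqrt_gap d T b' s = sqrt_gap d T b s - (sqrt (s\<^sup>2 + 4 * b' j) - sqrt (s\<^sup>2 + 4 * b j))"
    "sqrt_gap d T' b' s = sqrt_gap d T' b s + (sqrt (s\<^sup>2 + 4 * b' j) - sqrt (s\<^sup>2 + 4 * b j))"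
    unfolding rem same using j by simp_all
  then have "sqrt_gap d T b' s < 0" "0 < sqrt_gap d T' b' s"
    using s root_less by linarith+
  then have "s < t" "t < s"
    using t sqrt_gap_strict_mono[of d b' t s T] sqrt_gap_strict_mono[of d b' s t T'] b(2)
    by (metis less_asym linorder_neqE_linordered_idom less_irrefl)+
  then show False by simp
qed

text \<open>By the previous lemma each of the fewer than \<open>4\<^sup>d\<close> collision sets contains at most a fraction
  \<open>1/N\<close> of the grid \<open>{1..N}\<^sup>d\<close>, so for \<open>N > 4\<^sup>d\<close> they do not cover it.\<close>

lemma ex_distinct_sqrt_gap_roots:
  assumes d: "d > 0"
  shows "\<exists>b. (\<forall>j<d. b j > 0) \<and>
    inj_on (\<lambda>T. THE s. sqrt_gap d T b s = 0) (Pow {..<d})"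
proof (rule ccontr)
  assume contr: "\<not> ?thesis"
  \<comment> \<open>One more than a bound on the number of ordered pairs of sign patterns.\<close>
  define N where "N = Suc (2 ^ d * 2 ^ d)"
  define B :: "(nat \<Rightarrow> nat) set" where "B = PiE {..<d} (\<lambda>_. {1..N})"
  \<comment> \<open>Of two distinct patterns one has an index missing from the other, so ordering
    the pair suitably always yields the direction \<open>j\<close> used below.\<close>
  define pairs where "pairs = {(T, T'). T \<subseteq> {..<d} \<and> T' \<subseteq> {..<d} \<and> T - T' \<noteq> {}}"
  define bad where "bad P = {b \<in> B. \<exists>s. sqrt_gap d (fst P) (real \<circ> b) s = 0
      \<and> sqrt_gap d (snd P) (real \<circ> b) s = 0}" for P
  have root: "sqrt_gap d T (real \<circ> b) (THE s. sqrt_gap d T (real \<circ> b) s = 0) = 0" for T b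
    by (rule theI') (rule sqrt_gap_root_ex1, simp)
  have cover: "B \<subseteq> (\<Union>P\<in>pairs. bad P)"
  proof
    fix b assume b: "b \<in> B"
    then have "\<forall>j<d. (real \<circ> b) j > 0" by (force simp: B_def PiE_def Pi_def)
    then have "\<not> inj_on (\<lambda>T. THE s. sqrt_gap d T (real \<circ> b) s = 0) (Pow {..<d})"
      using contr by blast
    then obtain T T' where T: "T \<subseteq> {..<d}" "T' \<subseteq> {..<d}" "T \<noteq> T'"
      "(THE s. sqrt_gap d T (real \<circ> b) s = 0) = (THE s. sqrt_gap d T' (real \<circ> b) s = 0)"
      by (auto simp: inj_on_def)
    then have "b \<in> bad (T, T')" "b \<in> bad (T', T)"
      using root[of T b] root[of T' b] b by (auto simp: bad_def)
    moreover have "(T, T') \<in> pairs \<or> (T', T) \<in> pairs" using T by (auto simp: pairs_def)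
    ultimately show "b \<in> (\<Union>P\<in>pairs. bad P)" by blast
  qed
  have pairs_sub: "pairs \<subseteq> Pow {..<d} \<times> Pow {..<d}" by (auto simp: pairs_def)
  then have fin_pairs: "finite pairs" by (rule finite_subset) simp
  have finB: "finite B" unfolding B_def by (intro finite_PiE) auto
  have bad_le: "card (bad P) \<le> N ^ (d - 1)" if P: "P \<in> pairs" for P
  proof -
    obtain T T' where TT: "P = (T, T')" "T \<subseteq> {..<d}" using P by (auto simp: pairs_def)
    obtain j where j: "j < d" "j \<in> T" "j \<notin> T'" using P TT by (auto simp: pairs_def)
    let ?I = "{..<d} - {j}"
    have "inj_on (\<lambda>b. restrict b ?I) (bad P)"
    proof (rule inj_onI)
      fix b c assume bc: "b \<in> bad P" "c \<in> bad P" "restrict b ?I = restrict c ?I"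
      have B: "b \<in> B" "c \<in> B" using bc by (auto simp: bad_def)
      have eq: "b k = c k" if "k < d" "k \<noteq> j" for k
        using fun_cong[OF bc(3), of k] that by simp
      obtain s t where s: "sqrt_gap d T (real \<circ> b) s = 0" "sqrt_gap d T' (real \<circ> b) s = 0"
        and t: "sqrt_gap d T (real \<circ> c) t = 0" "sqrt_gap d T' (real \<circ> c) t = 0"
        using bc TT by (auto simp: bad_def)
      have "\<not> b j < c j"
        using sqrt_gap_no_second_collision[of d "real \<circ> b" "real \<circ> c" j T T' s t] j s t eq by auto
      moreover have "\<not> c j < b j"
        using sqrt_gap_no_second_collision[of d "real \<circ> c" "real \<circ> b" j T T' t s] j s t eq by auto
      ultimately have "b j = c j" by simp
      then have "b k = c k" if "k \<in> {..<d}" for k using eq that by (cases "k = j") auto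
      then show "b = c" using B unfolding B_def by (intro PiE_ext) auto
    qed
    moreover have "(\<lambda>b. restrict b ?I) ` bad P \<subseteq> PiE ?I (\<lambda>_. {1..N})"
      by (auto simp: bad_def B_def PiE_def Pi_def)
    ultimately have "card (bad P) \<le> card (PiE ?I (\<lambda>_. {1..N}))"
      by (intro card_inj_on_le[of "\<lambda>b. restrict b ?I"]) (auto intro: finite_PiE)
    also have "\<dots> = N ^ (d - 1)" using j by (simp add: card_PiE)
    finally show ?thesis .
  qed
  have "N * N ^ (d - 1) = card B"
    using d by (simp add: B_def card_PiE power_eq_if)
  also have "\<dots> \<le> card (\<Union>P\<in>pairs. bad P)"
    by (rule card_mono) (use cover fin_pairs finB in \<open>simp_all add: bad_def\<close>)
  also have "\<dots> \<le> (\<Sum>P\<in>pairs. card (bad P))" by (rule card_UN_le[OF fin_pairs])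
  also have "\<dots> \<le> (\<Sum>P\<in>pairs. N ^ (d - 1))" by (rule sum_mono) (rule bad_le)
  also have "\<dots> = card pairs * N ^ (d - 1)" by simp
  also have "\<dots> \<le> (2 ^ d * 2 ^ d) * N ^ (d - 1)"
    using card_mono[OF _ pairs_sub] by (intro mult_right_mono) (simp_all add: card_cartesian_product card_Pow)
  also have "\<dots> < N * N ^ (d - 1)" by (simp add: N_def)
  finally show False by simp
qed

text \<open>Inverts \<open>y_j = 2 x_j + S\<close>. The hypothesis with \<open>d + 2\<close> is
  exactly what makes the resulting \<open>x j\<close> sum to \<open>s\<close>.\<close>

lemma sqrt_sum_imp_quad_sol:
  assumes r: "\<And>j. j < d \<Longrightarrow> (r j)\<^sup>2 = s\<^sup>2 + 4 * b j"
    and s: "(of_nat d + 2) * s = (\<Sum>j<d. if j \<in> T then r j else - r j)"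
  shows "\<exists>x\<in>quad_sols d b. (\<Sum>j<d. x j) = s"
proof -
  define x where "x j = (if j < d then (- s + (if j \<in> T then r j else - r j)) / 2 else 0)" for j
  have "(\<Sum>j<d. x j) = (\<Sum>j<d. (- s + (if j \<in> T then r j else - r j)) / 2)"
    by (rule sum.cong) (auto simp: x_def)
  also have "\<dots> = (- of_nat d * s + (\<Sum>j<d. if j \<in> T then r j else - r j)) / 2"
    by (simp add: sum_divide_distrib[symmetric] sum.distrib sum_subtractf)
  also have "\<dots> = s" unfolding s[symmetric] by (simp add: algebra_simps)
  finally have sum: "(\<Sum>j<d. x j) = s" .
  have "(x j)\<^sup>2 + x j * s = b j" if j: "j < d" for j
  proof -
    have sq: "(if j \<in> T then r j else - r j)\<^sup>2 = s\<^sup>2 + 4 * b j" using r[OF j] by auto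
    have "4 * ((x j)\<^sup>2 + x j * s) = (if j \<in> T then r j else - r j)\<^sup>2 - s\<^sup>2"
      using j by (simp add: x_def power2_eq_square field_simps)
    also have "\<dots> = 4 * b j" unfolding sq by simp
    finally show ?thesis by (simp only: mult_cancel_left) simp
  qed
  moreover have "x j = 0" if "j \<ge> d" for j using that by (simp add: x_def)
  ultimately have "x \<in> quad_sols d b" by (simp add: quad_sols_def sum)
  then show ?thesis using sum by blast
qed

text \<open>The sign product with radicands \<open>S^2 + 4 b_j\<close>, evaluated at
  \<open>(d + 2) S\<close>, is the eliminant in \<open>S\<close>. The witness \<open>u0\<close> is
  returned with positive values so that further nonvanishing conditions can be checked at the same
  point.\<close>

lemma generic_card_quad_sols:
  fixes \<beta> :: "nat \<Rightarrow> 'p \<Rightarrow> complex"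
  assumes d: "d > 0" and \<beta>: "\<And>j. j < d \<Longrightarrow> \<beta> j \<in> polyfun X"
    and surj: "\<And>c. \<exists>u. \<forall>j<d. \<beta> j u = c j"
  shows "\<exists>D\<in>polyfun X. \<exists>u0. D u0 \<noteq> 0 \<and> (\<forall>j<d. \<exists>t>0. \<beta> j u0 = of_real t) \<and>
    (\<forall>u. D u \<noteq> 0 \<longrightarrow> card (quad_sols d (\<lambda>j. \<beta> j u)) = 2 ^ d)"
proof -
  \<comment> \<open>Here \<open>fst p\<close> is the unknown \<open>S\<close> and
    \<open>snd p\<close> is the parameter \<open>u\<close>; the argument of the sign product is a
    second adjoined variable.\<close>
  define \<rho> where "\<rho> j p = (fst p)\<^sup>2 + 4 * \<beta> j (snd p)" for j and p :: "complex \<times> 'p"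
  have \<rho>: "\<rho> j \<in> polyfun (extend_coords X)" if "j < d" for j
    unfolding \<rho>_def using \<beta>[OF that]
    by (intro polyfun.add polyfun_power polyfun_fst polyfun.mult polyfun.const polyfun_snd)
  obtain E where E: "E \<in> polyfun (extend_coords (extend_coords X))"
    "\<And>z p r. (\<forall>j<d. (r j)\<^sup>2 = \<rho> j p) \<Longrightarrow> E (z, p) = sign_prod d z r"
    using polyfun_sign_prod[of d \<rho> "extend_coords X"] \<rho> by auto
  define P where "P p = E ((of_nat d + 2) * fst p, p)" for p
  have "P \<in> polyfun (extend_coords X)"
    unfolding P_def
  proof (rule polyfun_subst[OF E(1)])
    fix f assume "f \<in> extend_coords (extend_coords X)"
    then consider "f = fst" | g where "g \<in> extend_coords X" "f = g \<circ> snd" by blast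
    then show "(\<lambda>p. f ((of_nat d + 2) * fst p, p)) \<in> polyfun (extend_coords X)"
    proof cases
      case 1
      then show ?thesis by (simp add: polyfun.mult[OF polyfun.const polyfun_fst])
    next
      case 2
      then show ?thesis using polyfun.base[of g "extend_coords X"] by simp
    qed
  qed
  then obtain q where q: "\<And>s u. P (s, u) = poly (q u) s"
    and coeff_q: "\<And>i. (\<lambda>u. coeff (q u) i) \<in> polyfun X"
    using polyfun_univariate by metis
  have poly_q: "poly (q u) s = sign_prod d ((of_nat d + 2) * s) r"
    if "\<And>j. j < d \<Longrightarrow> (r j)\<^sup>2 = s\<^sup>2 + 4 * \<beta> j u" for u s r
    unfolding q[symmetric] P_def using that by (subst E(2)[of r]) (auto simp: \<rho>_def)
  have degree_q: "degree (q u) \<le> 2 ^ d" for u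
  proof (rule degree_le_of_growth)
    fix t :: real assume t: "t \<ge> 1"
    \<comment> \<open>For \<open>t \<ge> 1\<close> every root is bounded by \<open>t\<close> times
      its summand in \<open>K\<close>, so the base of the norm estimate is at most
      \<open>K * t\<close>.\<close>
    define K where "K = real d + 2 + (\<Sum>j<d. 1 + 2 * sqrt (cmod (\<beta> j u)))"
    define r where "r j = csqrt ((of_real t)\<^sup>2 + 4 * \<beta> j u)" for j
    have r: "cmod (r j) \<le> t * (1 + 2 * sqrt (cmod (\<beta> j u)))" for j
    proof -
      have "cmod (r j) = sqrt (cmod ((of_real t)\<^sup>2 + 4 * \<beta> j u))"
        by (simp add: r_def)
      also have "\<dots> \<le> sqrt (t\<^sup>2 + 4 * cmod (\<beta> j u))"
        using norm_triangle_ineq[of "(of_real t)\<^sup>2" "4 * \<beta> j u"]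
        by (simp add: norm_mult norm_power)
      also have "\<dots> \<le> sqrt (t\<^sup>2) + sqrt (4 * cmod (\<beta> j u))"
        by (rule sqrt_add_le_add_sqrt) auto
      also have "\<dots> = t + 1 * (2 * sqrt (cmod (\<beta> j u)))" using t by (simp add: real_sqrt_mult)
      also have "\<dots> \<le> t + t * (2 * sqrt (cmod (\<beta> j u)))"
        using t by (intro add_left_mono mult_right_mono) auto
      finally show ?thesis by (simp add: algebra_simps)
    qed
    have "cmod (poly (q u) (of_real t)) = cmod (sign_prod d ((of_nat d + 2) * of_real t) r)"
      by (subst poly_q[of r]) (auto simp: r_def)
    also have "\<dots> \<le> (cmod ((of_nat d + 2) * of_real t) + (\<Sum>j<d. cmod (r j))) ^ 2 ^ d"
      by (rule norm_sign_prod_le)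
    also have "cmod ((of_nat d + 2) * of_real t) = (real d + 2) * t"
    proof -
      have "(of_nat d + 2) * of_real t = (of_real ((real d + 2) * t) :: complex)" by simp
      then show ?thesis using t by (simp only: norm_of_real) simp
    qed
    also have "((real d + 2) * t + (\<Sum>j<d. cmod (r j))) ^ 2 ^ d \<le> (K * t) ^ 2 ^ d"
    proof (rule power_mono)
      have "(\<Sum>j<d. cmod (r j)) \<le> (\<Sum>j<d. t * (1 + 2 * sqrt (cmod (\<beta> j u))))"
        by (rule sum_mono) (rule r)
      also have "\<dots> = (\<Sum>j<d. 1 + 2 * sqrt (cmod (\<beta> j u))) * t"
        by (simp only: sum_distrib_left[symmetric] mult.commute)
      finally show "(real d + 2) * t + (\<Sum>j<d. cmod (r j)) \<le> K * t"
        unfolding K_def distrib_right by simp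
      show "0 \<le> (real d + 2) * t + (\<Sum>j<d. cmod (r j))"
        using t by (intro add_nonneg_nonneg sum_nonneg) auto
    qed
    finally show "cmod (poly (q u) (of_real t)) \<le> K ^ 2 ^ d * t ^ 2 ^ d"
      by (simp add: power_mult_distrib)
  qed
  obtain b where b: "\<And>j. j < d \<Longrightarrow> b j > 0"
    and inj: "inj_on (\<lambda>T. THE s. sqrt_gap d T b s = 0) (Pow {..<d})"
    using ex_distinct_sqrt_gap_roots[OF d] by auto
  obtain u0 where u0: "\<And>j. j < d \<Longrightarrow> \<beta> j u0 = of_real (b j)"
    using surj[of "\<lambda>j. of_real (b j)"] by blast
  define s where "s T = (THE s. sqrt_gap d T b s = 0)" for T
  have ex1: "\<exists>!s. sqrt_gap d T b s = 0" for T
    by (rule sqrt_gap_root_ex1) (use b less_imp_le in blast)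
  have gap_iff: "sqrt_gap d T b t = 0 \<longleftrightarrow> t = s T" for T t
    using theI'[OF ex1[of T]] ex1[of T] unfolding s_def[symmetric] by auto
  \<comment> \<open>Real roots suffice: they already supply \<open>2^d\<close> distinct ones, and
    the degree bound admits no more.\<close>
  have root_iff: "poly (q u0) (of_real t) = 0 \<longleftrightarrow> (\<exists>T\<subseteq>{..<d}. t = s T)" for t
  proof -
    have "poly (q u0) (of_real t)
        = sign_prod d ((of_nat d + 2) * of_real t) (\<lambda>j. of_real (sqrt (t\<^sup>2 + 4 * b j)))"
    proof (rule poly_q)
      fix j assume j: "j < d"
      have "(sqrt (t\<^sup>2 + 4 * b j))\<^sup>2 = t\<^sup>2 + 4 * b j" using b[OF j] by simp
      then show "(complex_of_real (sqrt (t\<^sup>2 + 4 * b j)))\<^sup>2 = (of_real t)\<^sup>2 + 4 * \<beta> j u0"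
        unfolding of_real_power[symmetric] using u0[OF j] by simp
    qed
    then have "poly (q u0) (of_real t) = 0 \<longleftrightarrow> (\<exists>T\<subseteq>{..<d}. (of_nat d + 2) * of_real t =
        (\<Sum>j<d. if j \<in> T then complex_of_real (sqrt (t\<^sup>2 + 4 * b j))
          else - complex_of_real (sqrt (t\<^sup>2 + 4 * b j))))"
      by (simp only: sign_prod_eq_0_iff)
    also have "\<dots> \<longleftrightarrow> (\<exists>T\<subseteq>{..<d}. sqrt_gap d T b t = 0)"
    proof (intro ex_cong1 conj_cong refl)
      fix T
      have "(\<Sum>j<d. if j \<in> T then complex_of_real (sqrt (t\<^sup>2 + 4 * b j))
          else - complex_of_real (sqrt (t\<^sup>2 + 4 * b j))) = of_real
          (\<Sum>j<d. if j \<in> T then sqrt (t\<^sup>2 + 4 * b j) else - sqrt (t\<^sup>2 + 4 * b j))"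
        unfolding of_real_sum by (rule sum.cong) auto
      moreover have "(of_nat d + 2) * complex_of_real t = of_real ((real d + 2) * t)" by simp
      ultimately show "((of_nat d + 2) * of_real t =
        (\<Sum>j<d. if j \<in> T then complex_of_real (sqrt (t\<^sup>2 + 4 * b j))
          else - complex_of_real (sqrt (t\<^sup>2 + 4 * b j)))) \<longleftrightarrow> sqrt_gap d T b t = 0"
        unfolding sqrt_gap_def by (simp only: of_real_eq_iff) simp
    qed
    finally show ?thesis by (simp only: gap_iff)
  qed
  have q0: "q u0 \<noteq> 0"
  proof
    \<comment> \<open>Otherwise every real number would be one of the finitely many
      \<open>s T\<close>.\<close>
    assume "q u0 = 0"
    then have "UNIV \<subseteq> s ` Pow {..<d}" using root_iff by auto
    then have "finite (UNIV :: real set)" by (rule finite_subset) simp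
    then show False using infinite_UNIV_char_0 by blast
  qed
  have card0: "card {z. poly (q u0) z = 0} = 2 ^ d"
  proof (rule antisym)
    show "card {z. poly (q u0) z = 0} \<le> 2 ^ d"
      using card_poly_roots_bound[OF q0] degree_q[of u0] by simp
    have "inj_on (\<lambda>T. complex_of_real (s T)) (Pow {..<d})"
      using inj by (simp add: inj_on_def s_def)
    then have "2 ^ d = card ((\<lambda>T. complex_of_real (s T)) ` Pow {..<d})"
      by (simp add: card_image card_Pow)
    also have "\<dots> \<le> card {z. poly (q u0) z = 0}"
      using poly_roots_finite[OF q0] root_iff by (intro card_mono) auto
    finally show "2 ^ d \<le> card {z. poly (q u0) z = 0}" .
  qed
  obtain D where D: "D \<in> polyfun X" "D u0 \<noteq> 0"
    "\<And>u. D u \<noteq> 0 \<Longrightarrow> card {z. poly (q u) z = 0} = 2 ^ d"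
    using generic_card_roots[OF coeff_q degree_q _ q0 card0] by auto
  have "card (quad_sols d (\<lambda>j. \<beta> j u)) = 2 ^ d" if "D u \<noteq> 0" for u
  proof (rule antisym[OF card_quad_sols_le])
    \<comment> \<open>Only the lower bound needs the eliminant: each of its roots is the sum of some
      solution, whether or not different solutions share a sum.\<close>
    have "{z. poly (q u) z = 0} \<subseteq> (\<lambda>x. \<Sum>j<d. x j) ` quad_sols d (\<lambda>j. \<beta> j u)"
    proof
      fix z assume z: "z \<in> {z. poly (q u) z = 0}"
      define r where "r j = csqrt (z\<^sup>2 + 4 * \<beta> j u)" for j
      have r: "(r j)\<^sup>2 = z\<^sup>2 + 4 * \<beta> j u" for j by (simp add: r_def)
      have "sign_prod d ((of_nat d + 2) * z) r = 0"
        using z poly_q[of r z u] r by simp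
      then obtain T where "(of_nat d + 2) * z = (\<Sum>j<d. if j \<in> T then r j else - r j)"
        unfolding sign_prod_eq_0_iff by blast
      then show "z \<in> (\<lambda>x. \<Sum>j<d. x j) ` quad_sols d (\<lambda>j. \<beta> j u)"
        using sqrt_sum_imp_quad_sol[of d r z "\<lambda>j. \<beta> j u" T] r by auto
    qed
    then have "card {z. poly (q u) z = 0} \<le> card (quad_sols d (\<lambda>j. \<beta> j u))"
      by (rule surj_card_le[OF quad_sols_finite])
    then show "2 ^ d \<le> card (quad_sols d (\<lambda>j. \<beta> j u))" using D(3)[OF that] by simp
  qed
  then show ?thesis using D(1,2) u0 b by blast
qed


section \<open>Derivatives of polynomials along curves\<close>

lemma pmono_UNIV: "pmono x (m :: 'n::finite \<Rightarrow>\<^sub>0 nat) = (\<Prod>v\<in>UNIV. x v ^ Poly_Mapping.lookup m v)"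
  by (rule pmono_superset) auto

lemma peval_partial_deriv:
  "peval (partial_deriv i F) x = (\<Sum>m\<in>Poly_Mapping.keys F. Poly_Mapping.lookup F m *
     (of_nat (Poly_Mapping.lookup m i) * pmono x (m - Poly_Mapping.single i 1)))"
  unfolding partial_deriv_def peval_sum by (simp add: algebra_simps)

text \<open>Links the formal partial derivatives in \<open>tangent_space\<close> with derivatives
  along curves, so that tangency can be tested by differentiation.\<close>

lemma has_field_derivative_peval:
  fixes \<gamma> :: "complex \<Rightarrow> 'n::finite \<Rightarrow> complex"
  assumes \<gamma>: "\<And>i. ((\<lambda>t. \<gamma> t i) has_field_derivative \<gamma>' i) (at z)"
  shows "((\<lambda>t. peval F (\<gamma> t)) has_field_derivative
    (\<Sum>i\<in>UNIV. peval (partial_deriv i F) (\<gamma> z) * \<gamma>' i)) (at z)"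
proof -
  have mono: "((\<lambda>t. pmono (\<gamma> t) m) has_field_derivative
    (\<Sum>i\<in>UNIV. of_nat (Poly_Mapping.lookup m i) * pmono (\<gamma> z) (m - Poly_Mapping.single i 1) * \<gamma>' i)) (at z)" for m
  proof -
    have "((\<lambda>t. \<Prod>i\<in>UNIV. \<gamma> t i ^ Poly_Mapping.lookup m i) has_field_derivative
      (\<Sum>i\<in>UNIV. (of_nat (Poly_Mapping.lookup m i) * (\<gamma>' i * \<gamma> z i ^ (Poly_Mapping.lookup m i - Suc 0)))
         * (\<Prod>j\<in>UNIV - {i}. \<gamma> z j ^ Poly_Mapping.lookup m j))) (at z)"
      by (rule has_field_derivative_prod) (rule DERIV_power[OF \<gamma>])
    moreover have "(of_nat (Poly_Mapping.lookup m i) * (\<gamma>' i * \<gamma> z i ^ (Poly_Mapping.lookup m i - Suc 0)))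
         * (\<Prod>j\<in>UNIV - {i}. \<gamma> z j ^ Poly_Mapping.lookup m j)
       = of_nat (Poly_Mapping.lookup m i) * pmono (\<gamma> z) (m - Poly_Mapping.single i 1) * \<gamma>' i" for i
    proof -
      have "pmono (\<gamma> z) (m - Poly_Mapping.single i 1) = \<gamma> z i ^ (Poly_Mapping.lookup m i - Suc 0)
          * (\<Prod>j\<in>UNIV - {i}. \<gamma> z j ^ Poly_Mapping.lookup (m - Poly_Mapping.single i 1) j)"
        unfolding pmono_UNIV by (subst prod.remove[of _ i]) (auto simp: lookup_minus)
      also have "(\<Prod>j\<in>UNIV - {i}. \<gamma> z j ^ Poly_Mapping.lookup (m - Poly_Mapping.single i 1) j)
          = (\<Prod>j\<in>UNIV - {i}. \<gamma> z j ^ Poly_Mapping.lookup m j)"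
        by (rule prod.cong) (auto simp: lookup_minus lookup_single)
      finally show ?thesis by (simp add: mult_ac)
    qed
    ultimately show ?thesis unfolding pmono_UNIV[of "\<gamma> _"] by simp
  qed
  have "((\<lambda>t. \<Sum>m\<in>Poly_Mapping.keys F. Poly_Mapping.lookup F m * pmono (\<gamma> t) m) has_field_derivative
    (\<Sum>m\<in>Poly_Mapping.keys F. Poly_Mapping.lookup F m *
     (\<Sum>i\<in>UNIV. of_nat (Poly_Mapping.lookup m i) * pmono (\<gamma> z) (m - Poly_Mapping.single i 1) * \<gamma>' i))) (at z)"
    by (intro DERIV_sum DERIV_cmult mono)
  also have "(\<Sum>m\<in>Poly_Mapping.keys F. Poly_Mapping.lookup F m *
     (\<Sum>i\<in>UNIV. of_nat (Poly_Mapping.lookup m i) * pmono (\<gamma> z) (m - Poly_Mapping.single i 1) * \<gamma>' i))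
     = (\<Sum>i\<in>UNIV. peval (partial_deriv i F) (\<gamma> z) * \<gamma>' i)"
    unfolding peval_partial_deriv sum_distrib_right sum_distrib_left
    by (subst sum.swap) (simp add: mult_ac)
  finally show ?thesis
    by (simp add: peval_superset[of "Poly_Mapping.keys F" F])
qed

section \<open>The Veronese variety as the rank one symmetric matrices\<close>

lemma monom_degree_superset:
  assumes "finite A" "Poly_Mapping.keys m \<subseteq> A"
  shows "monom_degree m = (\<Sum>v\<in>A. Poly_Mapping.lookup m v)"
  unfolding monom_degree_def
  by (rule sum.mono_neutral_left) (use assms in \<open>auto simp: not_in_keys_iff_lookup_eq_zero\<close>)

lemma monom_degree_add: "monom_degree (m + m') = monom_degree m + monom_degree m'"
proof -
  let ?A = "Poly_Mapping.keys m \<union> Poly_Mapping.keys m'"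
  have "Poly_Mapping.keys (m + m') \<subseteq> ?A" by (rule Poly_Mapping.keys_add)
  then show ?thesis
    by (subst (1 2 3) monom_degree_superset[where A = ?A]) (auto simp: lookup_add sum.distrib)
qed

lemma monom_degree_single [simp]: "monom_degree (Poly_Mapping.single v k) = k"
  by (subst monom_degree_superset[where A = "{v}"]) auto

lemma monom_degree_0 [simp]: "monom_degree 0 = 0"
  by (simp add: monom_degree_def)

lemma monom_degree_eq_0_iff [simp]: "monom_degree m = 0 \<longleftrightarrow> m = 0"
proof
  assume "monom_degree m = 0"
  then have "\<forall>v\<in>Poly_Mapping.keys m. Poly_Mapping.lookup m v = 0" by (simp add: monom_degree_def)
  then show "m = 0" by (intro poly_mapping_eqI) (auto simp: in_keys_iff)
qed simp

lemma monom_remove_variable: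
  assumes "m \<noteq> (0 :: 'v \<Rightarrow>\<^sub>0 nat)"
  shows "\<exists>v\<in>Poly_Mapping.keys m. \<exists>m'. m = Poly_Mapping.single v 1 + m'
    \<and> Poly_Mapping.keys m' \<subseteq> Poly_Mapping.keys m \<and> monom_degree m = Suc (monom_degree m')"
proof -
  obtain v where v: "v \<in> Poly_Mapping.keys m"
    using assms monom_degree_eq_0_iff by (force simp: monom_degree_def)
  then have "Poly_Mapping.lookup m v > 0" by (simp add: in_keys_iff)
  then have eq: "m = Poly_Mapping.single v 1 + (m - Poly_Mapping.single v 1)"
    by (intro poly_mapping_eqI) (auto simp: lookup_add lookup_minus lookup_single when_def)
  moreover have "Poly_Mapping.keys (m - Poly_Mapping.single v 1) \<subseteq> Poly_Mapping.keys m"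
    by (auto simp: in_keys_iff lookup_minus)
  moreover have "monom_degree m = Suc (monom_degree (m - Poly_Mapping.single v 1))"
    by (subst eq, subst monom_degree_add) simp
  ultimately show ?thesis using v by blast
qed

section \<open>Coordinates indexed by pairs of variables\<close>

locale veronese =
  fixes d :: nat and a :: "'n::finite \<Rightarrow> nat \<Rightarrow>\<^sub>0 nat"
  assumes d: "d \<ge> 2" and bij_a: "bij_betw a UNIV (veronese_columns d)"
begin

text \<open>Homogenising with an additional variable \<open>\<theta>\<^sub>0\<close>, the columns become the monomials
  \<open>\<theta>\<^sub>j \<theta>\<^sub>k\<close> with \<open>j \<le> k < d\<close>.\<close>

definition unit_exp :: "nat \<Rightarrow> nat \<Rightarrow>\<^sub>0 nat" where
  "unit_exp j = (if j = 0 then 0 else Poly_Mapping.single j 1)"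

definition idx :: "nat \<Rightarrow> nat \<Rightarrow> 'n" where
  "idx j k = inv_into UNIV a (unit_exp j + unit_exp k)"

definition pairs :: "(nat \<times> nat) set" where
  "pairs = {(j, k). j \<le> k \<and> k < d}"

definition pair_of :: "'n \<Rightarrow> nat \<times> nat" where
  "pair_of = inv_into pairs (\<lambda>(j, k). idx j k)"

text \<open>The quadratic Veronese map from the affine space of \<open>x\<close> onto the
  cone.\<close>

definition nu :: "(nat \<Rightarrow> complex) \<Rightarrow> complex ^ 'n" where
  "nu x = (\<chi> i. x (fst (pair_of i)) * x (snd (pair_of i)))"

text \<open>The differential of \<open>nu\<close> at \<open>x\<close> in direction
  \<open>y\<close>.\<close>

definition dnu :: "(nat \<Rightarrow> complex) \<Rightarrow> (nat \<Rightarrow> complex) \<Rightarrow> complex ^ 'n" where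
  "dnu x y = (\<chi> i. x (fst (pair_of i)) * y (snd (pair_of i)) + y (fst (pair_of i)) * x (snd (pair_of i)))"

lemma idx_sym: "idx j k = idx k j"
  by (simp add: idx_def add.commute)

lemma a_idx:
  assumes "j < d" "k < d"
  shows "a (idx j k) = unit_exp j + unit_exp k"
proof -
  have "Poly_Mapping.keys (unit_exp j + unit_exp k) \<subseteq> {1..d - 1}"
    using Poly_Mapping.keys_add[of "unit_exp j" "unit_exp k"] assms
    by (auto simp: unit_exp_def split: if_splits)
  moreover have "monom_degree (unit_exp j + unit_exp k) \<le> 2"
    by (simp add: monom_degree_add unit_exp_def)
  ultimately have "unit_exp j + unit_exp k \<in> a ` UNIV"
    using bij_a by (auto simp: veronese_columns_def bij_betw_def)
  then show ?thesis unfolding idx_def by (rule f_inv_into_f)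
qed

lemma lookup_unit_exp: "l > 0 \<Longrightarrow> Poly_Mapping.lookup (unit_exp j) l = (if j = l then 1 else 0)"
  by (simp add: unit_exp_def lookup_single)

text \<open>The padding variable leaves no trace in a column, since \<open>unit_exp 0\<close> is
  zero. Injectivity is therefore read off from the positive exponents and the order of the pair;
  surjectivity splits off at most two variables.\<close>

lemma bij_idx: "bij_betw (\<lambda>(j, k). idx j k) pairs UNIV"
  unfolding bij_betw_def
proof
  show "inj_on (\<lambda>(j, k). idx j k) pairs"
  proof (rule inj_onI, clarify)
    fix j k j' k' assume jk: "(j, k) \<in> pairs" "(j', k') \<in> pairs" and eq: "idx j k = idx j' k'"
    have exps: "unit_exp j + unit_exp k = unit_exp j' + unit_exp k'"
      using jk arg_cong[OF eq, of a] by (simp add: a_idx pairs_def)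
    have *: "(if j = l then 1 else 0 :: nat) + (if k = l then 1 else 0)
        = (if j' = l then 1 else 0) + (if k' = l then 1 else 0)" if "l > 0" for l
      using arg_cong[of _ _ "\<lambda>m. Poly_Mapping.lookup m l", OF exps] that
      by (simp add: lookup_add lookup_unit_exp)
    have le: "j \<le> k" "j' \<le> k'" using jk by (auto simp: pairs_def)
    have 1: "j > 0 \<Longrightarrow> j = j' \<or> j = k'" using *[of j] by (auto split: if_splits)
    have 2: "k > 0 \<Longrightarrow> k = j' \<or> k = k'" using *[of k] by (auto split: if_splits)
    have 3: "j' > 0 \<Longrightarrow> j' = j \<or> j' = k" using *[of j'] by (auto split: if_splits)
    have 4: "k' > 0 \<Longrightarrow> k' = j \<or> k' = k" using *[of k'] by (auto split: if_splits)
    have k: "k = k'" using 1 2 3 4 le by linarith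
    then have "k' > 0 \<Longrightarrow> j = k' \<longleftrightarrow> j' = k'" using *[of k'] by (auto split: if_splits)
    then have "j = j'" using 1 3 k le by linarith
    then show "j = j' \<and> k = k'" using k by simp
  qed
  show "(\<lambda>(j, k). idx j k) ` pairs = UNIV"
  proof (intro equalityI subset_UNIV subsetI)
    fix i :: 'n
    have ai: "Poly_Mapping.keys (a i) \<subseteq> {1..d - 1}" "monom_degree (a i) \<le> 2"
      using bij_a by (auto simp: veronese_columns_def bij_betw_def)
    have "\<exists>j k. j < d \<and> k < d \<and> a i = unit_exp j + unit_exp k"
    proof (cases "a i = 0")
      case True
      then show ?thesis using d by (intro exI[of _ 0]) (auto simp: unit_exp_def)
    next
      case False
      then obtain j m where j: "j \<in> Poly_Mapping.keys (a i)" "a i = Poly_Mapping.single j 1 + m"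
        "Poly_Mapping.keys m \<subseteq> Poly_Mapping.keys (a i)" "monom_degree (a i) = Suc (monom_degree m)"
        using monom_remove_variable by meson
      have "j \<in> {1..d - 1}" using j(1) ai(1) by blast
      then have jd: "j < d" "j > 0" by auto
      show ?thesis
      proof (cases "m = 0")
        case True
        then show ?thesis using j jd d by (intro exI[of _ j] exI[of _ 0]) (auto simp: unit_exp_def)
      next
        case False
        then obtain k m' where k: "k \<in> Poly_Mapping.keys m" "m = Poly_Mapping.single k 1 + m'"
          "monom_degree m = Suc (monom_degree m')"
          using monom_remove_variable by meson
        have "k \<in> {1..d - 1}" using k(1) j(3) ai(1) by blast
        then have "k < d" "k > 0" by auto
        moreover have "m' = 0" using k(3) j(4) ai(2) by simp
        ultimately show ?thesis using j k jd
          by (intro exI[of _ j] exI[of _ k]) (auto simp: unit_exp_def)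
      qed
    qed
    then obtain j k where jk: "j < d" "k < d" "a i = unit_exp j + unit_exp k" by blast
    then have "a (idx j k) = a i" by (simp add: a_idx)
    then have i: "idx j k = i" using injD[OF bij_betw_imp_inj_on[OF bij_a]] by blast
    show "i \<in> (\<lambda>(j, k). idx j k) ` pairs"
    proof (cases "j \<le> k")
      case True
      then show ?thesis using jk i by (intro image_eqI[of _ _ "(j, k)"]) (auto simp: pairs_def)
    next
      case False
      then show ?thesis using jk i idx_sym[of j k]
        by (intro image_eqI[of _ _ "(k, j)"]) (auto simp: pairs_def)
    qed
  qed
qed

lemma pair_of_cases:
  obtains j k where "j \<le> k" "k < d" "pair_of i = (j, k)" "i = idx j k"
proof -
  have "i \<in> (\<lambda>(j, k). idx j k) ` pairs" using bij_idx by (simp add: bij_betw_def)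
  then have "pair_of i \<in> pairs" "(\<lambda>(j, k). idx j k) (pair_of i) = i"
    unfolding pair_of_def by (rule inv_into_into, rule f_inv_into_f)
  then show ?thesis using that by (cases "pair_of i") (auto simp: pairs_def)
qed

lemma pair_of_idx: "j \<le> k \<Longrightarrow> k < d \<Longrightarrow> pair_of (idx j k) = (j, k)"
  unfolding pair_of_def
  using bij_betw_inv_into_left[OF bij_idx, of "(j, k)"] by (simp add: pairs_def)

lemma nu_idx:
  assumes "j < d" "k < d"
  shows "vec_nth (nu x) (idx j k) = x j * x k"
  using assms pair_of_idx[of j k] pair_of_idx[of k j] idx_sym[of j k]
  by (cases "j \<le> k") (auto simp: nu_def)

lemma dnu_idx:
  assumes "j < d" "k < d"
  shows "vec_nth (dnu x y) (idx j k) = x j * y k + y j * x k"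
  using assms pair_of_idx[of j k] pair_of_idx[of k j] idx_sym[of j k]
  by (cases "j \<le> k") (auto simp: dnu_def)

lemma vec_eq_idxI:
  assumes "\<And>j k. j < d \<Longrightarrow> k < d \<Longrightarrow> vec_nth v (idx j k) = vec_nth w (idx j k)"
  shows "v = w"
proof (unfold Finite_Cartesian_Product.vec_eq_iff, intro allI)
  fix i show "vec_nth v i = vec_nth w i"
    by (rule pair_of_cases[of i]) (use assms in auto)
qed

lemma sum_idx: "(\<Sum>i\<in>UNIV. g i) = (\<Sum>(j, k)\<in>pairs. g (idx j k))"
  using sum.reindex_bij_betw[OF bij_idx, of g] by (simp add: case_prod_unfold)

lemma nu_eq_0_iff: "nu x = 0 \<longleftrightarrow> (\<forall>j<d. x j = 0)"
proof
  assume "nu x = 0"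
  then have "x j * x j = 0" if "j < d" for j
    using nu_idx[OF that that, of x] by simp
  then show "\<forall>j<d. x j = 0" by simp
next
  assume "\<forall>j<d. x j = 0"
  then show "nu x = 0" by (intro vec_eq_idxI) (simp add: nu_idx)
qed

lemma nu_scale: "nu (\<lambda>j. c * x j) = c\<^sup>2 *s nu x"
  by (rule vec_eq_idxI) (simp add: nu_idx power2_eq_square)

lemma nu_deriv:
  "((\<lambda>t. vec_nth (nu (\<lambda>j. x j + t * y j)) i) has_field_derivative vec_nth (dnu x y) i) (at 0)"
  unfolding nu_def dnu_def vec_lambda_beta by (auto intro!: derivative_eq_intros)

section \<open>Torus parametrisation and Zariski closure\<close>

lemma prod_exponents_idx:
  assumes "j < d" "k < d"
  shows "(\<Prod>l\<in>{1..d-1}. \<theta> l ^ Poly_Mapping.lookup (a (idx j k)) l) = (\<theta>(0 := 1)) j * (\<theta>(0 := 1)) k"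
proof -
  have one: "(\<Prod>l\<in>{1..d-1}. \<theta> l ^ Poly_Mapping.lookup (unit_exp j) l) = (\<theta>(0 := 1)) j" if "j < d" for j
  proof (cases "j = 0")
    case False
    then have "(\<Prod>l\<in>{1..d-1}. \<theta> l ^ Poly_Mapping.lookup (unit_exp j) l) = (\<Prod>l\<in>{1..d-1}. if l = j then \<theta> l else 1)"
      by (intro prod.cong) (auto simp: lookup_unit_exp)
    moreover have "j \<le> d - 1" using that by simp
    ultimately show ?thesis using False by simp
  qed (simp add: unit_exp_def)
  show ?thesis
    using assms one[of j] one[of k]
    by (simp add: a_idx lookup_add power_add prod.distrib del: fun_upd_apply)
qed

lemma toric_map_idx:
  assumes "j < d" "k < d"
  shows "vec_nth (toric_map a d (\<chi> i. 1) s \<theta>) (idx j k) = s * ((\<theta>(0 := 1)) j * (\<theta>(0 := 1)) k)"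
  using prod_exponents_idx[OF assms, of \<theta>] by (simp add: toric_map_def del: fun_upd_apply)

text \<open>The change of parameters is \<open>s = x_0^2\<close> and
  \<open>\<theta>_j = x_j / x_0\<close>; the way back takes a square root of
  \<open>s\<close>.\<close>

lemma torus_image_eq:
  "{toric_map a d (\<chi> i. 1) s \<theta> | s \<theta>. s \<noteq> 0 \<and> (\<forall>j\<in>{1..d-1}. \<theta> j \<noteq> 0)}
    = {nu x | x. \<forall>j<d. x j \<noteq> 0}" (is "?L = ?R")
proof
  show "?L \<subseteq> ?R"
  proof clarify
    fix s :: complex and \<theta> :: "nat \<Rightarrow> complex"
    assume s: "s \<noteq> 0" and \<theta>: "\<forall>j\<in>{1..d-1}. \<theta> j \<noteq> 0"
    define x where "x j = csqrt s * (\<theta>(0 := 1)) j" for j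
    have "toric_map a d (\<chi> i. 1) s \<theta> = nu x"
    proof (rule vec_eq_idxI)
      fix j k assume jk: "j < d" "k < d"
      have "x j * x k = (csqrt s)\<^sup>2 * ((\<theta>(0 := 1)) j * (\<theta>(0 := 1)) k)"
        by (simp add: x_def power2_eq_square)
      then show "vec_nth (toric_map a d (\<chi> i. 1) s \<theta>) (idx j k) = vec_nth (nu x) (idx j k)"
        using jk by (simp add: toric_map_idx nu_idx del: fun_upd_apply)
    qed
    moreover have "\<forall>j<d. x j \<noteq> 0" using s \<theta> by (auto simp: x_def)
    ultimately show "\<exists>x. toric_map a d (\<chi> i. 1) s \<theta> = nu x \<and> (\<forall>j<d. x j \<noteq> 0)" by blast
  qed
  show "?R \<subseteq> ?L"
  proof clarify
    fix x :: "nat \<Rightarrow> complex" assume x: "\<forall>j<d. x j \<noteq> 0"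
    have x0: "x 0 \<noteq> 0" using x d by auto
    have "nu x = toric_map a d (\<chi> i. 1) ((x 0)\<^sup>2) (\<lambda>j. x j / x 0)"
    proof (rule vec_eq_idxI)
      fix j k assume jk: "j < d" "k < d"
      have "((\<lambda>j. x j / x 0)(0 := 1)) l = x l / x 0" for l using x0 by simp
      then show "vec_nth (nu x) (idx j k) = vec_nth (toric_map a d (\<chi> i. 1) ((x 0)\<^sup>2) (\<lambda>j. x j / x 0)) (idx j k)"
        using jk x0 by (simp add: toric_map_idx nu_idx power2_eq_square del: fun_upd_apply)
    qed
    moreover have "(x 0)\<^sup>2 \<noteq> 0" "\<forall>j\<in>{1..d-1}. x j / x 0 \<noteq> 0" using x x0 d by auto
    ultimately show "\<exists>s \<theta>. nu x = toric_map a d (\<chi> i. 1) s \<theta> \<and> s \<noteq> 0 \<and> (\<forall>j\<in>{1..d-1}. \<theta> j \<noteq> 0)"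
      by (intro exI[of _ "(x 0)\<^sup>2"] exI[of _ "\<lambda>j. x j / x 0"]) blast
  qed
qed

text \<open>The 2 by 2 minor with rows \<open>j\<close>, \<open>m\<close> and columns
  \<open>k\<close>, \<open>l\<close> of the symmetric matrix whose entries are the
  coordinates.\<close>

definition minor :: "nat \<Rightarrow> nat \<Rightarrow> nat \<Rightarrow> nat \<Rightarrow> 'n cpoly" where
  "minor j k l m = pvar (idx j k) * pvar (idx l m) - pvar (idx j l) * pvar (idx k m)"

lemma peval_minor:
  "peval (minor j k l m) x = x (idx j k) * x (idx l m) - x (idx j l) * x (idx k m)"
  by (simp add: minor_def peval_diff peval_mult)

text \<open>The minors vanish on the torus image, and a symmetric complex matrix of rank at most one
  is a square of a vector. Conversely, points with zero coordinates are limits of torus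
  points.\<close>

lemma zariski_closure_torus_image:
  "zariski_closure {toric_map a d (\<chi> i. 1) s \<theta> | s \<theta>. s \<noteq> 0 \<and> (\<forall>j\<in>{1..d-1}. \<theta> j \<noteq> 0)} = range nu"
  unfolding torus_image_eq
proof (intro equalityI subsetI)
  fix p assume p: "p \<in> zariski_closure {nu x | x. \<forall>j<d. x j \<noteq> 0}"
  let ?p = "\<lambda>j k. vec_nth p (idx j k)"
  have rank1: "?p j k * ?p l m = ?p j l * ?p k m" if "j < d" "k < d" "l < d" "m < d" for j k l m
  proof -
    have "peval (minor j k l m) (vec_nth p) = 0"
    proof -
      have "\<forall>q\<in>{nu x | x. \<forall>j<d. x j \<noteq> 0}. peval (minor j k l m) (vec_nth q) = 0"
        using that by (auto simp: peval_minor nu_idx)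
      then show ?thesis using p unfolding zariski_closure_def by blast
    qed
    then show ?thesis by (simp add: peval_minor)
  qed
  show "p \<in> range nu"
  proof (cases "\<exists>l<d. ?p l l \<noteq> 0")
    case True
    then obtain l where l: "l < d" "?p l l \<noteq> 0" by blast
    \<comment> \<open>The vector is column \<open>l\<close> of the matrix, divided by a root of its
      diagonal entry.\<close>
    define c where "c = csqrt (?p l l)"
    have c: "c * c = ?p l l" "c \<noteq> 0"
      using power2_csqrt[of "?p l l"] l by (simp_all add: c_def power2_eq_square)
    have "p = nu (\<lambda>j. ?p j l / c)"
    proof (rule vec_eq_idxI)
      fix j k assume jk: "j < d" "k < d"
      have "?p j k * ?p l l = ?p j l * ?p k l" by (rule rank1) (use jk l in auto)
      then show "?p j k = vec_nth (nu (\<lambda>j. ?p j l / c)) (idx j k)"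
        using jk c l by (simp add: nu_idx field_simps)
    qed
    then show ?thesis by blast
  next
    case False
    have "p = nu (\<lambda>_. 0)"
    proof (rule vec_eq_idxI)
      fix j k assume jk: "j < d" "k < d"
      \<comment> \<open>With a zero diagonal this minor makes each entry square to zero.\<close>
      have "?p j k * ?p j k = ?p j j * ?p k k" by (rule rank1) (use jk in auto)
      then show "?p j k = vec_nth (nu (\<lambda>_. 0)) (idx j k)" using False jk by (simp add: nu_idx)
    qed
    then show ?thesis by blast
  qed
next
  fix p assume "p \<in> range nu"
  then obtain x where x: "p = nu x" by blast
  show "p \<in> zariski_closure {nu x | x. \<forall>j<d. x j \<noteq> 0}"
    unfolding zariski_closure_def
  proof (clarsimp simp: x)
    fix F assume F: "\<forall>q. (\<exists>x. q = nu x \<and> (\<forall>j<d. x j \<noteq> 0)) \<longrightarrow> peval F (vec_nth q) = 0"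
    \<comment> \<open>A common small nonzero shift moves every coordinate of \<open>x\<close> away
      from zero.\<close>
    let ?f = "\<lambda>t. peval F (vec_nth (nu (\<lambda>j. x j + t * 1)))"
    have "isCont ?f 0"
      by (rule DERIV_isCont, rule has_field_derivative_peval, rule nu_deriv)
    then have "(?f \<longlongrightarrow> peval F (vec_nth (nu x))) (at 0)" by (simp add: isCont_def)
    moreover have "eventually (\<lambda>t. ?f t = 0) (at 0)"
    proof -
      have "eventually (\<lambda>t. \<forall>j\<in>{..<d}. t \<noteq> - x j) (at 0)"
        by (intro eventually_ball_finite ballI eventually_neq_at_within) simp
      then show ?thesis
      proof eventually_elim
        case (elim t)
        have "\<forall>j<d. x j + t * 1 \<noteq> 0"
          using elim by (auto simp: add_eq_0_iff)
        then show ?case by (intro F[rule_format] exI[of _ "\<lambda>j. x j + t * 1"]) simp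
      qed
    qed
    then have "(?f \<longlongrightarrow> 0) (at 0)" by (rule tendsto_eventually)
    ultimately show "peval F (vec_nth (nu x)) = 0" by (intro tendsto_unique[of "at 0" ?f]) auto
  qed
qed

section \<open>Points, ideal and tangent spaces of the cone\<close>

abbreviation V :: "'n ppoint set" where
  "V \<equiv> toric_variety a d (\<chi> i. 1)"

lemma V_eq: "V = {proj_point (nu x) | x. \<exists>j<d. x j \<noteq> 0}"
  unfolding toric_variety_def zariski_closure_torus_image using nu_eq_0_iff by auto

lemma in_proj_point_nu:
  assumes "p \<in> proj_point (nu x)"
  shows "\<exists>c. c \<noteq> 0 \<and> p = nu (\<lambda>j. c * x j)"
proof -
  obtain k where k: "k \<noteq> 0" "p = k *s nu x" using assms by (auto simp: proj_point_def)
  then have "p = nu (\<lambda>j. csqrt k * x j)" by (simp add: nu_scale)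
  moreover have "csqrt k \<noteq> 0" using k by simp
  ultimately show ?thesis by blast
qed

lemma self_in_proj_point: "p \<in> proj_point p"
  unfolding proj_point_def by (intro CollectI exI[of _ 1]) simp

text \<open>A multiple of \<open>nu x\<close> is again of the form \<open>nu\<close>, by a square
  root of the factor, so representatives of projective points can be traded for nonzero
  \<open>x\<close>.\<close>

lemma ball_V_iff:
  "(\<forall>P\<in>V. \<forall>p\<in>P. Q p) \<longleftrightarrow> (\<forall>x. (\<exists>j<d. x j \<noteq> 0) \<longrightarrow> Q (nu x))"
proof (intro iffI allI impI ballI)
  fix x assume *: "\<forall>P\<in>V. \<forall>p\<in>P. Q p" and "\<exists>j<d. x j \<noteq> (0 :: complex)"
  then have "proj_point (nu x) \<in> V" by (auto simp: V_eq)
  then show "Q (nu x)" using * self_in_proj_point by blast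
next
  fix P p assume *: "\<forall>x. (\<exists>j<d. x j \<noteq> 0) \<longrightarrow> Q (nu x)" and P: "P \<in> V" "p \<in> P"
  obtain x where x: "P = proj_point (nu x)" "\<exists>j<d. x j \<noteq> 0" using P by (auto simp: V_eq)
  then obtain c where "c \<noteq> 0" "p = nu (\<lambda>j. c * x j)" using in_proj_point_nu P by blast
  then show "Q p" using * x by auto
qed

lemma vanishing_ideal_V:
  "F \<in> vanishing_ideal V \<longleftrightarrow> (\<forall>x. (\<exists>j<d. x j \<noteq> 0) \<longrightarrow> peval F (vec_nth (nu x)) = 0)"
  unfolding vanishing_ideal_def mem_Collect_eq by (rule ball_V_iff)

text \<open>The linearised minors already force \<open>v\<close> to be a value of
  \<open>dnu x\<close>; conversely, differentiating an equation of the variety along the image of a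
  line gives tangency.\<close>

lemma tangent_space_nu:
  assumes x: "\<exists>j<d. x j \<noteq> 0"
  shows "tangent_space V (nu x) = range (dnu x)"
proof (intro equalityI subsetI)
  fix v assume v: "v \<in> tangent_space V (nu x)"
  let ?p = "\<lambda>j k. vec_nth (nu x) (idx j k)" and ?v = "\<lambda>j k. vec_nth v (idx j k)"
  obtain l where l: "l < d" "x l \<noteq> 0" using x by blast
  have lin: "?v j k * ?p l m + ?p j k * ?v l m = ?v j l * ?p k m + ?p j l * ?v k m"
    if jk: "j < d" "k < d" "l < d" "m < d" for j k l m
  proof -
    have "minor j k l m \<in> vanishing_ideal V"
      using jk by (simp add: vanishing_ideal_V peval_minor nu_idx)
    then have "(\<Sum>i\<in>UNIV. peval (partial_deriv i (minor j k l m)) (vec_nth (nu x)) * vec_nth v i) = 0"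
      using v by (simp add: tangent_space_def)
    moreover have "((\<lambda>t. vec_nth (nu x) i + t * vec_nth v i) has_field_derivative vec_nth v i) (at 0)" for i
      by (auto intro!: derivative_eq_intros)
    ultimately have "((\<lambda>t. peval (minor j k l m) (\<lambda>i. vec_nth (nu x) i + t * vec_nth v i))
        has_field_derivative 0) (at 0)"
      using has_field_derivative_peval[of "\<lambda>t i. vec_nth (nu x) i + t * vec_nth v i" "vec_nth v" 0 "minor j k l m"]
      by simp
    moreover have "((\<lambda>t. peval (minor j k l m) (\<lambda>i. vec_nth (nu x) i + t * vec_nth v i))
        has_field_derivative (?v j k * ?p l m + ?p j k * ?v l m - (?v j l * ?p k m + ?p j l * ?v k m))) (at 0)"
      unfolding peval_minor by (auto intro!: derivative_eq_intros)
    ultimately have "0 = ?v j k * ?p l m + ?p j k * ?v l m - (?v j l * ?p k m + ?p j l * ?v k m)"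
      by (rule DERIV_unique)
    then show ?thesis by simp
  qed
  \<comment> \<open>With \<open>x l\<close> nonzero, the entry at \<open>(l, l)\<close> forces
    \<open>y_l\<close> and the entries at \<open>(j, l)\<close> then force all
    \<open>y_j\<close>.\<close>
  define yl where "yl = ?v l l / (2 * x l)"
  define y where "y j = (?v j l - x j * yl) / x l" for j
  have "v = dnu x y"
  proof (rule vec_eq_idxI)
    fix j k assume jk: "j < d" "k < d"
    have eq: "?v j k * (x l * x l) + x j * x k * ?v l l = ?v j l * (x k * x l) + x j * x l * ?v k l"
      using lin[OF jk l(1) l(1)] jk l(1) by (simp add: nu_idx)
    have y: "x l * y j = ?v j l - x j * yl" "x l * y k = ?v k l - x k * yl" "2 * x l * yl = ?v l l"
      using l(2) by (simp_all add: y_def yl_def)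
    have "x l * x l * (x j * y k + y j * x k) = x l * (x j * (x l * y k) + x k * (x l * y j))"
      by (simp add: algebra_simps)
    also have "\<dots> = x l * x j * ?v k l + x l * x k * ?v j l - x j * x k * (2 * x l * yl)"
      unfolding y(1,2) by (simp add: algebra_simps)
    also have "\<dots> = x l * x l * ?v j k"
      unfolding y(3) using eq by (simp add: algebra_simps)
    finally have "x j * y k + y j * x k = ?v j k" using l(2) by simp
    then show "?v j k = vec_nth (dnu x y) (idx j k)"
      using jk by (simp add: dnu_idx)
  qed
  then show "v \<in> range (dnu x)" by blast
next
  fix v assume "v \<in> range (dnu x)"
  then obtain y where y: "v = dnu x y" by blast
  obtain l where l: "l < d" "x l \<noteq> 0" using x by blast
  show "v \<in> tangent_space V (nu x)"
    unfolding tangent_space_def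
  proof (intro CollectI ballI)
    fix F assume F: "F \<in> vanishing_ideal V"
    let ?f = "\<lambda>t. peval F (vec_nth (nu (\<lambda>j. x j + t * y j)))"
    have deriv: "(?f has_field_derivative
        (\<Sum>i\<in>UNIV. peval (partial_deriv i F) (vec_nth (nu x)) * vec_nth v i)) (at 0)"
      using has_field_derivative_peval[of "\<lambda>t. vec_nth (nu (\<lambda>j. x j + t * y j))" "vec_nth (dnu x y)" 0 F]
        nu_deriv by (simp add: y)
    \<comment> \<open>Near 0 the vector stays nonzero, so the curve stays on the variety, where
      \<open>F\<close> is known to vanish.\<close>
    have "((\<lambda>t. x l + t * y l) \<longlongrightarrow> x l + 0 * y l) (nhds 0)"
      by (intro tendsto_intros filterlim_ident)
    then have "eventually (\<lambda>t. x l + t * y l \<noteq> 0) (nhds 0)"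
      using l by (intro tendsto_imp_eventually_ne) auto
    then have "eventually (\<lambda>t. ?f t = 0) (nhds 0)"
    proof eventually_elim
      case (elim t)
      then show ?case using F[unfolded vanishing_ideal_V, rule_format, of "\<lambda>j. x j + t * y j"] l by auto
    qed
    moreover have "((\<lambda>_. 0 :: complex) has_field_derivative 0) (at 0)" by simp
    ultimately have "(?f has_field_derivative 0) (at 0)"
      by (subst DERIV_cong_ev[OF refl _ refl]) auto
    then show "(\<Sum>i\<in>UNIV. peval (partial_deriv i F) (vec_nth (nu x)) * vec_nth v i) = 0"
      using deriv DERIV_unique by blast
  qed
qed

end


section \<open>The Hilbert polynomial\<close>

text \<open>The vectors \<open>w j\<close> represent a basis of the quotient of \<open>U\<close> by
  \<open>K\<close>. With \<open>K\<close> the forms vanishing on the variety, the difference of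
  dimensions in \<open>hilbert_function\<close> becomes \<open>card J\<close>.\<close>

lemma (in vector_space) dim_eq_add_card_complement:
  assumes K: "subspace K" "K \<subseteq> U" and U: "subspace U" "U \<subseteq> span T" "finite T"
    and J: "finite J" "\<And>j. j \<in> J \<Longrightarrow> w j \<in> U"
    and indep: "\<And>c. (\<Sum>j\<in>J. scale (c j) (w j)) \<in> K \<Longrightarrow> \<forall>j\<in>J. c j = 0"
    and gen: "\<And>v. v \<in> U \<Longrightarrow> \<exists>c. v - (\<Sum>j\<in>J. scale (c j) (w j)) \<in> K"
  shows "dim U = dim K + card J"
proof -
  obtain B where B: "B \<subseteq> K" "independent B" "K \<subseteq> span B" "card B = dim K"
    using basis_exists by blast
  have finB: "finite B"
    using independent_span_bound[OF U(3) B(2)] B(1) K(2) U(2) by blast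
  have zero: "\<forall>j\<in>J. c j = 0" if "(\<Sum>j\<in>J. scale (c j) (w j)) = 0" for c
    using indep[of c] that subspace_0[OF K(1)] by simp
  note inj = independent_family(1)[OF J(1) zero]
  have disj: "B \<inter> w ` J = {}"
  proof (rule ccontr)
    assume "B \<inter> w ` J \<noteq> {}"
    then obtain j where j: "j \<in> J" "w j \<in> K" using B(1) by auto
    have "(\<Sum>i\<in>J. scale (if i = j then 1 else 0) (w i)) = (\<Sum>i\<in>J. if i = j then w i else 0)"
      by (rule sum.cong) auto
    also have "\<dots> = w j" using J(1) j by simp
    finally show False using indep[of "\<lambda>i. if i = j then 1 else 0"] j by auto
  qed
  have "dim U = card (B \<union> w ` J)"
  proof (rule dim_unique[OF _ _ _ refl])
    show "B \<union> w ` J \<subseteq> U" using B(1) K(2) J(2) by auto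
    show "U \<subseteq> span (B \<union> w ` J)"
    proof
      fix v assume "v \<in> U"
      then obtain c where c: "v - (\<Sum>j\<in>J. scale (c j) (w j)) \<in> K" using gen by blast
      have "(\<Sum>j\<in>J. scale (c j) (w j)) \<in> span (B \<union> w ` J)"
        by (intro span_sum span_scale span_base) auto
      moreover have "v - (\<Sum>j\<in>J. scale (c j) (w j)) \<in> span (B \<union> w ` J)"
        using c B(3) span_mono[of B "B \<union> w ` J"] by blast
      ultimately have "(v - (\<Sum>j\<in>J. scale (c j) (w j))) + (\<Sum>j\<in>J. scale (c j) (w j)) \<in> span (B \<union> w ` J)"
        by (intro span_add)
      then show "v \<in> span (B \<union> w ` J)" by simp
    qed
    show "independent (B \<union> w ` J)"
    proof (rule independent_if_scalars_zero)
      show "finite (B \<union> w ` J)" using finB J(1) by simp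
      fix f x assume sum0: "(\<Sum>x\<in>B \<union> w ` J. scale (f x) x) = 0" and x: "x \<in> B \<union> w ` J"
      have split: "(\<Sum>x\<in>B. scale (f x) x) + (\<Sum>x\<in>w ` J. scale (f x) x) = 0"
        using sum0 finB J(1) disj by (simp add: sum.union_disjoint)
      have "(\<Sum>j\<in>J. scale (f (w j)) (w j)) = (\<Sum>x\<in>w ` J. scale (f x) x)"
        using inj by (simp add: sum.reindex)
      also have "\<dots> = - (\<Sum>x\<in>B. scale (f x) x)"
        using split by (simp add: eq_neg_iff_add_eq_0 add.commute)
      also have "\<dots> \<in> K"
        using B(1) by (intro subspace_neg subspace_sum subspace_scale K(1)) auto
      finally have fw: "\<forall>j\<in>J. f (w j) = 0" by (rule indep)
      then have "(\<Sum>x\<in>w ` J. scale (f x) x) = 0" by (intro sum.neutral) auto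
      then have "(\<Sum>x\<in>B. scale (f x) x) = 0" using split by simp
      then have "\<forall>x\<in>B. f x = 0" using B(2) finB independentD by blast
      then show "f x = 0" using fw x by auto
    qed
  qed
  also have "\<dots> = dim K + card J"
    using finB J(1) disj inj B(4) by (simp add: card_Un_disjoint card_image)
  finally show ?thesis .
qed

lemma finite_monoms: "finite {M :: 'n::finite \<Rightarrow>\<^sub>0 nat. monom_degree M = t}"
proof (rule finite_imageD)
  have "Poly_Mapping.lookup ` {M :: 'n \<Rightarrow>\<^sub>0 nat. monom_degree M = t} \<subseteq> PiE UNIV (\<lambda>_. {..t})"
  proof (clarsimp simp: PiE_def)
    fix M :: "'n \<Rightarrow>\<^sub>0 nat" and i
    show "Poly_Mapping.lookup M i \<le> monom_degree M"
      using member_le_sum[of i UNIV "Poly_Mapping.lookup M"]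
      by (simp add: monom_degree_superset[of UNIV])
  qed
  then show "finite (Poly_Mapping.lookup ` {M :: 'n \<Rightarrow>\<^sub>0 nat. monom_degree M = t})"
    by (rule finite_subset) (intro finite_PiE, auto)
  show "inj_on Poly_Mapping.lookup {M :: 'n \<Rightarrow>\<^sub>0 nat. monom_degree M = t}"
    by (intro inj_onI poly_mapping_eqI) simp
qed

lemma peval_pscale [simp]: "peval (pscale c F) x = c * peval F x"
  by (simp add: pscale_def peval_mult)

lemma pscale_single: "pscale c (Poly_Mapping.single m b) = Poly_Mapping.single m (c * b)"
  by (simp add: pscale_def mult_single)

lemma lookup_pscale: "Poly_Mapping.lookup (pscale c F) m = c * Poly_Mapping.lookup F m"
proof -
  have "pscale c F = (\<Sum>m\<in>Poly_Mapping.keys F. Poly_Mapping.single m (c * Poly_Mapping.lookup F m))"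
    by (subst poly_mapping_sum_monomials) (simp add: cpoly.scale_sum_right pscale_single)
  then show ?thesis
    by (simp add: lookup_sum lookup_single when_def not_in_keys_iff_lookup_eq_zero)
qed

lemma subspace_homogeneous_forms: "cpoly.subspace (homogeneous_forms t)"
proof (rule cpoly.subspaceI)
  show "F + G \<in> homogeneous_forms t" if "F \<in> homogeneous_forms t" "G \<in> homogeneous_forms t"
    for F G :: "'v cpoly"
    using that Poly_Mapping.keys_add[of F G] by (auto simp: homogeneous_forms_def)
  show "pscale c F \<in> homogeneous_forms t" if "F \<in> homogeneous_forms t" for c and F :: "'v cpoly"
    using that by (auto simp: homogeneous_forms_def in_keys_iff lookup_pscale)
qed (simp add: homogeneous_forms_def)

lemma subspace_vanishing_ideal: "cpoly.subspace (vanishing_ideal X)"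
  by (rule cpoly.subspaceI) (auto simp: vanishing_ideal_def peval_add)

lemma homogeneous_forms_span:
  "homogeneous_forms t \<subseteq> cpoly.span ((\<lambda>m. Poly_Mapping.single m 1) ` {m. monom_degree m = t})"
proof
  fix F :: "'v cpoly" assume F: "F \<in> homogeneous_forms t"
  have "(\<Sum>m\<in>Poly_Mapping.keys F. pscale (Poly_Mapping.lookup F m) (Poly_Mapping.single m 1))
      \<in> cpoly.span ((\<lambda>m. Poly_Mapping.single m 1) ` {m. monom_degree m = t})"
    using F by (intro cpoly.span_sum cpoly.span_scale cpoly.span_base) (auto simp: homogeneous_forms_def)
  then show "F \<in> cpoly.span ((\<lambda>m. Poly_Mapping.single m 1) ` {m. monom_degree m = t})"
    using poly_mapping_sum_monomials[of F] by (simp add: pscale_single)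
qed

text \<open>Stars and bars, applied to the list of exponents.\<close>

lemma card_monoms:
  "card {m :: nat \<Rightarrow>\<^sub>0 nat. Poly_Mapping.keys m \<subseteq> {..<d} \<and> monom_degree m = N} = (N + d - 1) choose N"
proof -
  let ?A = "{m :: nat \<Rightarrow>\<^sub>0 nat. Poly_Mapping.keys m \<subseteq> {..<d} \<and> monom_degree m = N}"
  let ?B = "{l :: nat list. length l = d \<and> sum_list l = N}"
  let ?f = "\<lambda>m :: nat \<Rightarrow>\<^sub>0 nat. map (Poly_Mapping.lookup m) [0..<d]"
  have sum: "sum_list (map (Poly_Mapping.lookup m) [0..<d]) = (\<Sum>j<d. Poly_Mapping.lookup m j)" for m :: "nat \<Rightarrow>\<^sub>0 nat"
    by (simp add: interv_sum_list_conv_sum_set_nat atLeast0LessThan)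
  have "bij_betw ?f ?A ?B"
    unfolding bij_betw_def
  proof
    show "inj_on ?f ?A"
    proof (rule inj_onI, rule poly_mapping_eqI)
      fix m m' j assume m: "m \<in> ?A" "m' \<in> ?A" "?f m = ?f m'"
      show "Poly_Mapping.lookup m j = Poly_Mapping.lookup m' j"
      proof (cases "j < d")
        case True
        then show ?thesis using m(3) by (simp add: list_eq_iff_nth_eq)
      next
        case False
        then have "j \<notin> Poly_Mapping.keys m" "j \<notin> Poly_Mapping.keys m'" using m by auto
        then show ?thesis by (simp add: in_keys_iff)
      qed
    qed
    show "?f ` ?A = ?B"
    proof (intro equalityI subsetI)
      fix l assume "l \<in> ?f ` ?A"
      then show "l \<in> ?B" using monom_degree_superset[of "{..<d}"] by (auto simp: sum)
    next
      fix l assume l: "l \<in> ?B"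
      define m where "m = (\<Sum>j<d. Poly_Mapping.single j (l ! j))"
      have lookup: "Poly_Mapping.lookup m j = (if j < d then l ! j else 0)" for j
        by (simp add: m_def lookup_sum lookup_single when_def)
      have keys: "Poly_Mapping.keys m \<subseteq> {..<d}" by (auto simp: in_keys_iff lookup split: if_splits)
      have f: "?f m = l" using l by (simp add: list_eq_iff_nth_eq lookup)
      then have "monom_degree m = N"
        using l sum[of m] monom_degree_superset[of "{..<d}" m] keys by simp
      then show "l \<in> ?f ` ?A" using f keys by (intro image_eqI[of _ _ m]) auto
    qed
  qed
  then have "card ?A = card ?B" by (rule bij_betw_same_card)
  then show ?thesis by (simp add: card_length_sum_list)
qed

text \<open>Shows the binomial coefficient as a polynomial in \<open>n\<close>, from which the
  Hilbert polynomial is read off.\<close>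

lemma binomial_prod: "(of_nat ((n + k) choose k) :: rat) * fact k = (\<Prod>i\<in>{1..k}. of_nat n + of_nat i)"
proof (induction k)
  case (Suc k)
  have "Suc k * ((n + Suc k) choose Suc k) = (n + Suc k) * ((n + k) choose k)"
    using Suc_times_binomial[of k "n + k"] by simp
  then have "(of_nat (Suc k) :: rat) * of_nat ((n + Suc k) choose Suc k) = of_nat (n + Suc k) * of_nat ((n + k) choose k)"
    unfolding of_nat_mult[symmetric] by (simp only:)
  then have "(of_nat ((n + Suc k) choose Suc k) :: rat) * fact (Suc k)
      = of_nat (n + Suc k) * (of_nat ((n + k) choose k) * fact k)"
    unfolding fact_Suc by (simp only: mult_ac)
  also have "\<dots> = (\<Prod>i\<in>{1..Suc k}. of_nat n + of_nat i)"
    unfolding Suc.IH by (simp add: mult_ac)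
  finally show ?case .
qed simp

section \<open>Restriction of forms to the cone\<close>

context veronese
begin

text \<open>The exponent in \<open>x\<close> that results from substituting \<open>nu x\<close> into
  the monomial \<open>M\<close>.\<close>

definition wt :: "('n \<Rightarrow>\<^sub>0 nat) \<Rightarrow> nat \<Rightarrow>\<^sub>0 nat" where
  "wt M = (\<Sum>i\<in>UNIV. Poly_Mapping.single (fst (pair_of i)) (Poly_Mapping.lookup M i)
      + Poly_Mapping.single (snd (pair_of i)) (Poly_Mapping.lookup M i))"

lemma wt_add: "wt (M + M') = wt M + wt M'"
  unfolding wt_def sum.distrib[symmetric]
  by (rule sum.cong) (simp_all add: lookup_add single_add ac_simps)

lemma wt_0 [simp]: "wt 0 = 0"
  by (simp add: wt_def)

lemma wt_single_idx:
  assumes "j < d" "k < d"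
  shows "wt (Poly_Mapping.single (idx j k) 1) = Poly_Mapping.single j 1 + Poly_Mapping.single k 1"
proof -
  have "wt (Poly_Mapping.single i 1) = Poly_Mapping.single (fst (pair_of i)) 1 + Poly_Mapping.single (snd (pair_of i)) 1" for i
  proof -
    have "wt (Poly_Mapping.single i 1) = (\<Sum>i'\<in>UNIV. if i' = i then
        Poly_Mapping.single (fst (pair_of i)) 1 + Poly_Mapping.single (snd (pair_of i)) 1 else 0)"
      unfolding wt_def by (rule sum.cong) (auto simp: lookup_single)
    then show ?thesis by simp
  qed
  then show ?thesis
    using pair_of_idx[of j k] pair_of_idx[of k j] idx_sym[of j k] assms
    by (cases "j \<le> k") (simp_all add: add.commute)
qed

lemma pmono_nu: "pmono (vec_nth (nu x)) M = pmono x (wt M)"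
proof -
  have sum: "pmono x (\<Sum>i\<in>I. f i) = (\<Prod>i\<in>I. pmono x (f i))" for I :: "'n set" and f
    by (induction I rule: infinite_finite_induct) (simp_all add: pmono_add)
  show ?thesis
    unfolding wt_def sum pmono_UNIV by (simp add: nu_def pmono_add power_mult_distrib)
qed

text \<open>Any monomial of degree \<open>2 * t\<close> is a product of \<open>t\<close> quadratic
  ones: two variables are split off at a time.\<close>

lemma wt_image:
  "wt ` {M. monom_degree M = t} = {m. Poly_Mapping.keys m \<subseteq> {..<d} \<and> monom_degree m = 2 * t}"
proof (intro equalityI subsetI)
  fix m assume "m \<in> wt ` {M. monom_degree M = t}"
  then obtain M where M: "m = wt M" "monom_degree M = t" by auto
  have "Poly_Mapping.keys m \<subseteq> {..<d}"
  proof
    fix v assume "v \<in> Poly_Mapping.keys m"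
    then have "v \<in> (\<Union>i\<in>UNIV. Poly_Mapping.keys (Poly_Mapping.single (fst (pair_of i)) (Poly_Mapping.lookup M i)
      + Poly_Mapping.single (snd (pair_of i)) (Poly_Mapping.lookup M i)))"
      unfolding M wt_def by (rule subsetD[OF Poly_Mapping.keys_sum])
    then obtain i where "v \<in> Poly_Mapping.keys (Poly_Mapping.single (fst (pair_of i)) (Poly_Mapping.lookup M i)
      + Poly_Mapping.single (snd (pair_of i)) (Poly_Mapping.lookup M i))" by blast
    then have v: "v = fst (pair_of i) \<or> v = snd (pair_of i)"
      by (auto dest!: subsetD[OF Poly_Mapping.keys_add] split: if_splits)
    show "v \<in> {..<d}"
      by (rule pair_of_cases[of i]) (use v in auto)
  qed
  moreover have "monom_degree (\<Sum>i\<in>I. f i) = (\<Sum>i\<in>I. monom_degree (f i))" for I :: "'n set" and f :: "'n \<Rightarrow> nat \<Rightarrow>\<^sub>0 nat"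
    by (induction I rule: infinite_finite_induct) (simp_all add: monom_degree_add)
  then have "monom_degree m = (\<Sum>i\<in>UNIV. 2 * Poly_Mapping.lookup M i)"
    unfolding M wt_def by (simp add: monom_degree_add mult_2)
  then have "monom_degree m = 2 * t"
    using M(2) by (simp add: monom_degree_superset[of UNIV] sum_distrib_left[symmetric])
  ultimately show "m \<in> {m. Poly_Mapping.keys m \<subseteq> {..<d} \<and> monom_degree m = 2 * t}" by simp
next
  fix m :: "nat \<Rightarrow>\<^sub>0 nat" assume "m \<in> {m. Poly_Mapping.keys m \<subseteq> {..<d} \<and> monom_degree m = 2 * t}"
  then have "Poly_Mapping.keys m \<subseteq> {..<d}" "monom_degree m = 2 * t" by auto
  then show "m \<in> wt ` {M. monom_degree M = t}"
  proof (induction t arbitrary: m)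
    case 0
    then show ?case by (intro image_eqI[of _ _ 0]) auto
  next
    case (Suc t)
    then have "m \<noteq> 0" by auto
    then obtain j m1 where j: "j \<in> Poly_Mapping.keys m" "m = Poly_Mapping.single j 1 + m1"
      "Poly_Mapping.keys m1 \<subseteq> Poly_Mapping.keys m" "monom_degree m = Suc (monom_degree m1)"
      using monom_remove_variable by meson
    then have "m1 \<noteq> 0" using Suc.prems by auto
    then obtain k m2 where k: "k \<in> Poly_Mapping.keys m1" "m1 = Poly_Mapping.single k 1 + m2"
      "Poly_Mapping.keys m2 \<subseteq> Poly_Mapping.keys m1" "monom_degree m1 = Suc (monom_degree m2)"
      using monom_remove_variable by meson
    have jk: "j < d" "k < d" using j(1,3) k(1) Suc.prems by auto
    have "m2 \<in> wt ` {M. monom_degree M = t}"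
      using j(3,4) k(3,4) Suc.prems by (intro Suc.IH) auto
    then obtain M where M: "monom_degree M = t" "wt M = m2" by auto
    have "wt (Poly_Mapping.single (idx j k) 1 + M) = m"
      using j(2) k(2) M jk wt_single_idx[OF jk] by (simp add: wt_add add.assoc)
    moreover have "monom_degree (Poly_Mapping.single (idx j k) 1 + M) = Suc t"
      using M by (simp add: monom_degree_add)
    ultimately show ?case by (intro image_eqI[of _ _ "Poly_Mapping.single (idx j k) 1 + M"]) auto
  qed
qed

text \<open>On the cone a form depends only on the coefficient sums over the fibres of
  \<open>wt\<close>, and the resulting monomials in \<open>x\<close> are independent. One
  representative per fibre is therefore a basis modulo the ideal.\<close>

lemma hilbert_function_V:
  assumes t: "t > 0"
  shows "hilbert_function V t = (2 * t + d - 1) choose (2 * t)"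
proof -
  define J where "J = {m :: nat \<Rightarrow>\<^sub>0 nat. Poly_Mapping.keys m \<subseteq> {..<d} \<and> monom_degree m = 2 * t}"
  have J_eq: "J = wt ` {M. monom_degree M = t}" by (simp add: J_def wt_image)
  have finJ: "finite J" unfolding J_eq by (intro finite_imageI finite_monoms)
  define \<sigma> where "\<sigma> = inv_into {M. monom_degree M = t} wt"
  have \<sigma>: "monom_degree (\<sigma> m) = t" "wt (\<sigma> m) = m" if "m \<in> J" for m
    using that inv_into_into[of m wt "{M. monom_degree M = t}"] f_inv_into_f[of m wt "{M. monom_degree M = t}"]
    unfolding J_eq \<sigma>_def by auto
  have peval_sum': "peval (\<Sum>m\<in>J. pscale (c m) (Poly_Mapping.single (\<sigma> m) 1)) (vec_nth (nu x)) = (\<Sum>m\<in>J. c m * pmono x m)" for c x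
    by (simp add: peval_sum pmono_nu \<sigma>)
  have "cpoly.dim (homogeneous_forms t :: 'n cpoly set)
      = cpoly.dim (homogeneous_forms t \<inter> vanishing_ideal V) + card J"
  proof (rule cpoly.dim_eq_add_card_complement)
    show "cpoly.subspace (homogeneous_forms t \<inter> vanishing_ideal V)"
      by (intro cpoly.subspace_inter subspace_homogeneous_forms subspace_vanishing_ideal)
    show "cpoly.subspace (homogeneous_forms t :: 'n cpoly set)" by (rule subspace_homogeneous_forms)
    show "homogeneous_forms t \<subseteq> cpoly.span ((\<lambda>m. Poly_Mapping.single m 1) ` {m :: 'n \<Rightarrow>\<^sub>0 nat. monom_degree m = t})"
      by (rule homogeneous_forms_span)
    show "finite ((\<lambda>m. Poly_Mapping.single m 1 :: 'n cpoly) ` {m :: 'n \<Rightarrow>\<^sub>0 nat. monom_degree m = t})"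
      by (intro finite_imageI finite_monoms)
    show hom: "Poly_Mapping.single (\<sigma> m) 1 \<in> homogeneous_forms t" if "m \<in> J" for m
      using \<sigma>[OF that] by (simp add: homogeneous_forms_def)
    fix c assume "(\<Sum>m\<in>J. pscale (c m) (Poly_Mapping.single (\<sigma> m) 1)) \<in> homogeneous_forms t \<inter> vanishing_ideal V"
    then have zero: "(\<Sum>m\<in>J. c m * pmono x m) = 0" if "\<exists>j<d. x j \<noteq> 0" for x
      using that by (simp add: vanishing_ideal_V peval_sum')
    have "(\<Sum>m\<in>J. c m * pmono x m) = 0" for x
    \<comment> \<open>The ideal tests nonzero \<open>x\<close> only. If \<open>x\<close> vanishes on
      all indices below \<open>d\<close>, every monomial in \<open>J\<close> does too because
      \<open>t > 0\<close>, so the relation holds everywhere, as independence requires.\<close>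
    proof (cases "\<exists>j<d. x j \<noteq> 0")
      case False
      have "pmono x m = 0" if m: "m \<in> J" for m
      proof -
        have "m \<noteq> 0" using m t by (auto simp: J_def)
        then obtain v where v: "v \<in> Poly_Mapping.keys m" using monom_remove_variable by blast
        then have "v \<in> {..<d}" "Poly_Mapping.lookup m v > 0"
          using m unfolding J_def by (blast, simp add: in_keys_iff)
        then have "x v ^ Poly_Mapping.lookup m v = 0" using False by auto
        then show ?thesis unfolding pmono_def using v by (intro prod_zero) auto
      qed
      then show ?thesis by simp
    qed (rule zero)
    then show "\<forall>m\<in>J. c m = 0" using pmono_independent[OF finJ, of c] by blast
  next
    fix F :: "'n cpoly" assume F: "F \<in> homogeneous_forms t"
    define c where "c m = (\<Sum>M\<in>{M \<in> Poly_Mapping.keys F. wt M = m}. Poly_Mapping.lookup F M)" for m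
    let ?G = "F - (\<Sum>m\<in>J. pscale (c m) (Poly_Mapping.single (\<sigma> m) 1))"
    have "peval F (vec_nth (nu x)) = (\<Sum>m\<in>J. c m * pmono x m)" for x
    proof -
      have img: "wt ` Poly_Mapping.keys F \<subseteq> J"
        using F unfolding J_eq homogeneous_forms_def by auto
      have "peval F (vec_nth (nu x)) = (\<Sum>M\<in>Poly_Mapping.keys F. Poly_Mapping.lookup F M * pmono x (wt M))"
        by (simp add: peval_superset[of "Poly_Mapping.keys F" F] pmono_nu)
      also have "\<dots> = (\<Sum>m\<in>J. \<Sum>M\<in>{M \<in> Poly_Mapping.keys F. wt M = m}. Poly_Mapping.lookup F M * pmono x (wt M))"
        by (rule sum.group[symmetric]) (use finJ img in auto)
      also have "\<dots> = (\<Sum>m\<in>J. c m * pmono x m)"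
        unfolding c_def sum_distrib_right by (intro sum.cong) auto
      finally show ?thesis .
    qed
    then have "?G \<in> vanishing_ideal V"
      unfolding vanishing_ideal_V by (simp add: peval_diff peval_sum')
    moreover have "?G \<in> homogeneous_forms t"
      using F \<sigma> by (intro cpoly.subspace_diff cpoly.subspace_sum cpoly.subspace_scale subspace_homogeneous_forms)
        (auto simp: homogeneous_forms_def)
    ultimately show "\<exists>c. F - (\<Sum>m\<in>J. pscale (c m) (Poly_Mapping.single (\<sigma> m) 1)) \<in> homogeneous_forms t \<inter> vanishing_ideal V"
      by blast
  qed (use finJ in auto)
  then show ?thesis
    unfolding hilbert_function_def by (simp add: J_def card_monoms)
qed

text \<open>The binomial coefficient of \<open>2 t + d - 1\<close> over \<open>d - 1\<close> as a
  polynomial in \<open>t\<close>. The slopes 2 produce the degree \<open>2^(d - 1)\<close>.\<close>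

definition hilb :: "rat poly" where
  "hilb = Polynomial.smult (1 / fact (d - 1)) (\<Prod>i\<in>{1..d-1}. [:of_nat i, 2:])"

lemma hilbert_poly_V: "hilbert_poly V = hilb"
proof -
  have hilb: "poly hilb (of_nat t) = of_nat (hilbert_function V t)" if t: "t \<ge> 1" for t
  proof -
    have "poly hilb (of_nat t) = (\<Prod>i\<in>{1..d-1}. of_nat (2 * t) + of_nat i) / fact (d - 1)"
      by (simp add: hilb_def poly_prod add.commute mult.commute)
    also have "\<dots> = of_nat ((2 * t + (d - 1)) choose (d - 1))"
      unfolding binomial_prod[symmetric] by simp
    also have "(2 * t + (d - 1)) choose (d - 1) = (2 * t + d - 1) choose (2 * t)"
      using d binomial_symmetric[of "2 * t" "2 * t + (d - 1)"] by simp
    finally show ?thesis using t by (simp add: hilbert_function_V)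
  qed
  show ?thesis
    unfolding hilbert_poly_def
  proof (rule the_equality)
    show "\<exists>t0. \<forall>t\<ge>t0. poly hilb (of_nat t) = of_nat (hilbert_function V t)" using hilb by blast
    fix h :: "rat poly" assume "\<exists>t0. \<forall>t\<ge>t0. poly h (of_nat t) = of_nat (hilbert_function V t)"
    then obtain t0 where t0: "\<And>t. t \<ge> t0 \<Longrightarrow> poly h (of_nat t) = of_nat (hilbert_function V t)" by blast
    show "h = hilb"
    proof (rule ccontr)
      assume "h \<noteq> hilb"
      then have "finite {z. poly (h - hilb) z = 0}" by (intro poly_roots_finite) simp
      moreover have "of_nat ` {max t0 1..} \<subseteq> {z. poly (h - hilb) z = 0}" using t0 hilb by auto
      ultimately have "finite (of_nat ` {max t0 1..} :: rat set)" by (rule finite_subset[rotated])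
      then have "finite {max t0 1..}" by (rule finite_imageD) (simp add: inj_on_def)
      then show False by (simp add: infinite_Ici)
    qed
  qed
qed

lemma degree_hilb: "degree hilb = d - 1" and lead_coeff_hilb: "lead_coeff hilb = 2 ^ (d - 1) / fact (d - 1)"
proof -
  have "degree (\<Prod>i\<in>{1..d-1}. [:of_nat i, 2 :: rat:]) = (\<Sum>i\<in>{1..d-1}. degree [:of_nat i, 2 :: rat:])"
    by (rule degree_prod_sum_eq) auto
  then show "degree hilb = d - 1" by (simp add: hilb_def)
  have "lead_coeff (\<Prod>i\<in>{1..d-1}. [:of_nat i, 2 :: rat:]) = (\<Prod>i\<in>{1..d-1}. lead_coeff [:of_nat i, 2 :: rat:])"
    by (rule lead_coeff_prod)
  then have "lead_coeff (\<Prod>i\<in>{1..d-1}. [:of_nat i, 2 :: rat:]) = 2 ^ (d - 1)" by simp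
  then show "lead_coeff hilb = 2 ^ (d - 1) / fact (d - 1)"
    unfolding hilb_def lead_coeff_smult by simp
qed

lemma proj_dim_V: "proj_dim V = d - 1"
  by (simp add: proj_dim_def hilbert_poly_V degree_hilb)

lemma proj_degree_V: "proj_degree V = 2 ^ (d - 1)"
  by (simp add: proj_degree_def proj_dim_V hilbert_poly_V lead_coeff_hilb)

end


section \<open>Critical points\<close>

text \<open>At \<open>t = 0\<close> every power equals 1, so the product and quotient rules reduce
  to the logarithmic derivative.\<close>

lemma has_field_derivative_likelihood_ratio:
  fixes p u v :: "complex ^ 'n::finite"
  assumes p: "\<And>i. vec_nth p i \<noteq> 0" "(\<Sum>i\<in>UNIV. vec_nth p i) \<noteq> 0"
  shows "((\<lambda>t. likelihood_ratio u p (p + t *s v)) has_field_derivative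
    (\<Sum>i\<in>UNIV. vec_nth u i * (vec_nth v i / vec_nth p i))
      - (\<Sum>i\<in>UNIV. vec_nth u i) * ((\<Sum>i\<in>UNIV. vec_nth v i) / (\<Sum>i\<in>UNIV. vec_nth p i))) (at 0)"
proof -
  have factor: "((\<lambda>t. ((z + t * w) / z) powr c) has_field_derivative c * (w / z)) (at 0)"
    if "z \<noteq> 0" for z w c :: complex
  proof -
    have inner: "((\<lambda>t. (z + t * w) / z) has_field_derivative w / z) (at 0)"
      using that by (auto intro!: derivative_eq_intros)
    have "((\<lambda>y. y powr c) has_field_derivative c * 1 powr (c - 1)) (at 1)"
      by (rule has_field_derivative_powr) (simp add: complex_nonpos_Reals_iff)
    then have "((\<lambda>y. y powr c) has_field_derivative c) (at ((z + 0 * w) / z))"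
      using that by simp
    from DERIV_chain2[OF this inner] show ?thesis .
  qed
  let ?P = "\<lambda>t. \<Prod>i\<in>UNIV. ((vec_nth p i + t * vec_nth v i) / vec_nth p i) powr vec_nth u i"
  let ?S = "\<lambda>t. (((\<Sum>i\<in>UNIV. vec_nth p i) + t * (\<Sum>i\<in>UNIV. vec_nth v i)) / (\<Sum>i\<in>UNIV. vec_nth p i))
      powr (\<Sum>i\<in>UNIV. vec_nth u i)"
  have "(?P has_field_derivative (\<Sum>i\<in>UNIV. (vec_nth u i * (vec_nth v i / vec_nth p i)) *
      (\<Prod>j\<in>UNIV - {i}. ((vec_nth p j + 0 * vec_nth v j) / vec_nth p j) powr vec_nth u j))) (at 0)"
    by (rule has_field_derivative_prod) (rule factor[OF p(1)])
  then have P: "(?P has_field_derivative (\<Sum>i\<in>UNIV. vec_nth u i * (vec_nth v i / vec_nth p i))) (at 0)"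
    using p by simp
  have S: "(?S has_field_derivative (\<Sum>i\<in>UNIV. vec_nth u i) *
      ((\<Sum>i\<in>UNIV. vec_nth v i) / (\<Sum>i\<in>UNIV. vec_nth p i))) (at 0)"
    by (rule factor[OF p(2)])
  have "((\<lambda>t. ?P t / ?S t) has_field_derivative
    (\<Sum>i\<in>UNIV. vec_nth u i * (vec_nth v i / vec_nth p i))
      - (\<Sum>i\<in>UNIV. vec_nth u i) * ((\<Sum>i\<in>UNIV. vec_nth v i) / (\<Sum>i\<in>UNIV. vec_nth p i))) (at 0)"
    using DERIV_divide[OF P S] p by simp
  moreover have "likelihood_ratio u p (p + t *s v) = ?P t / ?S t" for t
    by (simp add: likelihood_ratio_def sum.distrib sum_distrib_left)
  ultimately show ?thesis by simp
qed

lemma proj_point_eqD: "proj_point p = proj_point q \<Longrightarrow> \<exists>k. k \<noteq> 0 \<and> q = k *s p"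
proof -
  assume "proj_point p = proj_point q"
  then have "q \<in> proj_point p" by (metis (mono_tags, lifting) CollectI proj_point_def vector_smult_lid zero_neq_one)
  then show ?thesis by (auto simp: proj_point_def)
qed

lemma proj_point_scale:
  assumes "k \<noteq> 0"
  shows "proj_point (k *s p) = proj_point p"
proof
  show "proj_point (k *s p) \<subseteq> proj_point p"
    using assms by (auto simp: proj_point_def vector_smult_assoc)
  show "proj_point p \<subseteq> proj_point (k *s p)"
  proof
    fix q assume "q \<in> proj_point p"
    then obtain c where c: "c \<noteq> 0" "q = c *s p" by (auto simp: proj_point_def)
    then have "q = (c / k) *s (k *s p)" "c / k \<noteq> 0" using assms by (simp_all add: vector_smult_assoc)
    then show "q \<in> proj_point (k *s p)" unfolding proj_point_def by blast
  qed
qed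

lemma in_likelihood_hyperplanes_iff:
  assumes "p \<noteq> 0"
  shows "proj_point p \<in> likelihood_hyperplanes \<longleftrightarrow> (\<exists>i. vec_nth p i = 0) \<or> (\<Sum>i\<in>UNIV. vec_nth p i) = 0"
proof
  assume "proj_point p \<in> likelihood_hyperplanes"
  then obtain q where q: "proj_point p = proj_point q" "(\<exists>i. vec_nth q i = 0) \<or> (\<Sum>i\<in>UNIV. vec_nth q i) = 0"
    by (auto simp: likelihood_hyperplanes_def)
  then obtain k where k: "k \<noteq> 0" "q = k *s p" using proj_point_eqD by blast
  then show "(\<exists>i. vec_nth p i = 0) \<or> (\<Sum>i\<in>UNIV. vec_nth p i) = 0"
    using q(2) by (auto simp: sum_distrib_left[symmetric])
next
  assume "(\<exists>i. vec_nth p i = 0) \<or> (\<Sum>i\<in>UNIV. vec_nth p i) = 0"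
  then show "proj_point p \<in> likelihood_hyperplanes"
    using assms unfolding likelihood_hyperplanes_def by blast
qed

section \<open>Likelihood equations on the cone\<close>

context veronese
begin

text \<open>A diagonal pair contributes \<open>f j j\<close> twice, hence the extra diagonal sum.
  This is the source of the shape \<open>x_j^2 + x_j S\<close>.\<close>

lemma sum_pairs_sym:
  fixes f :: "nat \<Rightarrow> nat \<Rightarrow> complex"
  shows "(\<Sum>(j, k)\<in>pairs. f j k + f k j) = (\<Sum>j<d. \<Sum>k<d. f j k) + (\<Sum>j<d. f j j)"
proof -
  have "(\<Sum>(j, k)\<in>pairs. f j k + f k j) = (\<Sum>(k, j)\<in>Sigma {..<d} (\<lambda>k. {..k}). f j k + f k j)"
    by (rule sum.reindex_bij_witness[of _ prod.swap prod.swap]) (auto simp: pairs_def)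
  also have "\<dots> = (\<Sum>k<d. \<Sum>j\<le>k. f j k + f k j)"
    by (simp add: sum.Sigma)
  also have "(\<Sum>k<m. \<Sum>j\<le>k. f j k + f k j) = (\<Sum>j<m. \<Sum>k<m. f j k) + (\<Sum>j<m. f j j)" for m
  proof (induction m)
    case (Suc m)
    have "(\<Sum>j\<le>m. f j m + f m j) = (\<Sum>j<m. f j m) + (\<Sum>j<m. f m j) + 2 * f m m"
      by (simp add: lessThan_Suc_atMost[symmetric] sum.distrib)
    moreover have "(\<Sum>k<Suc m. \<Sum>j\<le>k. f j k + f k j) = (\<Sum>k<m. \<Sum>j\<le>k. f j k + f k j) + (\<Sum>j\<le>m. f j m + f m j)"
      by (rule sum.lessThan_Suc)
    ultimately have "(\<Sum>k<Suc m. \<Sum>j\<le>k. f j k + f k j) = (\<Sum>j<m. \<Sum>k<m. f j k) + (\<Sum>j<m. f j j)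
        + ((\<Sum>j<m. f j m) + (\<Sum>j<m. f m j) + 2 * f m m)"
      by (simp only: Suc.IH)
    then show ?case by (simp only: sum.lessThan_Suc sum.distrib) simp
  qed simp
  finally show ?thesis .
qed

text \<open>The exponent of \<open>x_j\<close> in the product of the coordinates of
  \<open>nu x\<close> raised to the powers \<open>u\<close>: row \<open>j\<close> of the homogenised
  matrix applied to \<open>u\<close>, with entry 2 at the square of \<open>x_j\<close>.\<close>

definition \<beta> :: "nat \<Rightarrow> complex ^ 'n \<Rightarrow> complex" where
  "\<beta> j u = (\<Sum>k<d. vec_nth u (idx j k)) + vec_nth u (idx j j)"

lemma sum_\<beta>: "(\<Sum>j<d. \<beta> j u * z j) = (\<Sum>(j, k)\<in>pairs. vec_nth u (idx j k) * (z j + z k))"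
proof -
  have "(\<Sum>j<d. \<beta> j u * z j) = (\<Sum>j<d. \<Sum>k<d. vec_nth u (idx j k) * z j) + (\<Sum>j<d. vec_nth u (idx j j) * z j)"
    by (simp add: \<beta>_def distrib_right sum.distrib sum_distrib_right)
  also have "\<dots> = (\<Sum>(j, k)\<in>pairs. vec_nth u (idx j k) * z j + vec_nth u (idx k j) * z k)"
    by (rule sum_pairs_sym[symmetric])
  also have "\<dots> = (\<Sum>(j, k)\<in>pairs. vec_nth u (idx j k) * (z j + z k))"
    by (intro sum.cong) (auto simp: idx_sym[of _ "fst _"] distrib_left, simp add: idx_sym)
  finally show ?thesis .
qed

lemma sum_\<beta>_1: "(\<Sum>j<d. \<beta> j u) = 2 * (\<Sum>i\<in>UNIV. vec_nth u i)"
  using sum_\<beta>[of u "\<lambda>_. 1"] by (simp add: sum_idx sum_distrib_left case_prod_unfold mult.commute)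

lemma sum_dnu: "(\<Sum>i\<in>UNIV. vec_nth (dnu x y) i) = (\<Sum>j<d. (x j + (\<Sum>k<d. x k)) * y j)"
proof -
  have "(\<Sum>i\<in>UNIV. vec_nth (dnu x y) i) = (\<Sum>(j, k)\<in>pairs. x k * y j + x j * y k)"
    unfolding sum_idx by (rule sum.cong) (auto simp: pairs_def dnu_idx mult.commute)
  also have "\<dots> = (\<Sum>j<d. \<Sum>k<d. x k * y j) + (\<Sum>j<d. x j * y j)"
    by (rule sum_pairs_sym)
  finally show ?thesis by (simp add: distrib_right sum.distrib sum_distrib_right)
qed

lemma sum_nu: "2 * (\<Sum>i\<in>UNIV. vec_nth (nu x) i) = (\<Sum>j<d. (x j)\<^sup>2 + x j * (\<Sum>k<d. x k))"
proof -
  have "2 * vec_nth (nu x) i = vec_nth (dnu x x) i" for i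
    by (simp add: nu_def dnu_def)
  then have "2 * (\<Sum>i\<in>UNIV. vec_nth (nu x) i) = (\<Sum>i\<in>UNIV. vec_nth (dnu x x) i)"
    by (simp add: sum_distrib_left)
  then show ?thesis unfolding sum_dnu by (simp add: power2_eq_square algebra_simps)
qed

text \<open>If \<open>dnu x c\<close> vanishes and \<open>x l\<close> does not, the entry at
  \<open>(l, l)\<close> kills \<open>c l\<close> and the entries at \<open>(l, j)\<close> then kill
  the rest. The dimension is thus constant, so every point is smooth.\<close>

lemma dim_tangent_space:
  assumes x: "\<exists>j<d. x j \<noteq> 0"
  shows "vec.dim (tangent_space V (nu x)) = d"
proof -
  define w where "w j = dnu x (\<lambda>k. if k = j then 1 else 0)" for j
  have comb: "(\<Sum>j<d. y j *s w j) = dnu x y" for y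
  proof (rule vec_eq_idxI)
    fix j k assume jk: "j < d" "k < d"
    have "vec_nth (\<Sum>l<d. y l *s w l) (idx j k)
        = (\<Sum>l<d. x j * (if k = l then y l else 0) + (if j = l then y l else 0) * x k)"
      unfolding sum_component
      by (rule sum.cong) (auto simp: w_def dnu_idx jk)
    also have "\<dots> = x j * y k + y j * x k"
      using jk by (simp add: sum.distrib sum_distrib_left[symmetric] sum_distrib_right[symmetric])
    finally show "vec_nth (\<Sum>l<d. y l *s w l) (idx j k) = vec_nth (dnu x y) (idx j k)"
      using jk by (simp add: dnu_idx)
  qed
  obtain l where l: "l < d" "x l \<noteq> 0" using x by blast
  have zero: "\<forall>j\<in>{..<d}. c j = 0" if "(\<Sum>j<d. c j *s w j) = 0" for c
  proof
    have c0: "x j * c k + c j * x k = 0" if "j < d" "k < d" for j k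
      using dnu_idx[OF that, of x c] \<open>(\<Sum>j<d. c j *s w j) = 0\<close> by (simp add: comb)
    fix j assume j: "j \<in> {..<d}"
    have "c l = 0" using c0[OF l(1) l(1)] l(2) by (simp add: mult.commute)
    then show "c j = 0" using c0[of l j] l j by simp
  qed
  have "vec.dim (range (dnu x)) = card (w ` {..<d})"
  proof (rule vec.dim_unique[OF _ _ _ refl])
    show "w ` {..<d} \<subseteq> range (dnu x)" by (auto simp: w_def)
    show "range (dnu x) \<subseteq> vec.span (w ` {..<d})"
    proof
      fix v assume "v \<in> range (dnu x)"
      then obtain y where "v = (\<Sum>j<d. y j *s w j)" by (auto simp: comb)
      moreover have "(\<Sum>j<d. y j *s w j) \<in> vec.span (w ` {..<d})"
        by (intro vec.span_sum vec.span_scale vec.span_base) auto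
      ultimately show "v \<in> vec.span (w ` {..<d})" by simp
    qed
    show "vec.independent (w ` {..<d})"
      by (rule vec.independent_family(2)[OF _ zero]) simp
  qed
  also have "\<dots> = d"
    using card_image[OF vec.independent_family(1)[of "{..<d}" w, OF _ zero]] by simp
  finally show ?thesis using tangent_space_nu[OF x] by simp
qed

lemma regular_points_V: "regular_points V = V"
proof -
  have "\<forall>P\<in>V. \<forall>p\<in>P. vec.dim (tangent_space V p) = d"
    unfolding ball_V_iff using dim_tangent_space by blast
  then show ?thesis using d by (auto simp: regular_points_def proj_dim_V)
qed

lemma nu_coords_nonzero_iff: "(\<exists>i. vec_nth (nu x) i = 0) \<longleftrightarrow> (\<exists>j<d. x j = 0)"
proof
  assume "\<exists>i. vec_nth (nu x) i = 0"
  then obtain i where i: "vec_nth (nu x) i = 0" by blast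
  show "\<exists>j<d. x j = 0"
    by (rule pair_of_cases[of i]) (use i in \<open>auto simp: nu_def intro: le_less_trans\<close>)
next
  assume "\<exists>j<d. x j = 0"
  then obtain j where "j < d" "x j = 0" by blast
  then have "vec_nth (nu x) (idx j j) = 0" by (simp add: nu_idx)
  then show "\<exists>i. vec_nth (nu x) i = 0" by blast
qed

lemma critical_at_nu_iff:
  assumes x: "\<And>j. j < d \<Longrightarrow> x j \<noteq> 0" and Q: "(\<Sum>i\<in>UNIV. vec_nth (nu x) i) \<noteq> 0"
  shows "(\<forall>v\<in>tangent_space V (nu x).
       ((\<lambda>t. likelihood_ratio u (nu x) (nu x + t *s v)) has_field_derivative 0) (at 0)) \<longleftrightarrow>
    (\<forall>j<d. \<beta> j u * (\<Sum>i\<in>UNIV. vec_nth (nu x) i)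
      = (\<Sum>i\<in>UNIV. vec_nth u i) * ((x j)\<^sup>2 + x j * (\<Sum>k<d. x k)))"
proof -
  let ?Q = "\<Sum>i\<in>UNIV. vec_nth (nu x) i" and ?U = "\<Sum>i\<in>UNIV. vec_nth u i" and ?S = "\<Sum>k<d. x k"
  have nz: "vec_nth (nu x) i \<noteq> 0" for i using nu_coords_nonzero_iff[of x] x by blast
  have x': "\<exists>j<d. x j \<noteq> 0" using x[of 0] d by (intro exI[of _ 0]) simp
  \<comment> \<open>The coefficient of \<open>y j\<close> in the logarithmic derivative along
    \<open>dnu x y\<close>. As \<open>y\<close> is arbitrary, each coefficient must vanish; clearing
    \<open>x j\<close> and \<open>?Q\<close> gives the equations.\<close>
  define e where "e j = \<beta> j u / x j - ?U * (x j + ?S) / ?Q" for j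
  have deriv: "((\<lambda>t. likelihood_ratio u (nu x) (nu x + t *s dnu x y)) has_field_derivative
      (\<Sum>j<d. e j * y j)) (at 0)" for y
  proof -
    have frac: "vec_nth (dnu x y) (idx j k) / vec_nth (nu x) (idx j k) = y j / x j + y k / x k"
      if "(j, k) \<in> pairs" for j k
      using that x[of j] x[of k] by (simp add: pairs_def dnu_idx nu_idx add_divide_distrib add.commute)
    have "(\<Sum>i\<in>UNIV. vec_nth u i * (vec_nth (dnu x y) i / vec_nth (nu x) i)) = (\<Sum>j<d. \<beta> j u * (y j / x j))"
      unfolding sum_\<beta>[of u "\<lambda>j. y j / x j"]
        sum_idx[of "\<lambda>i. vec_nth u i * (vec_nth (dnu x y) i / vec_nth (nu x) i)"]
      by (rule sum.cong) (auto simp only: frac)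
    moreover have "?U * ((\<Sum>i\<in>UNIV. vec_nth (dnu x y) i) / ?Q) = (\<Sum>j<d. ?U * (x j + ?S) / ?Q * y j)"
      unfolding sum_dnu by (simp add: sum_distrib_left sum_divide_distrib mult_ac)
    ultimately have "(\<Sum>i\<in>UNIV. vec_nth u i * (vec_nth (dnu x y) i / vec_nth (nu x) i))
        - ?U * ((\<Sum>i\<in>UNIV. vec_nth (dnu x y) i) / ?Q) = (\<Sum>j<d. e j * y j)"
      by (simp add: e_def sum_subtractf left_diff_distrib)
    then show ?thesis using has_field_derivative_likelihood_ratio[OF nz Q, of u "dnu x y"] by simp
  qed
  have "(\<forall>v\<in>tangent_space V (nu x).
       ((\<lambda>t. likelihood_ratio u (nu x) (nu x + t *s v)) has_field_derivative 0) (at 0))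
      \<longleftrightarrow> (\<forall>y. (\<Sum>j<d. e j * y j) = 0)"
    unfolding tangent_space_nu[OF x'] ball_simps
    using deriv DERIV_unique by (metis (no_types, lifting))
  also have "\<dots> \<longleftrightarrow> (\<forall>j<d. e j = 0)"
  proof
    assume *: "\<forall>y. (\<Sum>j<d. e j * y j) = 0"
    show "\<forall>j<d. e j = 0"
    proof (intro allI impI)
      fix j assume "j < d"
      then have "(\<Sum>k<d. e k * (if k = j then 1 else 0)) = e j" by (simp add: if_distrib cong: if_cong)
      then show "e j = 0" using * by metis
    qed
  qed simp
  also have "\<dots> \<longleftrightarrow> (\<forall>j<d. \<beta> j u * ?Q = ?U * ((x j)\<^sup>2 + x j * ?S))"
    using x Q by (intro all_cong) (auto simp: e_def field_simps power2_eq_square)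
  finally show ?thesis .
qed

lemma critical_points_V:
  assumes U: "(\<Sum>i\<in>UNIV. vec_nth u i) \<noteq> 0" and \<beta>0: "\<And>j. j < d \<Longrightarrow> \<beta> j u \<noteq> 0"
  shows "critical_points V u = (\<lambda>x. proj_point (nu x)) ` quad_sols d (\<lambda>j. \<beta> j u)"
proof (intro equalityI subsetI)
  let ?U = "\<Sum>i\<in>UNIV. vec_nth u i"
  fix P assume P: "P \<in> critical_points V u"
  then have "P \<in> V" by (simp add: critical_points_def regular_points_V)
  then obtain x where x: "P = proj_point (nu x)" "\<exists>j<d. x j \<noteq> 0" by (auto simp: V_eq)
  let ?Q = "\<Sum>i\<in>UNIV. vec_nth (nu x) i"
  have "nu x \<noteq> 0" using x(2) nu_eq_0_iff by blast
  then have nz: "\<And>j. j < d \<Longrightarrow> x j \<noteq> 0" "?Q \<noteq> 0"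
    using P x(1) nu_coords_nonzero_iff[of x]
    by (auto simp: critical_points_def in_likelihood_hyperplanes_iff)
  have "\<forall>v\<in>tangent_space V (nu x).
       ((\<lambda>t. likelihood_ratio u (nu x) (nu x + t *s v)) has_field_derivative 0) (at 0)"
    using P self_in_proj_point[of "nu x"] unfolding x(1) critical_points_def by blast
  then have crit: "\<beta> j u * ?Q = ?U * ((x j)\<^sup>2 + x j * (\<Sum>k<d. x k))" if "j < d" for j
    using critical_at_nu_iff[OF nz] that by blast
  \<comment> \<open>This scale gives \<open>nu z\<close> the coordinate sum \<open>?U\<close> and
    removes \<open>?Q\<close> from the equations.\<close>
  define c where "c = csqrt (?U / ?Q)"
  have c2: "c\<^sup>2 = ?U / ?Q" by (simp add: c_def)
  define z where "z j = (if j < d then c * x j else 0)" for j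
  have sum: "(\<Sum>k<d. z k) = c * (\<Sum>k<d. x k)" by (simp add: z_def sum_distrib_left)
  have "(z j)\<^sup>2 + z j * (\<Sum>k<d. z k) = \<beta> j u" if j: "j < d" for j
  proof -
    have "(z j)\<^sup>2 + z j * (\<Sum>k<d. z k) = c\<^sup>2 * ((x j)\<^sup>2 + x j * (\<Sum>k<d. x k))"
      unfolding sum using j by (simp add: z_def power2_eq_square algebra_simps)
    also have "\<dots> = (?U * ((x j)\<^sup>2 + x j * (\<Sum>k<d. x k))) / ?Q" by (simp add: c2)
    also have "\<dots> = \<beta> j u" using crit[OF j, symmetric] nz(2) by simp
    finally show ?thesis .
  qed
  then have "z \<in> quad_sols d (\<lambda>j. \<beta> j u)" by (simp add: quad_sols_def z_def)
  moreover have "nu z = c\<^sup>2 *s nu x"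
    unfolding nu_scale[symmetric] by (rule vec_eq_idxI) (simp add: nu_idx z_def)
  then have "proj_point (nu z) = P" using x(1) U nz(2) by (simp add: proj_point_scale c2)
  ultimately show "P \<in> (\<lambda>x. proj_point (nu x)) ` quad_sols d (\<lambda>j. \<beta> j u)" by blast
next
  let ?U = "\<Sum>i\<in>UNIV. vec_nth u i"
  fix P assume "P \<in> (\<lambda>x. proj_point (nu x)) ` quad_sols d (\<lambda>j. \<beta> j u)"
  then obtain x where P: "P = proj_point (nu x)" and
    x: "\<And>j. j < d \<Longrightarrow> (x j)\<^sup>2 + x j * (\<Sum>k<d. x k) = \<beta> j u" by (auto simp: quad_sols_def)
  have x0: "x j \<noteq> 0" if "j < d" for j using x[OF that] \<beta>0[OF that] by auto
  have x': "\<exists>j<d. x j \<noteq> 0" using x0[of 0] d by (intro exI[of _ 0]) simp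
  \<comment> \<open>Adding all equations recovers the normalisation, so the point automatically
    avoids the hyperplane of coordinate sum zero.\<close>
  have "2 * (\<Sum>i\<in>UNIV. vec_nth (nu x) i) = (\<Sum>j<d. \<beta> j u)"
    unfolding sum_nu by (rule sum.cong) (simp_all add: x)
  then have Q: "(\<Sum>i\<in>UNIV. vec_nth (nu x) i) = ?U" by (simp add: sum_\<beta>_1)
  have "P \<in> V" using P x' by (auto simp: V_eq)
  moreover have "P \<notin> likelihood_hyperplanes"
  proof -
    have "nu x \<noteq> 0" using x' nu_eq_0_iff by blast
    moreover have "\<not> (\<exists>i. vec_nth (nu x) i = 0)"
      unfolding nu_coords_nonzero_iff using x0 by blast
    ultimately show ?thesis unfolding P by (subst in_likelihood_hyperplanes_iff) (simp_all add: Q U)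
  qed
  moreover have "\<forall>v\<in>tangent_space V p. ((\<lambda>t. likelihood_ratio u p (p + t *s v)) has_field_derivative 0) (at 0)"
    if "p \<in> P" for p
  proof -
    have "p \<in> proj_point (nu x)" using that P by simp
    then obtain c where c: "c \<noteq> 0" "p = nu (\<lambda>j. c * x j)" using in_proj_point_nu by meson
    have Qc: "(\<Sum>i\<in>UNIV. vec_nth (nu (\<lambda>j. c * x j)) i) = c\<^sup>2 * ?U"
      unfolding nu_scale by (simp add: sum_distrib_left[symmetric] Q)
    have eq: "\<beta> j u * (c\<^sup>2 * ?U) = ?U * ((c * x j)\<^sup>2 + c * x j * (\<Sum>k<d. c * x k))" if "j < d" for j
      unfolding x[OF that, symmetric] sum_distrib_left[symmetric] by (simp add: power2_eq_square algebra_simps)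
    show ?thesis
      unfolding c(2)
    proof (rule iffD2[OF critical_at_nu_iff])
      show "c * x j \<noteq> 0" if "j < d" for j using c(1) x0[OF that] by simp
      show "(\<Sum>i\<in>UNIV. vec_nth (nu (\<lambda>j. c * x j)) i) \<noteq> 0" unfolding Qc using c(1) U by simp
      show "\<forall>j<d. \<beta> j u * (\<Sum>i\<in>UNIV. vec_nth (nu (\<lambda>j. c * x j)) i)
          = ?U * ((c * x j)\<^sup>2 + c * x j * (\<Sum>k<d. c * x k))"
        unfolding Qc using eq by blast
    qed
  qed
  ultimately show "P \<in> critical_points V u"
    by (simp add: critical_points_def regular_points_V)
qed

lemma card_critical_points_V:
  assumes U: "(\<Sum>i\<in>UNIV. vec_nth u i) \<noteq> 0" and \<beta>0: "\<And>j. j < d \<Longrightarrow> \<beta> j u \<noteq> 0"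
  shows "finite (critical_points V u)"
    and "card (quad_sols d (\<lambda>j. \<beta> j u)) = 2 * card (critical_points V u)"
proof -
  let ?Z = "quad_sols d (\<lambda>j. \<beta> j u)" and ?f = "\<lambda>x. proj_point (nu x)"
  have eq: "critical_points V u = ?f ` ?Z" by (rule critical_points_V[OF U]) (rule \<beta>0)
  show "finite (critical_points V u)" unfolding eq by (intro finite_imageI quad_sols_finite)
  have fibre: "card {y \<in> ?Z. ?f y = ?f x} = 2" if x: "x \<in> ?Z" for x
  proof -
    have sol: "(x j)\<^sup>2 + x j * (\<Sum>k<d. x k) = \<beta> j u" if "j < d" for j
      using x that by (simp add: quad_sols_def)
    have x0: "x 0 \<noteq> 0" using sol[of 0] \<beta>0[of 0] d by auto
    have "{y \<in> ?Z. ?f y = ?f x} = {x, \<lambda>j. - x j}"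
    proof (intro equalityI subsetI)
      fix y assume y: "y \<in> {y \<in> ?Z. ?f y = ?f x}"
      then have "nu y \<in> proj_point (nu x)" using self_in_proj_point[of "nu y"] by simp
      then obtain c where c: "nu y = nu (\<lambda>j. c * x j)" using in_proj_point_nu by blast
      have prod: "y j * y k = c\<^sup>2 * (x j * x k)" if "j < d" "k < d" for j k
        using arg_cong[OF c, of "\<lambda>v. vec_nth v (idx j k)"] that
        by (simp add: nu_idx power2_eq_square mult_ac)
      \<comment> \<open>The left side of the system is quadratic, so comparing both solutions at
        index 0 forces \<open>c^2 = 1\<close>, hence \<open>y\<close> is \<open>x\<close> or its
        negative.\<close>
      have "\<beta> 0 u = y 0 * y 0 + (\<Sum>k<d. y 0 * y k)"
        using y d by (auto simp: quad_sols_def power2_eq_square sum_distrib_left)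
      also have "\<dots> = c\<^sup>2 * (x 0 * x 0) + (\<Sum>k<d. c\<^sup>2 * (x 0 * x k))"
        using d by (intro arg_cong2[of _ _ _ _ "(+)"] sum.cong prod) auto
      also have "\<dots> = c\<^sup>2 * ((x 0)\<^sup>2 + x 0 * (\<Sum>k<d. x k))"
        by (simp add: sum_distrib_left power2_eq_square distrib_left)
      also have "\<dots> = c\<^sup>2 * \<beta> 0 u" using sol[of 0] d by simp
      finally have "c\<^sup>2 = 1" using \<beta>0[of 0] d by simp
      then have prod1: "y j * y k = x j * x k" if "j < d" "k < d" for j k using prod[OF that] by simp
      then have "(y 0)\<^sup>2 = (x 0)\<^sup>2" using d by (simp add: power2_eq_square)
      then consider "y 0 = x 0" | "y 0 = - x 0" by (auto simp: power2_eq_iff)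
      then have "(\<forall>j<d. y j = x j) \<or> (\<forall>j<d. y j = - x j)"
      proof cases
        case 1
        then show ?thesis using prod1[of 0] x0 d by auto
      next
        case 2
        have "y j = - x j" if "j < d" for j
        proof -
          have "x 0 * (y j + x j) = 0"
            using prod1[of 0 j] that d 2 by (simp add: distrib_left neg_eq_iff_add_eq_0)
          then show ?thesis using x0 by (simp add: eq_neg_iff_add_eq_0)
        qed
        then show ?thesis by blast
      qed
      moreover have "\<forall>j\<ge>d. y j = 0 \<and> x j = 0" using x y by (simp add: quad_sols_def)
      ultimately have "(\<forall>j. y j = x j) \<or> (\<forall>j. y j = - x j)" by (metis not_le neg_0_equal_iff_equal)
      then show "y \<in> {x, \<lambda>j. - x j}" by auto
    next
      fix y assume "y \<in> {x, \<lambda>j. - x j}"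
      moreover have "(\<lambda>j. - x j) \<in> ?Z" using x by (simp add: quad_sols_def sum_negf)
      moreover have "nu (\<lambda>j. - x j) = nu x" by (simp add: nu_def)
      ultimately show "y \<in> {y \<in> ?Z. ?f y = ?f x}" using x by auto
    qed
    moreover have "x \<noteq> (\<lambda>j. - x j)"
    proof
      assume "x = (\<lambda>j. - x j)"
      then have "x 0 = - x 0" by (rule fun_cong)
      then show False using x0 by simp
    qed
    ultimately show ?thesis by simp
  qed
  have "card ?Z = (\<Sum>P\<in>?f ` ?Z. card {y \<in> ?Z. ?f y = P})"
    using sum.image_gen[OF quad_sols_finite, of "\<lambda>_. 1 :: nat" d "\<lambda>j. \<beta> j u" ?f] by simp
  also have "\<dots> = (\<Sum>P\<in>?f ` ?Z. 2)" by (rule sum.cong) (use fibre in auto)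
  finally show "card ?Z = 2 * card (critical_points V u)" unfolding eq by simp
qed

lemma mldeg_V: "mldeg V = 2 ^ (d - 1)"
proof -
  let ?X = "range (\<lambda>i (u :: complex ^ 'n). vec_nth u i)"
  have coord: "(\<lambda>u. vec_nth u i) \<in> polyfun ?X" for i by (rule polyfun.base) blast
  have \<beta>: "\<beta> j \<in> polyfun ?X" for j
    unfolding \<beta>_def by (intro polyfun.add polyfun_sum coord)
  have surj: "\<exists>u. \<forall>j<d. \<beta> j u = c j" for c
  proof (intro exI allI impI)
    fix j assume j: "j < d"
    \<comment> \<open>Supported on the diagonal indices and halved there, since
      \<open>\<beta>\<close> counts a diagonal entry twice.\<close>
    let ?u = "\<chi> i. if fst (pair_of i) = snd (pair_of i) then c (fst (pair_of i)) / 2 else 0"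
    have u: "vec_nth ?u (idx j k) = (if k = j then c j / 2 else 0)" if "k < d" for k
      using that j pair_of_idx[of j k] pair_of_idx[of k j] idx_sym[of j k]
      by (cases "j \<le> k") auto
    have "(\<Sum>k<d. vec_nth ?u (idx j k)) = (\<Sum>k<d. if k = j then c j / 2 else 0)"
      by (rule sum.cong) (auto simp: u simp del: vec_lambda_beta)
    also have "\<dots> = c j / 2" using j by simp
    finally have s: "(\<Sum>k<d. vec_nth ?u (idx j k)) = c j / 2" .
    show "\<beta> j ?u = c j" unfolding \<beta>_def s u[OF j] by simp
  qed
  obtain D u0 where D: "D \<in> polyfun ?X" "D u0 \<noteq> 0" and pos: "\<And>j. j < d \<Longrightarrow> \<exists>t>0. \<beta> j u0 = of_real t"
    and card_sols: "\<And>u. D u \<noteq> 0 \<Longrightarrow> card (quad_sols d (\<lambda>j. \<beta> j u)) = 2 ^ d"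
    using generic_card_quad_sols[of d \<beta> ?X, OF _ \<beta> surj] d by auto
  have "(\<lambda>u. D u * (\<Sum>i\<in>UNIV. vec_nth u i) * (\<Prod>j<d. \<beta> j u)) \<in> polyfun ?X"
    by (intro polyfun.mult D polyfun_sum polyfun_prod coord \<beta>)
  then obtain G :: "'n cpoly" where
    G: "\<And>u. D u * (\<Sum>i\<in>UNIV. vec_nth u i) * (\<Prod>j<d. \<beta> j u) = peval G (vec_nth u)"
    using polyfun_imp_peval by blast
  obtain t where t: "\<And>j. j < d \<Longrightarrow> t j > 0 \<and> \<beta> j u0 = of_real (t j)" using pos by metis
  \<comment> \<open>Positivity of all \<open>\<beta> j u0\<close> keeps their sum and product
    nonzero, so the three generic conditions hold together at \<open>u0\<close>.\<close>
  have "2 * (\<Sum>i\<in>UNIV. vec_nth u0 i) = of_real (\<Sum>j<d. t j)"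
    unfolding sum_\<beta>_1[symmetric] of_real_sum using t by (intro sum.cong) auto
  moreover have "(\<Sum>j<d. t j) > 0" using t d by (intro sum_pos) (auto simp: lessThan_empty_iff)
  then have "complex_of_real (\<Sum>j<d. t j) \<noteq> 0" by (simp only: of_real_eq_0_iff)
  ultimately have "(\<Sum>i\<in>UNIV. vec_nth u0 i) \<noteq> 0" by (metis mult_zero_right)
  moreover have "(\<Prod>j<d. \<beta> j u0) \<noteq> 0" using t by force
  ultimately have "peval G (vec_nth u0) \<noteq> 0" unfolding G[symmetric] using D(2) by simp
  then have "G \<noteq> 0" by auto
  have crit: "finite (critical_points V u) \<and> card (critical_points V u) = 2 ^ (d - 1)"
    if "peval G (vec_nth u) \<noteq> 0" for u
  proof -
    have nz: "D u \<noteq> 0" "(\<Sum>i\<in>UNIV. vec_nth u i) \<noteq> 0" "\<And>j. j < d \<Longrightarrow> \<beta> j u \<noteq> 0"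
      using that unfolding G[symmetric] by auto
    have "2 * card (critical_points V u) = 2 ^ d"
      using card_critical_points_V(2)[OF nz(2,3)] card_sols[OF nz(1)] by simp
    also have "\<dots> = 2 * 2 ^ (d - 1)" using d by (simp add: power_eq_if)
    finally show ?thesis using card_critical_points_V(1)[OF nz(2,3)] by simp
  qed
  show ?thesis
    unfolding mldeg_def
  proof (rule the_equality)
    show "\<exists>G :: 'n cpoly. G \<noteq> 0 \<and> (\<forall>u. peval G (vec_nth u) \<noteq> 0 \<longrightarrow>
        finite (critical_points V u) \<and> card (critical_points V u) = 2 ^ (d - 1))"
      using \<open>G \<noteq> 0\<close> crit by blast
    fix N assume "\<exists>G :: 'n cpoly. G \<noteq> 0 \<and> (\<forall>u. peval G (vec_nth u) \<noteq> 0 \<longrightarrow>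
        finite (critical_points V u) \<and> card (critical_points V u) = N)"
    then obtain G' :: "'n cpoly" where G': "G' \<noteq> 0"
      "\<And>u. peval G' (vec_nth u) \<noteq> 0 \<Longrightarrow> card (critical_points V u) = N" by blast
    obtain u where "peval G (vec_nth u) \<noteq> 0" "peval G' (vec_nth u) \<noteq> 0"
      using peval_common_nonzero[OF \<open>G \<noteq> 0\<close> G'(1)] by blast
    then show "N = 2 ^ (d - 1)" using crit G'(2) by metis
  qed
qed

end

section \<open>The principal \<open>A\<close>-determinant\<close>

text \<open>The variable restores the exponent lowered by differentiation, so the operator only
  scales coefficients.\<close>

lemma lookup_toric_derivative:
  fixes F :: "'v cpoly"
  shows
  "Poly_Mapping.lookup (pvar v * partial_deriv v F) m = of_nat (Poly_Mapping.lookup m v) * Poly_Mapping.lookup F m"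
proof -
  have "pvar v * partial_deriv v F = (\<Sum>m\<in>Poly_Mapping.keys F. Poly_Mapping.single m
        (of_nat (Poly_Mapping.lookup m v) * Poly_Mapping.lookup F m))"
    unfolding partial_deriv_def sum_distrib_left pvar_def mult_single
  proof (rule sum.cong[OF refl])
    fix m :: "'v \<Rightarrow>\<^sub>0 nat"
    have "Poly_Mapping.single v 1 + (m - Poly_Mapping.single v 1) = m" if "Poly_Mapping.lookup m v \<noteq> 0"
      using that by (intro poly_mapping_eqI) (auto simp: lookup_add lookup_minus lookup_single when_def)
    then show "Poly_Mapping.single (Poly_Mapping.single v 1 + (m - Poly_Mapping.single v 1))
        (1 * (of_nat (Poly_Mapping.lookup m v) * Poly_Mapping.lookup F m))
      = Poly_Mapping.single m (of_nat (Poly_Mapping.lookup m v) * Poly_Mapping.lookup F m)"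
      by (cases "Poly_Mapping.lookup m v = 0") auto
  qed
  then show ?thesis
    by (simp add: lookup_sum lookup_single when_def not_in_keys_iff_lookup_eq_zero)
qed

context veronese
begin

lemma inj_a: "inj a"
  using bij_a by (rule bij_betw_imp_inj_on)

lemma lookup_support_poly: "Poly_Mapping.lookup (support_poly a (\<chi> i. 1)) m = (if m \<in> range a then 1 else 0)"
proof -
  have "Poly_Mapping.lookup (support_poly a (\<chi> i. 1)) m = (\<Sum>i\<in>UNIV. if a i = m then 1 else 0)"
    by (simp add: support_poly_def lookup_sum lookup_single when_def)
  also have "\<dots> = of_nat (card {i. a i = m})"
    by (simp add: sum.If_cases)
  also have "card {i. a i = m} = (if m \<in> range a then 1 else 0)"
  proof (cases "m \<in> range a")
    case True
    then obtain i where "m = a i" by blast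
    then have "{i. a i = m} = {i}" using injD[OF inj_a] by blast
    then show ?thesis using True by simp
  qed auto
  finally show ?thesis by simp
qed

text \<open>A zero of the determinant yields a common zero \<open>nu x\<close> of the toric
  derivatives. There each \<open>x_j\<close> is 0 or \<open>-S\<close>, and summing forces
  \<open>S = 0\<close> and hence \<open>x_j = 0\<close> for all \<open>j < d\<close>.\<close>

lemma ones_notin_Sigma_A:
  assumes "is_A_resultant a d R"
  shows "(\<chi> i. 1) \<notin> Sigma_A a R"
proof
  let ?f = "support_poly a (\<chi> i. 1)"
  assume "(\<chi> i. 1) \<in> Sigma_A a R"
  then have "eval_coeffs a R (toric_derivatives ?f) = 0"
    by (simp add: Sigma_A_def principal_A_det_def)
  moreover have "Poly_Mapping.keys (toric_derivatives ?f j) \<subseteq> range a" for j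
    by (auto simp: toric_derivatives_def in_keys_iff lookup_toric_derivative lookup_support_poly split: if_splits)
  ultimately obtain P where P: "P \<in> V" "\<forall>p\<in>P. \<forall>j\<in>{1..d}. L_form a (toric_derivatives ?f j) p = 0"
    using assms unfolding is_A_resultant_def by blast
  then obtain x where x: "P = proj_point (nu x)" "\<exists>j<d. x j \<noteq> 0" by (auto simp: V_eq)
  have L: "L_form a (toric_derivatives ?f j) (nu x) = 0" if "j \<in> {1..d}" for j
    using P(2) x(1) self_in_proj_point that by blast
  define S where "S = (\<Sum>k<d. x k)"
  have "L_form a (toric_derivatives ?f 1) (nu x) = (\<Sum>i\<in>UNIV. vec_nth (nu x) i)"
    by (simp add: L_form_def toric_derivatives_def lookup_support_poly)
  then have "(\<Sum>j<d. (x j)\<^sup>2 + x j * S) = 0"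
    using L[of 1] d sum_nu[of x] by (simp add: S_def)
  \<comment> \<open>Index 0 has no toric derivative of its own; its equation is what remains of
    \<open>f\<close> once the other equations are subtracted.\<close>
  then have total: "((x 0)\<^sup>2 + x 0 * S) + (\<Sum>j\<in>{1..<d}. (x j)\<^sup>2 + x j * S) = 0"
    using d by (simp add: lessThan_atLeast0 sum.atLeast_Suc_lessThan)
  have pos: "(x j)\<^sup>2 + x j * S = 0" if j: "j \<in> {1..<d}" for j
  proof -
    have "L_form a (toric_derivatives ?f (j + 1)) (nu x)
        = (\<Sum>i\<in>UNIV. of_nat (Poly_Mapping.lookup (a i) j) * vec_nth (nu x) i)"
      using j by (simp add: L_form_def toric_derivatives_def lookup_toric_derivative lookup_support_poly)
    also have "\<dots> = (\<Sum>(k, l)\<in>pairs. (if k = j then x k * x l else 0) + (if l = j then x l * x k else 0))"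
      unfolding sum_idx using j
      by (intro sum.cong) (auto simp: pairs_def a_idx nu_idx lookup_add lookup_unit_exp)
    also have "\<dots> = (\<Sum>k<d. \<Sum>l<d. if k = j then x k * x l else 0) + (\<Sum>k<d. if k = j then x k * x k else 0)"
      by (rule sum_pairs_sym)
    also have "(\<Sum>k<d. \<Sum>l<d. if k = j then x k * x l else 0) = (\<Sum>k<d. if k = j then x k * S else 0)"
      by (intro sum.cong) (auto simp: S_def sum_distrib_left)
    also have "\<dots> + (\<Sum>k<d. if k = j then x k * x k else 0) = x j * S + x j * x j"
      using j by simp
    finally show ?thesis using L[of "j + 1"] j by (simp add: power2_eq_square add.commute)
  qed
  have all: "(x j)\<^sup>2 + x j * S = 0" if j: "j < d" for j
  proof (cases "j = 0")
    case True
    have "(\<Sum>j\<in>{1..<d}. (x j)\<^sup>2 + x j * S) = 0" by (rule sum.neutral) (use pos in auto)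
    then show ?thesis using total True by simp
  qed (use pos j in auto)
  have cases: "x j = (if x j = 0 then 0 else - S)" if j: "j < d" for j
  proof -
    have "x j * (x j + S) = 0" using all[OF j] by (simp add: power2_eq_square distrib_left)
    then show ?thesis by (auto simp: eq_neg_iff_add_eq_0)
  qed
  \<comment> \<open>If \<open>m\<close> of the coordinates are nonzero, this says
    \<open>S = - m S\<close>; the factor \<open>m + 1\<close> cannot vanish.\<close>
  have "S = (\<Sum>j<d. if x j = 0 then 0 else - S)"
    unfolding S_def[symmetric] by (subst (1) S_def, rule sum.cong) (use cases in auto)
  also have "\<dots> = - (of_nat (card {j. j < d \<and> x j \<noteq> 0}) * S)"
    by (simp add: sum.If_cases lessThan_def Int_def Compl_eq)
  finally have "of_nat (Suc (card {j. j < d \<and> x j \<noteq> 0})) * S = 0"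
    by (simp add: algebra_simps eq_neg_iff_add_eq_0)
  then have "S = 0" by (simp del: of_nat_Suc)
  have "x j = 0" if "j < d" for j
    using cases[OF that] by (simp only: \<open>S = 0\<close> minus_zero if_cancel)
  then show False using x(2) by blast
qed

end

theorem proposition24:
  fixes d :: nat and a :: "'n::finite \<Rightarrow> nat \<Rightarrow>\<^sub>0 nat"
  assumes "d \<ge> 2"
    and "bij_betw a UNIV (veronese_columns d)"
  shows "(\<forall>R. is_A_resultant a d R \<longrightarrow> (\<chi> i. 1) \<notin> Sigma_A a R) \<and>
    of_nat (mldeg (toric_variety a d (\<chi> i. 1))) = proj_degree (toric_variety a d (\<chi> i. 1)) \<and>
    proj_degree (toric_variety a d (\<chi> i. 1)) = 2 ^ (d - 1)"
proof -
  interpret veronese d a using assms by unfold_locales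
  show ?thesis using ones_notin_Sigma_A by (simp add: mldeg_V proj_degree_V)
qed

end
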